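(* Suppose $\sigma\in L^{\infty}(\mathbb{D}(0,R))$ is real-valued and has a radial limit $\tilde\sigma$. Then, for every continuous function $\psi:[\inf\sigma,\sup\sigma]\to\mathbb{C}$, $$\lim_{N\to\infty}\frac{1}{N+1}\operatorname{tr}\bigl(\psi(P_{N}T_{\sigma}P_{N})\bigr)=\int_{0}^{2\pi}\psi\bigl(\tilde{\sigma}(\theta)\bigr)\frac{d\theta}{2\pi}.$$
   Context: Let $\{c_n\}_{n\ge 0}$ be a sequence with $c_n>0$ for all $n$, such that $\{c_{n+1}/c_n\}$ is monotonic, and let $R=\lim_{n\to\infty}c_{n+1}/c_n\in(0,\infty]$ ($R=\infty$ if the limit diverges). Assume $\{c_n\}$ is the moment sequence of an absolutely continuous finite (positive) measure $d\mu(r)=\mu(r)\,dr$ with $\operatorname{supp}(\mu)=[0,R]$ ($[0,\infty)$ if $R=\infty$), i.e. $c_n=\int_0^R r^n\mu(r)\,dr$. If $R=\infty$, assume additionally that for every $m\in\mathbb{N}$, $\frac{c_{2l+m+1}}{\sqrt{c_{2l+2m+1}}\sqrt{c_{2l+1}}}\to 1$ as $l\to\infty$. $\mathbb{D}(0,R)=\{z\in\mathbb{C}:|z|<R\}$ (all of $\mathbb{C}$ if $R=\infty$), and $d\nu(z)=\mu(|z|)\frac{dz}{2\pi}$, where $dz$ is area measure. $\mathcal{H}_c$ is the space of analytic functions $f(z)=\sum_{n\ge0}a_nz^n$, $|z|<R$, with $\|f\|_c^2=\sum_{n\ge0}|a_n|^2c_{2n+1}<\infty$; it is a closed subspace of $L^2(\mathbb{D}(0,R),\nu)$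 with the same norm, with orthonormal basis $z^n/\sqrt{c_{2n+1}}$, $n\ge 0$. Let $P:L^2(\mathbb{D}(0,R),\nu)\to\mathcal{H}_c$ be the orthogonal projection. For $\sigma\in L^\infty(\mathbb{D}(0,R))$ the Toeplitz operator $T_\sigma:\mathcal{H}_c\to\mathcal{H}_c$ is $T_\sigma f=P(\sigma f)$. Let $\mathcal{K}_N=\operatorname{span}\{z^n/\sqrt{c_{2n+1}}:n=0,1,\dots,N\}$ and let $P_N$ be the orthogonal projection onto $\mathcal{K}_N$. The operator $P_NT_\sigma P_N$ is regarded as an operator on the $(N+1)$-dimensional space $\mathcal{K}_N$; it is self-adjoint for real $\sigma$, and $\psi(P_NT_\sigma P_N)$ (functional calculus) and its trace are taken on $\mathcal{K}_N$. Symbols $\sigma$ are understood as bounded measurable functions, so that pointwise limits, $\inf\sigma$ and $\sup\sigma$ make sense. A real-valued $\sigma\in L^\infty(\mathbb{D}(0,R))$ has a radial limit if $\tilde\sigma(\theta):=\lim_{r\to R^-}\sigma(re^{i\theta})$ exists for almost every $\theta\in[0,2\pi)$. *)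

theory Defs
  imports "HOL-Analysis.Analysis"
begin

definition disc :: "ereal \<Rightarrow> complex set" where
  "disc R = {z. ereal (cmod z) < R}"

definition radii :: "ereal \<Rightarrow> real set" where
  "radii R = {r. 0 \<le> r \<and> ereal r \<le> R}"

text \<open>The topological support of a Borel measure; it is applied to the measure with density
  \<open>w\<close> rather than to \<open>w\<close> itself, so it does not depend on the representative of \<open>w\<close>.\<close>

definition msupport :: "'a::topological_space measure \<Rightarrow> 'a set" where
  "msupport M = {x. \<forall>U. open U \<and> x \<in> U \<longrightarrow> emeasure M U > 0}"

definition radial_measure :: "(real \<Rightarrow> real) \<Rightarrow> ereal \<Rightarrow> complex measure" where
  "radial_measure w R =
     density (lebesgue_on (disc R)) (\<lambda>z. ennreal (w (cmod z) / (2 * pi)))"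

definition L2_inner ::
  "complex measure \<Rightarrow> (complex \<Rightarrow> complex) \<Rightarrow> (complex \<Rightarrow> complex) \<Rightarrow> complex" where
  "L2_inner M f g = (LINT z|M. f z * cnj (g z))"

text \<open>Elements of the function spaces below are functions on the disc. They are extended by \<open>0\<close>
  to the whole plane, so that equality of HOL functions is equality on the disc.\<close>

definition Hc :: "(nat \<Rightarrow> real) \<Rightarrow> ereal \<Rightarrow> (complex \<Rightarrow> complex) set" where
  "Hc c R = {f. (\<forall>z. z \<notin> disc R \<longrightarrow> f z = 0) \<and>
     (\<exists>a. (\<forall>z\<in>disc R. (\<lambda>n. a n * z ^ n) sums f z) \<and>
          summable (\<lambda>n. (cmod (a n))\<^sup>2 * c (2 * n + 1)))}"

definition mono_basis :: "(nat \<Rightarrow> real) \<Rightarrow> ereal \<Rightarrow> nat \<Rightarrow> complex \<Rightarrow> complex" where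
  "mono_basis c R n =
     (\<lambda>z. if z \<in> disc R then z ^ n / complex_of_real (sqrt (c (2 * n + 1))) else 0)"

definition KN :: "(nat \<Rightarrow> real) \<Rightarrow> ereal \<Rightarrow> nat \<Rightarrow> (complex \<Rightarrow> complex) set" where
  "KN c R N = {f. \<exists>a. f = (\<lambda>z. \<Sum>n\<le>N. a n * mono_basis c R n z)}"

text \<open>The orthogonal projection of a square-integrable \<open>g\<close> onto a closed subspace \<open>S\<close>:
  the unique \<open>f\<close> in \<open>S\<close> such that \<open>g - f\<close> is orthogonal to \<open>S\<close>. Uniqueness holds for
  subspaces of \<open>Hc c R\<close> because of the extension by \<open>0\<close>.\<close>

definition orth_proj ::
  "complex measure \<Rightarrow> (complex \<Rightarrow> complex) set \<Rightarrow> (complex \<Rightarrow> complex) \<Rightarrow> complex \<Rightarrow> complex" where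
  "orth_proj M S g = (THE f. f \<in> S \<and> (\<forall>h\<in>S. L2_inner M (\<lambda>z. g z - f z) h = 0))"

definition toeplitz ::
  "(nat \<Rightarrow> real) \<Rightarrow> (real \<Rightarrow> real) \<Rightarrow> ereal \<Rightarrow> (complex \<Rightarrow> real) \<Rightarrow>
   (complex \<Rightarrow> complex) \<Rightarrow> complex \<Rightarrow> complex" where
  "toeplitz c w R \<sigma> f =
     orth_proj (radial_measure w R) (Hc c R) (\<lambda>z. complex_of_real (\<sigma> z) * f z)"

definition compression ::
  "(nat \<Rightarrow> real) \<Rightarrow> (real \<Rightarrow> real) \<Rightarrow> ereal \<Rightarrow> (complex \<Rightarrow> real) \<Rightarrow> nat \<Rightarrow>
   (complex \<Rightarrow> complex) \<Rightarrow> complex \<Rightarrow> complex" where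
  "compression c w R \<sigma> N =
     orth_proj (radial_measure w R) (KN c R N) \<circ> toeplitz c w R \<sigma> \<circ>
     orth_proj (radial_measure w R) (KN c R N)"

definition eigsp ::
  "(complex \<Rightarrow> complex) set \<Rightarrow> ((complex \<Rightarrow> complex) \<Rightarrow> complex \<Rightarrow> complex) \<Rightarrow> real \<Rightarrow>
   (complex \<Rightarrow> complex) set" where
  "eigsp V A t = {f \<in> V. A f = (\<lambda>z. complex_of_real t * f z)}"

definition eigvals ::
  "(complex \<Rightarrow> complex) set \<Rightarrow> ((complex \<Rightarrow> complex) \<Rightarrow> complex \<Rightarrow> complex) \<Rightarrow> real set" where
  "eigvals V A = {t. \<exists>f\<in>eigsp V A t. f \<noteq> (\<lambda>z. 0)}"

text \<open>The functional calculus of a self-adjoint operator \<open>A\<close> on a finite-dimensional subspace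
  \<open>V\<close>: \<open>\<psi>(A) = \<Sum>\<^sub>t \<psi>(t) E\<^sub>t\<close>, where \<open>t\<close> runs over the (finitely many, real) eigenvalues and
  \<open>E\<^sub>t\<close> is the orthogonal projection onto the eigenspace of \<open>t\<close>.\<close>

definition fun_calc ::
  "complex measure \<Rightarrow> (complex \<Rightarrow> complex) set \<Rightarrow> (real \<Rightarrow> complex) \<Rightarrow>
   ((complex \<Rightarrow> complex) \<Rightarrow> complex \<Rightarrow> complex) \<Rightarrow> (complex \<Rightarrow> complex) \<Rightarrow> complex \<Rightarrow> complex" where
  "fun_calc M V \<psi> A f =
     (\<lambda>z. \<Sum>t\<in>eigvals V A. \<psi> t * orth_proj M (eigsp V A t) f z)"

text \<open>The trace on \<open>KN c R N\<close>, computed in the orthonormal basis of normalised monomials.\<close>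

definition trace_KN ::
  "(nat \<Rightarrow> real) \<Rightarrow> (real \<Rightarrow> real) \<Rightarrow> ereal \<Rightarrow> nat \<Rightarrow>
   ((complex \<Rightarrow> complex) \<Rightarrow> complex \<Rightarrow> complex) \<Rightarrow> complex" where
  "trace_KN c w R N B =
     (\<Sum>n\<le>N. L2_inner (radial_measure w R) (B (mono_basis c R n)) (mono_basis c R n))"

text \<open>The filter \<open>r \<rightarrow> R\<^sup>-\<close> on the reals, where \<open>R\<close> may be \<open>\<infinity>\<close>.\<close>

definition to_radius :: "ereal \<Rightarrow> real filter" where
  "to_radius R = (if R = \<infinity> then at_top else at_left (real_of_ereal R))"

definition has_radial_limit :: "ereal \<Rightarrow> (complex \<Rightarrow> real) \<Rightarrow> (real \<Rightarrow> real) \<Rightarrow> bool" where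
  "has_radial_limit R \<sigma> \<tau> \<longleftrightarrow>
     (AE \<theta> in lebesgue. \<theta> \<in> {0..<2 * pi} \<longrightarrow>
        ((\<lambda>r. \<sigma> (rcis r \<theta>)) \<longlongrightarrow> \<tau> \<theta>) (to_radius R))"

end

theory Submission
  imports Defs
begin

text \<open>Let \<open>e n\<close> be the normalised monomials and let \<open>A\<close> be the Hermitian matrix with entries
\<open>\<langle>\<sigma> (e n), e m\<rangle>\<close>, \<open>m, n \<le> N\<close>; it represents the compression in the orthonormal basis
\<open>e 0, \<dots>, e N\<close>. The proof compares the trace of \<open>\<psi> A\<close> with the sum of the diagonal integrals
\<open>\<integral> \<psi> (\<sigma> z) \<bar>e n z\<bar>\<^sup>2 d\<nu>\<close>, and needs no power of \<open>A\<close> beyond the second.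

Choose an orthonormal basis of eigenfunctions \<open>f v\<close> of the compression, with eigenvalues \<open>l v\<close>. The density \<open>\<bar>f v\<bar>\<^sup>2\<close> is that
of a probability measure with respect to \<open>\<nu>\<close>, and \<open>l v\<close> is the mean of \<open>\<sigma>\<close> under it.
Moreover \<open>\<Sum>v. \<bar>f v z\<bar>\<^sup>2 = \<Sum>n\<le>N. \<bar>e n z\<bar>\<^sup>2\<close> at every point, so the difference to be estimated is the sum
over \<open>v\<close> of the means of \<open>\<psi> (\<sigma> z) - \<psi> (l v)\<close>. A continuous function on a compact interval satisfies
\<open>\<bar>\<psi> x - \<psi> y\<bar> \<le> \<epsilon> + K (x - y)\<^sup>2\<close>: uniform continuity bounds the difference for close points, and
boundedness of \<open>\<psi>\<close> for distant ones. Hence the difference is at most \<open>\<epsilon> (N + 1) + K V\<close>, where \<open>V\<close> is the sum of the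
variances of \<open>\<sigma>\<close> under these measures, and \<open>V\<close> equals
\<open>(\<Sum>n\<le>N. \<integral> \<sigma>\<^sup>2 \<bar>e n\<bar>\<^sup>2 d\<nu>) - (\<Sum>m,n\<le>N. \<bar>A m n\<bar>\<^sup>2)\<close> (\<open>trace_variance_bound\<close>).

What remains is the behaviour of single matrix entries. In polar coordinates the measure
\<open>\<bar>e n\<bar>\<^sup>2 d\<nu>\<close> concentrates on the boundary circle as \<open>n\<close> grows, because the moment ratios tend to \<open>R\<close>. So for
fixed \<open>i, j\<close> the entries \<open>\<langle>\<phi> (\<sigma>) e (n + i), e (n + j)\<rangle>\<close> tend to the Fourier coefficients of \<open>\<phi>\<close> applied to the radial limit
(\<open>matrix_entry_limit\<close>). With \<open>i = j = 0\<close> and a Cesaro mean, the normalised diagonal sums tend to the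
integral in the theorem. For the variance, the \<open>n\<close>th column contributes
\<open>\<integral> \<sigma>\<^sup>2 \<bar>e n\<bar>\<^sup>2 d\<nu> - (\<Sum>m\<le>N. \<bar>A m n\<bar>\<^sup>2)\<close>; away from both ends of \<open>{0..N}\<close> this is asymptotically at most the
mean squared distance of the radial limit from any prescribed trigonometric polynomial. Such polynomials are dense in
\<open>L\<^sup>2\<close> of the circle, so \<open>V / (N + 1)\<close> tends to \<open>0\<close> (\<open>variance_sum_small\<close>).\<close>

section \<open>Polar coordinates in the complex plane\<close>

lemma lborel_complex: "(lborel :: complex measure) = distr (lborel \<Otimes>\<^sub>M lborel) borel (\<lambda>(x, y). Complex x y)"
proof (rule lborel_eqI)
  fix l u :: complex
  assume le: "\<And>b. b \<in> Basis \<Longrightarrow> l \<bullet> b \<le> u \<bullet> b"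
  have m[measurable]: "(\<lambda>(x, y). Complex x y) \<in> borel_measurable (lborel \<Otimes>\<^sub>M lborel)"
    unfolding Complex_eq by simp
  have le': "Re l \<le> Re u" "Im l \<le> Im u"
    using le[of 1] le[of \<i>] by (auto simp: Basis_complex_def inner_complex_def)
  have "emeasure (distr (lborel \<Otimes>\<^sub>M lborel) borel (\<lambda>(x, y). Complex x y)) (box l u)
      = emeasure (lborel \<Otimes>\<^sub>M lborel) ({Re l<..<Re u} \<times> {Im l<..<Im u})"
    by (subst emeasure_distr)
       (auto simp: space_pair_measure box_def Basis_complex_def inner_complex_def intro!: arg_cong2[where f=emeasure])
  also have "\<dots> = ennreal (Re u - Re l) * ennreal (Im u - Im l)"
    using le' by (subst lborel.emeasure_pair_measure_Times) auto
  also have "\<dots> = ennreal (\<Prod>b\<in>Basis. (u - l) \<bullet> b)"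
    using le' by (simp add: Basis_complex_def inner_complex_def ennreal_mult)
  finally show "emeasure (distr (lborel \<Otimes>\<^sub>M lborel) borel (\<lambda>(x, y). Complex x y)) (box l u)
    = ennreal (\<Prod>b\<in>Basis. (u - l) \<bullet> b)" .
qed simp

text \<open>The tangent maps the open interval onto the line, whereas substitution is available for
  compact intervals; the intervals from \<open>- arctan n\<close> to \<open>arctan n\<close> exhaust the domain, and monotone convergence gives the limit.\<close>

lemma nn_integral_tan:
  fixes f :: "real \<Rightarrow> ennreal"
  assumes [measurable]: "f \<in> borel_measurable borel"
  shows "(\<integral>\<^sup>+t. f t \<partial>lborel) =
    (\<integral>\<^sup>+\<theta>. f (tan \<theta>) * ennreal (1 / (cos \<theta>)\<^sup>2) * indicator {- pi / 2<..<pi / 2} \<theta> \<partial>lborel)"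
proof -
  define a where "a n = arctan (real n)" for n
  have a: "- pi / 2 < - a n" "a n < pi / 2" "0 \<le> a n" "tan (a n) = n" "tan (- a n) = - n" for n
    unfolding a_def using arctan_bounded[of "real n"] by (auto simp: arctan zero_le_arctan_iff)
  have step: "(\<integral>\<^sup>+t. f t * indicator {- real n..real n} t \<partial>lborel) =
     (\<integral>\<^sup>+\<theta>. f (tan \<theta>) * ennreal (1 / (cos \<theta>)\<^sup>2) * indicator {- a n..a n} \<theta> \<partial>lborel)" if "n > 0" for n
  proof -
    have c: "cos x > 0" if "x \<in> {- a n..a n}" for x
      using that a[of n] by (intro cos_gt_zero_pi) auto
    have lt: "- a n < a n" using that by (simp add: a_def)
    have "(\<integral>\<^sup>+x. f x * indicator {tan (- a n)..tan (a n)} x \<partial>lborel) =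
      (\<integral>\<^sup>+x. f (tan x) * ennreal (1 / (cos x)\<^sup>2) * indicator {- a n..a n} x \<partial>lborel)"
    proof (rule nn_integral_substitution_aux)
      show "(tan has_real_derivative 1 / (cos x)\<^sup>2) (at x)" if "x \<in> {- a n..a n}" for x
        using c[OF that] DERIV_tan[of x] by (simp add: inverse_eq_divide)
      show "continuous_on {- a n..a n} (\<lambda>x. 1 / (cos x)\<^sup>2)"
        using c by (intro continuous_intros) fastforce
    qed (use lt in auto)
    thus ?thesis using a by simp
  qed
  have "(\<integral>\<^sup>+t. f t \<partial>lborel) = (\<integral>\<^sup>+t. (SUP n. f t * indicator {- real (Suc n)..real (Suc n)} t) \<partial>lborel)"
  proof (rule nn_integral_cong)
    fix t :: real
    obtain n where n: "\<bar>t\<bar> \<le> real n" using real_arch_simple by blast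
    have "f t \<le> (SUP n. f t * indicator {- real (Suc n)..real (Suc n)} t)"
      by (rule SUP_upper2[of n]) (use n in \<open>auto simp: indicator_def\<close>)
    moreover have "(SUP n. f t * indicator {- real (Suc n)..real (Suc n)} t) \<le> f t"
      by (rule SUP_least) (auto simp: indicator_def)
    ultimately show "f t = (SUP n. f t * indicator {- real (Suc n)..real (Suc n)} t)" by (rule antisym)
  qed
  also have "\<dots> = (SUP n. \<integral>\<^sup>+t. f t * indicator {- real (Suc n)..real (Suc n)} t \<partial>lborel)"
    by (rule nn_integral_monotone_convergence_SUP)
       (auto simp: incseq_def le_fun_def indicator_def)
  also have "\<dots> = (SUP n. \<integral>\<^sup>+\<theta>. f (tan \<theta>) * ennreal (1 / (cos \<theta>)\<^sup>2) * indicator {- a (Suc n)..a (Suc n)} \<theta> \<partial>lborel)"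
    by (subst step) auto
  also have "\<dots> = (\<integral>\<^sup>+\<theta>. (SUP n. f (tan \<theta>) * ennreal (1 / (cos \<theta>)\<^sup>2) * indicator {- a (Suc n)..a (Suc n)} \<theta>) \<partial>lborel)"
  proof (rule nn_integral_monotone_convergence_SUP[symmetric])
    have "a m \<le> a n" if "m \<le> n" for m n using that by (simp add: a_def arctan_le_iff)
    hence "a (Suc m) \<le> a (Suc n)" if "m \<le> n" for m n using that by blast
    thus "incseq (\<lambda>n \<theta>. f (tan \<theta>) * ennreal (1 / (cos \<theta>)\<^sup>2) * indicator {- a (Suc n)..a (Suc n)} \<theta>)"
      by (fastforce simp: incseq_def le_fun_def indicator_def)
  qed (unfold tan_def, measurable)
  also have "\<dots> = (\<integral>\<^sup>+\<theta>. f (tan \<theta>) * ennreal (1 / (cos \<theta>)\<^sup>2) * indicator {- pi / 2<..<pi / 2} \<theta> \<partial>lborel)"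
  proof (rule nn_integral_cong)
    fix \<theta> :: real
    let ?F = "\<lambda>n. f (tan \<theta>) * ennreal (1 / (cos \<theta>)\<^sup>2) * indicator {- a (Suc n)..a (Suc n)} \<theta>"
    let ?G = "f (tan \<theta>) * ennreal (1 / (cos \<theta>)\<^sup>2) * indicator {- pi / 2<..<pi / 2} \<theta>"
    have "(SUP n. ?F n) \<le> ?G"
    proof (rule SUP_least)
      fix n
      show "?F n \<le> ?G" using a(1,2)[of "Suc n"] by (auto simp: indicator_def)
    qed
    moreover have "?G \<le> (SUP n. ?F n)"
    proof (cases "\<theta> \<in> {- pi / 2<..<pi / 2}")
      case True
      obtain n where n: "\<bar>tan \<theta>\<bar> \<le> real n" using real_arch_simple by blast
      have "arctan (tan \<theta>) = \<theta>" using True by (intro arctan_tan) auto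
      moreover have "arctan (tan \<theta>) \<le> arctan (Suc n)" "- arctan (Suc n) \<le> arctan (tan \<theta>)"
        unfolding arctan_minus[symmetric] arctan_le_iff using n by auto
      ultimately have "\<theta> \<in> {- a (Suc n)..a (Suc n)}" by (auto simp: a_def)
      thus ?thesis by (intro SUP_upper2[of n]) (auto simp: indicator_def)
    qed auto
    ultimately show "(SUP n. ?F n) = ?G" by (rule antisym)
  qed
  finally show ?thesis .
qed

text \<open>Three one-dimensional substitutions replace a two-dimensional change of variables:
  \<open>y = x t\<close>, then \<open>t = tan \<theta>\<close>, then \<open>x = r cos \<theta>\<close>. Angles fill a half turn and \<open>r\<close> runs over the
  whole line, a negative \<open>r\<close> describing the opposite half plane.\<close>

lemma nn_integral_polar_full_line:
  fixes h :: "complex \<Rightarrow> ennreal"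
  assumes [measurable]: "h \<in> borel_measurable borel"
  shows "(\<integral>\<^sup>+z. h z \<partial>lborel) =
    (\<integral>\<^sup>+\<theta>. (\<integral>\<^sup>+r. ennreal \<bar>r\<bar> * h (rcis r \<theta>) \<partial>lborel) * indicator {- pi / 2<..<pi / 2} \<theta> \<partial>lborel)"
proof -
  have m[measurable]: "(\<lambda>(x, y). Complex x y) \<in> borel_measurable (lborel \<Otimes>\<^sub>M lborel)"
    unfolding Complex_eq by simp
  have mC[measurable]: "(\<lambda>x. Complex (f x) (g x)) \<in> borel_measurable M"
    if [measurable]: "f \<in> borel_measurable M" "g \<in> borel_measurable M" for f g and M :: "'b measure"
    unfolding Complex_eq by simp
  have "(\<integral>\<^sup>+z. h z \<partial>lborel) = (\<integral>\<^sup>+x. \<integral>\<^sup>+y. h (Complex x y) \<partial>lborel \<partial>lborel)"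
    by (subst lborel_complex, subst nn_integral_distr)
       (auto simp: case_prod_beta' lborel.nn_integral_fst[symmetric] intro!: nn_integral_cong)
  also have "\<dots> = (\<integral>\<^sup>+x. \<integral>\<^sup>+t. ennreal \<bar>x\<bar> * h (Complex x (x * t)) \<partial>lborel \<partial>lborel)"
  proof (rule nn_integral_cong_AE)
    have "AE x in lborel. x \<noteq> (0::real)" by (rule AE_lborel_singleton)
    thus "AE x in lborel. (\<integral>\<^sup>+y. h (Complex x y) \<partial>lborel) = (\<integral>\<^sup>+t. ennreal \<bar>x\<bar> * h (Complex x (x * t)) \<partial>lborel)"
    proof eventually_elim
      case (elim x)
      show ?case
        by (subst nn_integral_real_affine[of _ x 0]) (use elim in \<open>auto simp: nn_integral_cmult\<close>)
    qed
  qed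
  also have "\<dots> = (\<integral>\<^sup>+t. \<integral>\<^sup>+x. ennreal \<bar>x\<bar> * h (Complex x (x * t)) \<partial>lborel \<partial>lborel)"
    by (rule lborel_pair.Fubini') measurable
  also have "\<dots> = (\<integral>\<^sup>+\<theta>. (\<integral>\<^sup>+x. ennreal \<bar>x\<bar> * h (Complex x (x * tan \<theta>)) \<partial>lborel) * ennreal (1 / (cos \<theta>)\<^sup>2)
       * indicator {- pi / 2<..<pi / 2} \<theta> \<partial>lborel)"
    by (rule nn_integral_tan) measurable
  also have "\<dots> = (\<integral>\<^sup>+\<theta>. (\<integral>\<^sup>+r. ennreal \<bar>r\<bar> * h (rcis r \<theta>) \<partial>lborel) * indicator {- pi / 2<..<pi / 2} \<theta> \<partial>lborel)"
  proof (intro nn_integral_cong)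
    fix \<theta> :: real
    show "(\<integral>\<^sup>+x. ennreal \<bar>x\<bar> * h (Complex x (x * tan \<theta>)) \<partial>lborel) * ennreal (1 / (cos \<theta>)\<^sup>2)
       * indicator {- pi / 2<..<pi / 2} \<theta> =
      (\<integral>\<^sup>+r. ennreal \<bar>r\<bar> * h (rcis r \<theta>) \<partial>lborel) * indicator {- pi / 2<..<pi / 2} \<theta>"
    proof (cases "\<theta> \<in> {- pi / 2<..<pi / 2}")
      case True
      hence c: "cos \<theta> > 0" by (intro cos_gt_zero_pi) auto
      have "(\<integral>\<^sup>+x. ennreal \<bar>x\<bar> * h (Complex x (x * tan \<theta>)) \<partial>lborel)
        = ennreal \<bar>cos \<theta>\<bar> * (\<integral>\<^sup>+r. ennreal \<bar>cos \<theta> * r\<bar> * h (Complex (cos \<theta> * r) (cos \<theta> * r * tan \<theta>)) \<partial>lborel)"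
        by (subst nn_integral_real_affine[of _ "cos \<theta>" 0]) (use c in auto)
      also have "\<dots> = ennreal ((cos \<theta>)\<^sup>2) * (\<integral>\<^sup>+r. ennreal \<bar>r\<bar> * h (rcis r \<theta>) \<partial>lborel)"
      proof -
        have "Complex (cos \<theta> * r) (cos \<theta> * r * tan \<theta>) = rcis r \<theta>" for r
          using c by (auto simp: complex_eq_iff tan_def)
        moreover have "ennreal \<bar>cos \<theta> * r\<bar> = ennreal (cos \<theta>) * ennreal \<bar>r\<bar>" for r
          using c by (simp add: abs_mult ennreal_mult)
        ultimately have "(\<integral>\<^sup>+r. ennreal \<bar>cos \<theta> * r\<bar> * h (Complex (cos \<theta> * r) (cos \<theta> * r * tan \<theta>)) \<partial>lborel)
          = (\<integral>\<^sup>+r. ennreal (cos \<theta>) * (ennreal \<bar>r\<bar> * h (rcis r \<theta>)) \<partial>lborel)"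
          by (simp add: mult.assoc)
        also have "\<dots> = ennreal (cos \<theta>) * (\<integral>\<^sup>+r. ennreal \<bar>r\<bar> * h (rcis r \<theta>) \<partial>lborel)"
          by (rule nn_integral_cmult) (simp add: rcis_def cis.code)
        finally show ?thesis using c by (simp add: power2_eq_square ennreal_mult mult.assoc)
      qed
      finally have "(\<integral>\<^sup>+x. ennreal \<bar>x\<bar> * h (Complex x (x * tan \<theta>)) \<partial>lborel) * ennreal (1 / (cos \<theta>)\<^sup>2)
        = (ennreal ((cos \<theta>)\<^sup>2) * ennreal (1 / (cos \<theta>)\<^sup>2)) * (\<integral>\<^sup>+r. ennreal \<bar>r\<bar> * h (rcis r \<theta>) \<partial>lborel)"
        by (simp add: mult_ac)
      also have "ennreal ((cos \<theta>)\<^sup>2) * ennreal (1 / (cos \<theta>)\<^sup>2) = 1"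
        using c by (simp add: ennreal_mult[symmetric])
      finally show ?thesis by simp
    qed auto
  qed
  finally show ?thesis .
qed

lemma borel_measurable_rcis [measurable (raw)]:
  assumes [measurable]: "f \<in> borel_measurable M" "g \<in> borel_measurable M"
  shows "(\<lambda>x. rcis (f x) (g x)) \<in> borel_measurable M"
  unfolding rcis_def cis.code Complex_eq by measurable

text \<open>Moves the opposite half turn back into one period, which turns a signed radius into a positive one.\<close>

lemma nn_integral_periodic_shift:
  fixes G :: "real \<Rightarrow> ennreal"
  assumes [measurable]: "G \<in> borel_measurable borel" and per: "\<And>x. G (x + 2 * pi) = G x"
  shows "(\<integral>\<^sup>+x. (G x + G (x + pi)) * indicator {- pi / 2<..<pi / 2} x \<partial>lborel)
    = (\<integral>\<^sup>+x. G x * indicator {0..<2 * pi} x \<partial>lborel)"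
proof -
  have sh: "(\<integral>\<^sup>+x. F x \<partial>lborel) = (\<integral>\<^sup>+x. F (x + t) \<partial>lborel)"
    if "F \<in> borel_measurable borel" for F :: "real \<Rightarrow> ennreal" and t
    using nn_integral_real_affine[OF that, of 1 t] by (simp add: add.commute)
  have per': "G (x - 2 * pi) = G x" for x using per[of "x - 2 * pi"] by simp
  have per'': "G (x - pi * 2) = G x" for x using per'[of x] by (simp add: mult.commute)
  have "(\<integral>\<^sup>+x. (G x + G (x + pi)) * indicator {- pi / 2<..<pi / 2} x \<partial>lborel)
    = (\<integral>\<^sup>+x. G x * indicator {- pi / 2<..<pi / 2} x \<partial>lborel)
    + (\<integral>\<^sup>+x. G (x + pi) * indicator {- pi / 2<..<pi / 2} x \<partial>lborel)"
    by (simp add: distrib_right nn_integral_add)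
  also have "(\<integral>\<^sup>+x. G (x + pi) * indicator {- pi / 2<..<pi / 2} x \<partial>lborel)
    = (\<integral>\<^sup>+x. G x * indicator {pi / 2<..<3 * pi / 2} x \<partial>lborel)"
    by (subst (2) sh[of _ pi]) (auto simp: indicator_def field_simps intro!: nn_integral_cong)
  also have "(\<integral>\<^sup>+x. G x * indicator {- pi / 2<..<pi / 2} x \<partial>lborel)
    = (\<integral>\<^sup>+x. G x * indicator {- pi / 2<..<0} x + G x * indicator {0..<pi / 2} x \<partial>lborel)"
    by (rule nn_integral_cong) (auto simp: indicator_def)
  also have "\<dots> = (\<integral>\<^sup>+x. G x * indicator {- pi / 2<..<0} x \<partial>lborel)
      + (\<integral>\<^sup>+x. G x * indicator {0..<pi / 2} x \<partial>lborel)"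
    by (rule nn_integral_add) auto
  also have "(\<integral>\<^sup>+x. G x * indicator {- pi / 2<..<0} x \<partial>lborel)
    = (\<integral>\<^sup>+x. G x * indicator {3 * pi / 2<..<2 * pi} x \<partial>lborel)"
    by (subst sh[of _ "- 2 * pi"]) (auto simp: indicator_def per' per'' field_simps intro!: nn_integral_cong)
  also have "\<dots> + (\<integral>\<^sup>+x. G x * indicator {0..<pi / 2} x \<partial>lborel) +
      (\<integral>\<^sup>+x. G x * indicator {pi / 2<..<3 * pi / 2} x \<partial>lborel) =
     (\<integral>\<^sup>+x. G x * indicator {3 * pi / 2<..<2 * pi} x + G x * indicator {0..<pi / 2} x +
      G x * indicator {pi / 2<..<3 * pi / 2} x \<partial>lborel)"
    by (simp add: nn_integral_add)
  also have "\<dots> = (\<integral>\<^sup>+x. G x * indicator {0..<2 * pi} x \<partial>lborel)"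
  proof (rule nn_integral_cong_AE)
    have "AE x in lborel. x \<noteq> pi / 2" "AE x in lborel. x \<noteq> 3 * pi / 2"
      by (rule AE_lborel_singleton)+
    thus "AE x in lborel. G x * indicator {3 * pi / 2<..<2 * pi} x + G x * indicator {0..<pi / 2} x +
      G x * indicator {pi / 2<..<3 * pi / 2} x = G x * indicator {0..<2 * pi} x"
      by eventually_elim (auto simp: indicator_def)
  qed
  finally show ?thesis .
qed

theorem nn_integral_polar:
  fixes h :: "complex \<Rightarrow> ennreal"
  assumes [measurable]: "h \<in> borel_measurable borel"
  shows "(\<integral>\<^sup>+z. h z \<partial>lborel) =
    (\<integral>\<^sup>+\<theta>. (\<integral>\<^sup>+r. ennreal r * h (rcis r \<theta>) * indicator {0<..} r \<partial>lborel) * indicator {0..<2 * pi} \<theta> \<partial>lborel)"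
proof -
  define G where "G \<theta> = (\<integral>\<^sup>+r. ennreal r * h (rcis r \<theta>) * indicator {0<..} r \<partial>lborel)" for \<theta>
  have [measurable]: "G \<in> borel_measurable borel" unfolding G_def by measurable
  have split: "(\<integral>\<^sup>+r. ennreal \<bar>r\<bar> * h (rcis r \<theta>) \<partial>lborel) = G \<theta> + G (\<theta> + pi)" for \<theta>
  proof -
    have neg: "rcis (- r) \<theta> = rcis r (\<theta> + pi)" for r by (simp add: rcis_def cis.code complex_eq_iff)
    have "(\<integral>\<^sup>+r. ennreal \<bar>r\<bar> * h (rcis r \<theta>) \<partial>lborel) =
      (\<integral>\<^sup>+r. ennreal r * h (rcis r \<theta>) * indicator {0<..} r +
         ennreal (- r) * h (rcis r \<theta>) * indicator {..<0} r \<partial>lborel)"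
      by (rule nn_integral_cong) (auto simp: indicator_def)
    also have "\<dots> = G \<theta> + (\<integral>\<^sup>+r. ennreal (- r) * h (rcis r \<theta>) * indicator {..<0} r \<partial>lborel)"
      unfolding G_def by (rule nn_integral_add) auto
    also have "(\<integral>\<^sup>+r. ennreal (- r) * h (rcis r \<theta>) * indicator {..<0} r \<partial>lborel) = G (\<theta> + pi)"
      unfolding G_def
      by (subst nn_integral_real_affine[of _ "-1" 0]) (auto simp: neg indicator_def intro!: nn_integral_cong)
    finally show ?thesis .
  qed
  have "G (\<theta> + 2 * pi) = G \<theta>" for \<theta> unfolding G_def by (simp add: rcis_def cis.code)
  thus ?thesis
    unfolding nn_integral_polar_full_line[OF assms] split
    by (subst nn_integral_periodic_shift) (auto simp: G_def)
qed

section \<open>Orthonormal eigenbases of Hermitian matrices\<close>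

text \<open>Vectors of length \<open>N + 1\<close> are functions on the naturals vanishing beyond \<open>N\<close>. This keeps \<open>N\<close> an
  ordinary variable and gives compactness through the product topology.\<close>

definition cip :: "nat \<Rightarrow> (nat \<Rightarrow> complex) \<Rightarrow> (nat \<Rightarrow> complex) \<Rightarrow> complex" where
  "cip N a b = (\<Sum>n\<le>N. a n * cnj (b n))"

definition mat_app :: "nat \<Rightarrow> (nat \<Rightarrow> nat \<Rightarrow> complex) \<Rightarrow> (nat \<Rightarrow> complex) \<Rightarrow> nat \<Rightarrow> complex" where
  "mat_app N A a = (\<lambda>m. if m \<le> N then \<Sum>n\<le>N. A m n * a n else 0)"

lemma cip_add_left: "cip N (\<lambda>n. a n + b n) v = cip N a v + cip N b v"
  by (simp add: cip_def sum.distrib algebra_simps)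

lemma cip_diff_left: "cip N (\<lambda>n. a n - b n) v = cip N a v - cip N b v"
  by (simp add: cip_def sum_subtractf algebra_simps)

lemma cip_scale_left: "cip N (\<lambda>n. t * a n) v = t * cip N a v"
  by (simp add: cip_def sum_distrib_left algebra_simps)

lemma cip_sum_left: "cip N (\<lambda>n. \<Sum>i\<in>I. f i n) v = (\<Sum>i\<in>I. cip N (f i) v)"
  unfolding cip_def by (subst sum.swap) (simp add: sum_distrib_right)

lemma cip_cnj: "cnj (cip N a b) = cip N b a"
  by (simp add: cip_def mult.commute)

lemma cip_add_right: "cip N v (\<lambda>n. a n + b n) = cip N v a + cip N v b"
  by (simp add: cip_def sum.distrib algebra_simps)

lemma cip_scale_right: "cip N v (\<lambda>n. t * a n) = cnj t * cip N v a"
  by (simp add: cip_def sum_distrib_left algebra_simps)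

lemma cip_self: "cip N a a = of_real (\<Sum>n\<le>N. (cmod (a n))\<^sup>2)"
  unfolding cip_def complex_norm_square[symmetric] of_real_sum ..

lemma cip_self_eq_0: "cip N a a = 0 \<longleftrightarrow> (\<forall>n\<le>N. a n = 0)"
  unfolding cip_self of_real_eq_0_iff by (subst sum_nonneg_eq_0_iff) auto

lemma mat_app_self_adjoint:
  assumes "\<And>m n. A m n = cnj (A n m)"
  shows "cip N (mat_app N A a) b = cip N a (mat_app N A b)"
proof -
  have "cip N (mat_app N A a) b = (\<Sum>m\<le>N. \<Sum>n\<le>N. A m n * a n * cnj (b m))"
    by (simp add: cip_def mat_app_def sum_distrib_right)
  also have "\<dots> = (\<Sum>n\<le>N. \<Sum>m\<le>N. A m n * a n * cnj (b m))" by (rule sum.swap)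
  also have "\<dots> = (\<Sum>n\<le>N. a n * (\<Sum>m\<le>N. cnj (A n m) * cnj (b m)))"
    by (simp add: sum_distrib_left mult_ac assms[symmetric])
  also have "\<dots> = cip N a (mat_app N A b)"
    by (simp add: cip_def mat_app_def)
  finally show ?thesis .
qed

text \<open>The quadratic form of a Hermitian matrix attains its maximum \<open>l\<close> on the unit sphere of an
  invariant subspace, and a maximiser is an eigenvector: \<open>l - A\<close> is positive semidefinite there and its form vanishes at
  the maximiser, hence it annihilates the maximiser. The subspace is cut out by orthogonality to a set \<open>O'\<close> of vectors.\<close>

lemma rayleigh_maximum:
  fixes W :: "(nat \<Rightarrow> complex) set"
  assumes herm: "\<And>m n. A m n = cnj (A n m)"
    and W: "W = {a. (\<forall>n>N. a n = 0) \<and> (\<forall>v\<in>O'. cip N a v = 0)}"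
    and inv: "\<And>a. a \<in> W \<Longrightarrow> mat_app N A a \<in> W"
    and nz: "b \<in> W" "b \<noteq> (\<lambda>n. 0)"
  shows "\<exists>a\<in>W. \<exists>l::real. cip N a a = 1 \<and> mat_app N A a = (\<lambda>n. of_real l * a n)"
proof -
  define q where "q a = Re (cip N (mat_app N A a) a)" for a
  define S where "S = {a\<in>W. cip N a a = 1}"
  have cont_cip: "continuous_on UNIV (\<lambda>a. cip N (f a) (g a))"
    if "\<And>n. n \<le> N \<Longrightarrow> continuous_on UNIV (\<lambda>a. f a n)" "\<And>n. n \<le> N \<Longrightarrow> continuous_on UNIV (\<lambda>a. g a n)"
    for f g :: "(nat \<Rightarrow> complex) \<Rightarrow> nat \<Rightarrow> complex"
    unfolding cip_def by (intro continuous_on_sum continuous_on_mult continuous_on_cnj) (use that in auto)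
  have contq: "continuous_on UNIV q"
    unfolding q_def
    by (intro continuous_intros cont_cip) (auto simp: mat_app_def intro!: continuous_intros)
  have closedS: "closed S"
  proof -
    have "S = (\<Inter>n\<in>{N<..}. {a. a n = 0}) \<inter> (\<Inter>v\<in>O'. {a. cip N a v = 0}) \<inter> {a. cip N a a = 1}"
      by (auto simp: S_def W)
    moreover have "closed {a::nat\<Rightarrow>complex. a n = 0}" for n
      by (intro closed_Collect_eq continuous_intros) auto
    moreover have "closed {a. cip N a v = 0}" for v
      by (intro closed_Collect_eq cont_cip continuous_intros) auto
    moreover have "closed {a. cip N a a = 1}"
      by (intro closed_Collect_eq cont_cip continuous_intros) auto
    ultimately show ?thesis by (auto intro!: closed_INT closed_Int)
  qed
  have bound: "cmod (a n) \<le> 1" if "a \<in> S" for a n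
  proof (cases "n \<le> N")
    case True
    have "(cmod (a n))\<^sup>2 \<le> (\<Sum>n\<le>N. (cmod (a n))\<^sup>2)"
      using True by (intro member_le_sum) auto
    also have "\<dots> = 1" using that unfolding S_def mem_Collect_eq cip_self of_real_eq_1_iff by simp
    finally show ?thesis by (simp add: power_le_one_iff abs_square_le_1)
  qed (use that in \<open>auto simp: S_def W\<close>)
  have "compact (PiE UNIV (\<lambda>n::nat. cball (0::complex) 1))"
    using compactin_PiE[of "\<lambda>_. euclidean" UNIV "\<lambda>n::nat. cball (0::complex) 1"]
    by (simp add: euclidean_product_topology)
  moreover have "S \<subseteq> PiE UNIV (\<lambda>n::nat. cball (0::complex) 1)"
    using bound by (auto simp: PiE_def Pi_def)
  ultimately have compS: "compact S"
    using closedS by (metis compact_Int_closed inf.absorb_iff2)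
  have Wscale: "(\<lambda>n. t * a n) \<in> W" if "a \<in> W" for a t
    using that by (auto simp: W cip_scale_left)
  have Wadd: "(\<lambda>n. a n + b n) \<in> W" if "a \<in> W" "b \<in> W" for a b
    using that by (auto simp: W cip_add_left)
  have norm: "\<exists>s t. s > 0 \<and> (\<lambda>n. of_real s * a n) \<in> S \<and> t = s\<^sup>2 \<and> of_real t * cip N a a = 1"
    if a: "a \<in> W" "a \<noteq> (\<lambda>n. 0)" for a
  proof -
    define x where "x = (\<Sum>n\<le>N. (cmod (a n))\<^sup>2)"
    have "cip N a a \<noteq> 0"
    proof
      assume "cip N a a = 0"
      hence "a n = 0" for n using a(1) unfolding cip_self_eq_0 W by (cases "n \<le> N") auto
      thus False using a(2) by auto
    qed
    moreover have "x \<ge> 0" unfolding x_def by (intro sum_nonneg) auto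
    ultimately have "x > 0" unfolding cip_self x_def[symmetric] by simp
    define s where "s = 1 / sqrt x"
    have s: "s > 0" "s\<^sup>2 * x = 1" using \<open>x > 0\<close> by (auto simp: s_def power_divide)
    have aa: "cip N a a = of_real x" unfolding cip_self x_def ..
    have "cip N (\<lambda>n. of_real s * a n) (\<lambda>n. of_real s * a n) = of_real (s\<^sup>2 * x)"
      unfolding cip_scale_left cip_scale_right aa by (simp add: power2_eq_square)
    hence "(\<lambda>n. of_real s * a n) \<in> S"
      unfolding S_def using Wscale[OF a(1)] s(2) by simp
    thus ?thesis using s by (auto simp: cip_self x_def[symmetric] simp flip: of_real_mult of_real_power)
  qed
  have "S \<noteq> {}" using norm[OF nz] by blast
  then obtain a where a: "a \<in> S" "\<And>b. b \<in> S \<Longrightarrow> q b \<le> q a"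
    using continuous_attains_sup[OF compS _ continuous_on_subset[OF contq]] by blast
  define l where "l = q a"
  have app_scale: "mat_app N A (\<lambda>n. t * a n) = (\<lambda>n. t * mat_app N A a n)" for t a
    by (auto simp: mat_app_def sum_distrib_left algebra_simps)
  have app_add: "mat_app N A (\<lambda>n. a n + b n) = (\<lambda>n. mat_app N A a n + mat_app N A b n)" for a b
    by (auto simp: mat_app_def sum.distrib algebra_simps)
  \<comment> \<open>\<open>B\<close> is \<open>l - A\<close>. Its form is nonnegative on \<open>W\<close> and vanishes at \<open>a\<close>, so evaluating it at
    \<open>a + t * B a\<close> for small negative \<open>t\<close> forces \<open>B a = 0\<close>.\<close>
  define B where "B b = (\<lambda>n. of_real l * b n + (-1) * mat_app N A b n)" for b
  have BW: "B b \<in> W" if "b \<in> W" for b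
    unfolding B_def by (intro Wadd Wscale inv that)
  have B_nonneg: "Re (cip N (B b) b) \<ge> 0" if b: "b \<in> W" for b
  proof (cases "b = (\<lambda>n. 0)")
    case True
    thus ?thesis by (simp add: cip_def)
  next
    case False
    obtain s t where s: "s > 0" "(\<lambda>n. of_real s * b n) \<in> S" "t = s\<^sup>2" "of_real t * cip N b b = 1"
      using norm[OF b False] by blast
    have "q (\<lambda>n. of_real s * b n) \<le> l" using a(2)[OF s(2)] by (simp add: l_def)
    also have "q (\<lambda>n. of_real s * b n) = t * q b"
      unfolding q_def app_scale cip_scale_left cip_scale_right s(3)
      by (simp add: power2_eq_square mult.assoc)
    finally have "t * q b \<le> l" .
    moreover have "t * Re (cip N b b) = 1" using arg_cong[OF s(4), of Re] by simp
    ultimately have "0 \<le> t * (l * Re (cip N b b) - q b)"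
      by (metis diff_ge_0_iff_ge mult.left_commute mult.right_neutral right_diff_distrib)
    hence "0 \<le> l * Re (cip N b b) - q b" using s(1,3) by (simp add: zero_le_mult_iff)
    thus ?thesis unfolding B_def cip_add_left cip_scale_left q_def by simp
  qed
  have aW: "a \<in> W" "cip N a a = 1" using a by (auto simp: S_def)
  have Baa: "Re (cip N (B a) a) = 0"
    unfolding B_def cip_add_left cip_scale_left aW l_def q_def by simp
  have Bsym: "cip N (B b) d = cip N b (B d)" for b d
    unfolding B_def cip_add_left cip_add_right cip_scale_left cip_scale_right
      mat_app_self_adjoint[OF herm] by simp
  have B_add: "B (\<lambda>n. b n + t * d n) = (\<lambda>n. B b n + t * B d n)" for b d t
    unfolding B_def app_add app_scale by (auto simp: algebra_simps)
  define w where "w = B a"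
  define X where "X = Re (cip N w w)"
  define Y where "Y = Re (cip N (B w) w)"
  have wW: "w \<in> W" unfolding w_def by (intro BW aW)
  have quad: "0 \<le> 2 * t * X + t\<^sup>2 * Y" for t :: real
  proof -
    let ?b = "\<lambda>n. a n + of_real t * w n"
    have "0 \<le> Re (cip N (B ?b) ?b)" by (intro B_nonneg Wadd Wscale aW wW)
    also have "cip N (B ?b) ?b = cip N (B a) a + of_real t * cip N (B a) w + of_real t * cip N (B w) a
        + of_real (t\<^sup>2) * cip N (B w) w"
      unfolding B_add cip_add_left cip_add_right cip_scale_left cip_scale_right
      by (simp add: power2_eq_square algebra_simps)
    also have "cip N (B w) a = cip N w w" unfolding Bsym w_def[symmetric] ..
    finally show ?thesis using Baa by (simp add: w_def[symmetric] X_def Y_def)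
  qed
  have X0: "X \<ge> 0" unfolding X_def cip_self by (simp add: sum_nonneg)
  have "X = 0"
  proof (rule ccontr)
    assume "X \<noteq> 0"
    hence Xp: "X > 0" using X0 by simp
    have Y0: "Y \<ge> 0" unfolding Y_def by (rule B_nonneg[OF wW])
    \<comment> \<open>close to the minimiser \<open>- X / Y\<close>, with \<open>Y + 1\<close> to allow \<open>Y = 0\<close>\<close>
    define t where "t = - X / (Y + 1)"
    have "2 * t * X + t\<^sup>2 * Y = X\<^sup>2 / (Y + 1) * (Y / (Y + 1) - 2)"
      using Y0 by (simp add: t_def power2_eq_square divide_simps) (simp add: algebra_simps)
    also have "\<dots> < 0" using Xp Y0
      by (intro mult_pos_neg) (auto simp: divide_simps)
    finally show False using quad[of t] by simp
  qed
  hence "cip N w w = 0" unfolding X_def cip_self by simp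
  hence "w n = 0" for n using wW unfolding cip_self_eq_0 W by (cases "n \<le> N") auto
  hence "mat_app N A a = (\<lambda>n. of_real l * a n)" unfolding w_def B_def by (simp add: fun_eq_iff)
  thus ?thesis using aW by blast
qed

definition orthonormal_eigenset :: "nat \<Rightarrow> (nat \<Rightarrow> nat \<Rightarrow> complex) \<Rightarrow> (nat \<Rightarrow> complex) set \<Rightarrow> bool" where
  "orthonormal_eigenset N A S \<longleftrightarrow> finite S \<and> (\<forall>v\<in>S. \<forall>n>N. v n = 0) \<and>
     (\<forall>v\<in>S. \<forall>w\<in>S. cip N v w = (if v = w then 1 else 0)) \<and>
     (\<forall>v\<in>S. \<exists>l::real. mat_app N A v = (\<lambda>n. of_real l * v n))"

lemma fourier_residual_orthogonal:
  assumes S: "finite S" "\<forall>v\<in>S. \<forall>w\<in>S. cip N v w = (if v = w then 1 else 0)" and w: "w \<in> S"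
  shows "cip N (\<lambda>n. a n - (\<Sum>v\<in>S. cip N a v * v n)) w = 0"
proof -
  have "(\<Sum>v\<in>S. cip N a v * cip N v w) = (\<Sum>v\<in>S. if v = w then cip N a v else 0)"
    using S w by (intro sum.cong) auto
  thus ?thesis using S w by (simp add: cip_diff_left cip_sum_left cip_scale_left)
qed

text \<open>Needed to bound the size of orthonormal systems, so that a largest one exists.\<close>

lemma bessel_cip:
  assumes S: "finite S" "\<forall>v\<in>S. \<forall>w\<in>S. cip N v w = (if v = w then 1 else 0)"
  shows "(\<Sum>v\<in>S. (cmod (cip N a v))\<^sup>2) \<le> Re (cip N a a)"
proof -
  let ?p = "\<lambda>n. \<Sum>v\<in>S. cip N a v * v n"
  let ?r = "\<lambda>n. a n - ?p n"
  have rp: "cip N ?r ?p = 0"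
  proof -
    have "cip N ?p ?r = (\<Sum>v\<in>S. cip N a v * cip N v ?r)"
      by (simp add: cip_sum_left cip_scale_left)
    also have "\<dots> = 0"
    proof (intro sum.neutral ballI)
      fix v assume "v \<in> S"
      hence "cip N v ?r = 0"
        using fourier_residual_orthogonal[OF S, of v a] cip_cnj[of N ?r v] by simp
      thus "cip N a v * cip N v ?r = 0" by simp
    qed
    finally show ?thesis using cip_cnj[of N ?p ?r] by simp
  qed
  have "cip N ?p a = (\<Sum>v\<in>S. cip N a v * cip N v a)"
    by (simp add: cip_sum_left cip_scale_left)
  also have "\<dots> = (\<Sum>v\<in>S. of_real ((cmod (cip N a v))\<^sup>2))"
    by (intro sum.cong refl) (simp only: complex_norm_square cip_cnj)
  finally have pa: "cip N ?p a = of_real (\<Sum>v\<in>S. (cmod (cip N a v))\<^sup>2)" by simp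
  have "cip N ?r ?r + cip N ?r ?p = cip N ?r a"
    unfolding cip_add_right[symmetric] by simp
  also have "\<dots> = cip N a a - cip N ?p a" by (rule cip_diff_left)
  finally have "cip N a a = cip N ?r ?r + cip N ?p a" using rp by (simp add: algebra_simps)
  hence "Re (cip N a a) = Re (cip N ?r ?r) + (\<Sum>v\<in>S. (cmod (cip N a v))\<^sup>2)" using pa by simp
  moreover have "Re (cip N ?r ?r) \<ge> 0" unfolding cip_self by (simp add: sum_nonneg)
  ultimately show ?thesis by simp
qed

definition eigenbasis ::
  "nat \<Rightarrow> (nat \<Rightarrow> nat \<Rightarrow> complex) \<Rightarrow> (nat \<Rightarrow> complex) set \<Rightarrow> ((nat \<Rightarrow> complex) \<Rightarrow> real) \<Rightarrow> bool" where
  "eigenbasis N A S l \<longleftrightarrow> finite S \<and> (\<forall>v\<in>S. \<forall>n>N. v n = 0) \<and>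
     (\<forall>u\<in>S. \<forall>v\<in>S. cip N u v = (if u = v then 1 else 0)) \<and>
     (\<forall>v\<in>S. mat_app N A v = (\<lambda>n. of_real (l v) * v n)) \<and>
     (\<forall>a. (\<forall>n>N. a n = 0) \<longrightarrow> a = (\<lambda>n. \<Sum>v\<in>S. cip N a v * v n))"

lemma eigenbasisD:
  assumes "eigenbasis N A S l"
  shows "finite S" and "v \<in> S \<Longrightarrow> n > N \<Longrightarrow> v n = 0"
    and "u \<in> S \<Longrightarrow> v \<in> S \<Longrightarrow> cip N u v = (if u = v then 1 else 0)"
    and "v \<in> S \<Longrightarrow> mat_app N A v = (\<lambda>n. of_real (l v) * v n)"
    and "\<forall>n>N. a n = 0 \<Longrightarrow> a = (\<lambda>n. \<Sum>v\<in>S. cip N a v * v n)"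
  using assms unfolding eigenbasis_def by simp_all

text \<open>An orthonormal set of eigenvectors of largest cardinality is complete: its orthogonal
  complement is invariant, and a nonzero vector in it would yield a further eigenvector by maximising the quadratic form.
  Cardinalities are bounded by \<open>N + 1\<close> because Bessel's inequality for the unit vectors gives
  \<open>\<Sum>v. \<bar>v n\<bar>\<^sup>2 \<le> 1\<close> for each \<open>n\<close>.\<close>

theorem hermitian_spectral_theorem:
  assumes herm: "\<And>m n. A m n = cnj (A n m)"
  shows "\<exists>S l. eigenbasis N A S l"
proof -
  have card: "card S \<le> N + 1" if "orthonormal_eigenset N A S" for S
  proof -
    have S: "finite S" "\<forall>v\<in>S. \<forall>w\<in>S. cip N v w = (if v = w then 1 else 0)"
      using that by (auto simp: orthonormal_eigenset_def)
    have "real (card S) = (\<Sum>v\<in>S. Re (cip N v v))" using S by simp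
    also have "\<dots> = (\<Sum>n\<le>N. \<Sum>v\<in>S. (cmod (v n))\<^sup>2)"
      unfolding cip_self by (subst sum.swap) simp
    also have "\<dots> \<le> (\<Sum>n\<le>N. 1)"
    proof (rule sum_mono)
      fix n assume n: "n \<in> {..N}"
      let ?e = "\<lambda>m. if m = n then 1 else 0 :: complex"
      have *: "(if m = n then 1 else 0) * x = (if m = n then x else 0)" for m and x :: complex by auto
      have "cip N ?e v = cnj (v n)" for v
        using n by (simp add: cip_def *)
      moreover have "cip N ?e ?e = 1" using n by (simp add: cip_def *)
      ultimately show "(\<Sum>v\<in>S. (cmod (v n))\<^sup>2) \<le> 1" using bessel_cip[OF S, of ?e] by simp
    qed
    finally show ?thesis by simp
  qed
  have empty: "orthonormal_eigenset N A {}" by (simp add: orthonormal_eigenset_def)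
  have "\<forall>T. orthonormal_eigenset N A T \<longrightarrow> card T < N + 2" using card by fastforce
  from ex_has_greatest_nat[OF empty this] obtain S where S: "orthonormal_eigenset N A S"
    and max: "\<And>T. orthonormal_eigenset N A T \<Longrightarrow> card T \<le> card S"
    by blast
  have S': "finite S" "\<forall>v\<in>S. \<forall>n>N. v n = 0" "\<forall>v\<in>S. \<forall>w\<in>S. cip N v w = (if v = w then 1 else 0)"
     "\<forall>v\<in>S. \<exists>l::real. mat_app N A v = (\<lambda>n. of_real l * v n)"
    using S by (auto simp: orthonormal_eigenset_def)
  define W where "W = {a. (\<forall>n>N. a n = 0) \<and> (\<forall>v\<in>S. cip N a v = 0)}"
  have inv: "mat_app N A a \<in> W" if "a \<in> W" for a
  proof -
    have "cip N (mat_app N A a) v = 0" if v: "v \<in> S" for v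
    proof -
      obtain l :: real where "mat_app N A v = (\<lambda>n. of_real l * v n)" using S' v by blast
      thus ?thesis using \<open>a \<in> W\<close> v by (simp add: mat_app_self_adjoint[OF herm] cip_scale_right W_def)
    qed
    thus ?thesis by (auto simp: W_def mat_app_def)
  qed
  have W0: "b = (\<lambda>n. 0)" if b: "b \<in> W" for b
  proof (rule ccontr)
    assume nz: "b \<noteq> (\<lambda>n. 0)"
    obtain a and l :: real where a: "a \<in> W" "cip N a a = 1" "mat_app N A a = (\<lambda>n. of_real l * a n)"
      using rayleigh_maximum[OF herm W_def inv b nz] by blast
    have "a \<notin> S"
    proof
      assume "a \<in> S"
      hence "cip N a a = 0" using a(1) unfolding W_def by blast
      thus False using a(2) by simp
    qed
    have av: "cip N a v = 0" and va: "cip N v a = 0" if "v \<in> S" for v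
    proof -
      show "cip N a v = 0" using a(1) that unfolding W_def by blast
      thus "cip N v a = 0" using cip_cnj[of N a v] by simp
    qed
    have "cip N v w = (if v = w then 1 else 0)" if "v \<in> insert a S" "w \<in> insert a S" for v w
    proof (cases "v = a"; cases "w = a")
      assume "v \<noteq> a" "w \<noteq> a"
      thus ?thesis using that S'(3) by blast
    next
      assume "v = a" "w \<noteq> a"
      thus ?thesis using that av[of w] by auto
    next
      assume "v \<noteq> a" "w = a"
      thus ?thesis using that va[of v] by auto
    qed (use a(2) in simp)
    moreover have "\<forall>n>N. a n = 0" using a(1) unfolding W_def by blast
    hence "\<forall>v\<in>insert a S. \<forall>n>N. v n = 0" using S'(2) by blast
    moreover have "\<forall>v\<in>insert a S. \<exists>l::real. mat_app N A v = (\<lambda>n. of_real l * v n)"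
      using S'(4) a(3) by blast
    ultimately have "orthonormal_eigenset N A (insert a S)"
      using S'(1) unfolding orthonormal_eigenset_def by blast
    from max[OF this] show False using \<open>a \<notin> S\<close> S' by simp
  qed
  have "a = (\<lambda>n. \<Sum>v\<in>S. cip N a v * v n)" if a: "\<forall>n>N. a n = 0" for a
  proof -
    have "(\<lambda>n. a n - (\<Sum>v\<in>S. cip N a v * v n)) \<in> W"
      using a S' fourier_residual_orthogonal[OF S'(1,3)] by (auto simp: W_def intro!: sum.neutral)
    from fun_cong[OF W0[OF this]] show ?thesis by (auto simp: fun_eq_iff)
  qed
  moreover from bchoice[OF S'(4)] obtain l :: "(nat \<Rightarrow> complex) \<Rightarrow> real"
    where "\<forall>v\<in>S. mat_app N A v = (\<lambda>n. of_real (l v) * v n)" ..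
  ultimately have "eigenbasis N A S l" using S'(1-3) by (simp add: eigenbasis_def)
  thus ?thesis by (intro exI)
qed

text \<open>Sums over an eigenbasis become sums over coordinates; this single identity yields the dimension count, the
  pointwise equality of the two sums of squared basis functions and the formula for the sum of squared eigenvalues.\<close>

lemma parseval_cip:
  assumes eb: "eigenbasis N A S l"
  shows "(\<Sum>v\<in>S. (cmod (cip N x v))\<^sup>2) = (\<Sum>n\<le>N. (cmod (x n))\<^sup>2)"
proof -
  define y where "y n = (if n \<le> N then x n else 0)" for n
  have y: "cip N y v = cip N x v" for v by (simp add: cip_def y_def)
  have "cip N y y = cip N (\<lambda>n. \<Sum>v\<in>S. cip N y v * v n) y"
    by (subst (1) eigenbasisD(5)[OF eb, of y]) (auto simp: y_def)
  also have "\<dots> = (\<Sum>v\<in>S. cip N y v * cip N v y)" by (simp add: cip_sum_left cip_scale_left)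
  also have "\<dots> = (\<Sum>v\<in>S. of_real ((cmod (cip N x v))\<^sup>2))"
    by (intro sum.cong refl) (simp only: complex_norm_square cip_cnj y[symmetric])
  finally have "of_real (\<Sum>n\<le>N. (cmod (y n))\<^sup>2) = complex_of_real (\<Sum>v\<in>S. (cmod (cip N x v))\<^sup>2)"
    unfolding cip_self by simp
  hence "(\<Sum>n\<le>N. (cmod (y n))\<^sup>2) = (\<Sum>v\<in>S. (cmod (cip N x v))\<^sup>2)" unfolding of_real_eq_iff .
  thus ?thesis by (simp add: y_def)
qed

section \<open>Trigonometric polynomials on the circle\<close>

text \<open>Factoring out the lowest frequency leaves an ordinary polynomial in \<open>cis \<theta>\<close>, so closure under sums and
  products comes from polynomial arithmetic.\<close>

definition trig_poly :: "nat \<Rightarrow> complex poly \<Rightarrow> real \<Rightarrow> complex" where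
  "trig_poly J p \<theta> = cis (- (real J * \<theta>)) * poly p (cis \<theta>)"

lemma trig_poly_of_polynomial_function:
  assumes "real_polynomial_function g"
  shows "\<exists>J p. \<forall>\<theta>. of_real (g (cis \<theta>)) = trig_poly J p \<theta>"
  using assms
proof (induction rule: real_polynomial_function.induct)
  case (linear f)
  interpret bounded_linear f by fact
  have f: "f (cis \<theta>) = cos \<theta> * f 1 + sin \<theta> * f \<i>" for \<theta>
  proof -
    have "cis \<theta> = cos \<theta> *\<^sub>R 1 + sin \<theta> *\<^sub>R \<i>" by (simp add: complex_eq_iff)
    thus ?thesis by (simp only: add scaleR) simp
  qed
  have "complex_of_real (f (cis \<theta>)) =
     trig_poly 1 [:of_real (f 1) / 2 - of_real (f \<i>) / (2 * \<i>), 0, of_real (f 1) / 2 + of_real (f \<i>) / (2 * \<i>):] \<theta>" for \<theta>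
  proof -
    have 1: "cis \<theta> * (cis \<theta> * (cis (- \<theta>) * x)) = cis \<theta> * x" for x
      by (simp add: cis_mult mult.assoc[symmetric])
    have 2: "of_real (cos \<theta>) = (cis \<theta> + cis (- \<theta>)) / 2" "of_real (sin \<theta>) = (cis \<theta> - cis (- \<theta>)) / (2 * \<i>)"
      by (auto simp: complex_eq_iff)
    show ?thesis unfolding f of_real_add of_real_mult 2 trig_poly_def
      by (simp add: algebra_simps 1 add_divide_distrib diff_divide_distrib)
  qed
  thus ?case by blast
next
  case (const c)
  have "complex_of_real c = trig_poly 0 [:of_real c:] \<theta>" for \<theta> by (simp add: trig_poly_def)
  thus ?case by blast
next
  case (add f g)
  then obtain J p K q where *: "\<And>\<theta>. of_real (f (cis \<theta>)) = trig_poly J p \<theta>" "\<And>\<theta>. of_real (g (cis \<theta>)) = trig_poly K q \<theta>"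
    by blast
  have "complex_of_real (f (cis \<theta>) + g (cis \<theta>)) = trig_poly (J + K) (monom 1 K * p + monom 1 J * q) \<theta>" for \<theta>
  proof -
    have "cis (- (real (J + K) * \<theta>)) * cis (real K * \<theta>) = cis (- (real J * \<theta>))"
         "cis (- (real (J + K) * \<theta>)) * cis (real J * \<theta>) = cis (- (real K * \<theta>))"
      by (simp_all add: cis_mult algebra_simps)
    thus ?thesis unfolding of_real_add * trig_poly_def
      by (simp add: poly_monom Complex.DeMoivre distrib_left mult.assoc[symmetric])
  qed
  thus ?case by blast
next
  case (mult f g)
  then obtain J p K q where *: "\<And>\<theta>. of_real (f (cis \<theta>)) = trig_poly J p \<theta>" "\<And>\<theta>. of_real (g (cis \<theta>)) = trig_poly K q \<theta>"
    by blast
  have "complex_of_real (f (cis \<theta>) * g (cis \<theta>)) = trig_poly (J + K) (p * q) \<theta>" for \<theta>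
  proof -
    have "cis (- (real (J + K) * \<theta>)) = cis (- (real J * \<theta>)) * cis (- (real K * \<theta>))"
      by (simp_all add: cis_mult algebra_simps)
    thus ?thesis unfolding of_real_mult * trig_poly_def by simp
  qed
  thus ?case by blast
qed

text \<open>Since \<open>h\<close> takes the same value at both ends, it is a continuous function on the unit circle
  (the parametrisation by \<open>cis\<close> is a quotient map by compactness), and Stone--Weierstrass approximates it by polynomials in the
  real and imaginary part.\<close>

lemma trig_poly_uniformly_dense:
  fixes h :: "real \<Rightarrow> real"
  assumes h: "continuous_on {0..2 * pi} h" "h 0 = 0" "h (2 * pi) = 0" and e: "e > 0"
  shows "\<exists>J p. \<forall>\<theta>\<in>{0..2 * pi}. cmod (of_real (h \<theta>) - trig_poly J p \<theta>) < e"
proof -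
  define H where "H z = h (Arg2pi z)" for z
  have Hcis: "H (cis \<theta>) = h \<theta>" if "\<theta> \<in> {0..2 * pi}" for \<theta>
  proof (cases "\<theta> = 2 * pi")
    case True
    moreover have "Arg2pi 1 = 0" by (simp add: Arg2pi_eq_0)
    ultimately show ?thesis using h by (simp add: H_def)
  next
    case False
    hence "Arg2pi (cis \<theta>) = \<theta>" using that by (intro Arg2pi_unique[of 1]) (auto simp: cis_conv_exp)
    thus ?thesis by (simp add: H_def)
  qed
  have onto: "\<exists>\<theta>\<in>{0..2 * pi}. z = cis \<theta>" if "z \<in> sphere 0 1" for z
    using that Arg2pi_eq[of z] Arg2pi_ge_0[of z] Arg2pi_lt_2pi[of z]
    by (intro bexI[of _ "Arg2pi z"]) (auto simp: cis_conv_exp mult.commute)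
  have "continuous_on (sphere 0 1) H"
    unfolding continuous_on_closed_vimage[OF closed_sphere]
  proof (intro allI impI)
    fix B :: "real set" assume B: "closed B"
    have "H -` B \<inter> sphere 0 1 = cis ` (h -` B \<inter> {0..2 * pi})"
      using onto Hcis by (fastforce simp: image_iff)
    moreover have "compact (h -` B \<inter> {0..2 * pi})"
    proof -
      have "closed (h -` B \<inter> {0..2 * pi})"
        using h(1) B by (simp add: continuous_on_closed_vimage)
      thus ?thesis by (metis compact_Int_closed compact_Icc inf_commute inf_left_idem)
    qed
    hence "compact (cis ` (h -` B \<inter> {0..2 * pi}))"
      by (intro compact_continuous_image continuous_intros)
    ultimately show "closed (H -` B \<inter> sphere 0 1)" by (simp add: compact_imp_closed)
  qed
  then obtain g where g: "real_polynomial_function g" "\<And>z. z \<in> sphere 0 1 \<Longrightarrow> \<bar>H z - g z\<bar> < e"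
    using Stone_Weierstrass_real_polynomial_function[OF compact_sphere _ e] by metis
  obtain J p where p: "\<And>\<theta>. of_real (g (cis \<theta>)) = trig_poly J p \<theta>"
    using trig_poly_of_polynomial_function[OF g(1)] by blast
  have "cmod (of_real (h \<theta>) - trig_poly J p \<theta>) < e" if "\<theta> \<in> {0..2 * pi}" for \<theta>
    using g(2)[of "cis \<theta>"] Hcis[OF that] unfolding p[symmetric] of_real_diff[symmetric] norm_of_real by simp
  thus ?thesis by blast
qed

lemma measurable_trig_poly [measurable]: "trig_poly J p \<in> borel_measurable borel"
  unfolding trig_poly_def by (intro borel_measurable_continuous_onI continuous_intros)

text \<open>A measurable function is almost everywhere a limit of continuous ones. Truncating these at \<open>B\<close> and
  multiplying by a cutoff that vanishes at both ends makes uniform approximation applicable, and dominated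
  convergence controls the error in the mean square.\<close>

theorem trig_poly_L2_dense:
  fixes s :: "real \<Rightarrow> real"
  assumes s: "s \<in> borel_measurable (lebesgue_on {0..2 * pi})"
    and B: "\<And>\<theta>. \<theta> \<in> {0..2 * pi} \<Longrightarrow> \<bar>s \<theta>\<bar> \<le> B" and e: "e > 0"
  shows "\<exists>J p. (LINT \<theta>|lebesgue_on {0..2 * pi}. (cmod (of_real (s \<theta>) - trig_poly J p \<theta>))\<^sup>2) < e"
proof -
  let ?U = "lebesgue_on {0..2 * pi}"
  interpret U: finite_measure ?U by (rule finite_measure_lebesgue_on) auto
  have B0: "B \<ge> 0" using B[of 0] by force
  have bm: "f \<in> borel_measurable ?U" if "f \<in> borel_measurable borel" for f :: "real \<Rightarrow> 'b::topological_space"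
    using that by (auto intro!: measurable_restrict_space1 measurable_completion)
  have sm: "s measurable_on {0..2 * pi}"
    using s by (subst measurable_on_iff_borel_measurable) auto
  then obtain N g where N: "negligible N" and g: "\<And>n. continuous_on UNIV (g n)"
    and lim: "\<And>x. x \<notin> N \<Longrightarrow> (\<lambda>n. g n x) \<longlonglongrightarrow> (if x \<in> {0..2 * pi} then s x else 0)"
    unfolding measurable_on_def by blast
  define h where "h n \<theta> = max (- B) (min B (g n \<theta>)) * min 1 (real n * min \<theta> (2 * pi - \<theta>))" for n \<theta>
  have h_cont: "continuous_on S (h n)" for n S
    unfolding h_def by (intro continuous_intros continuous_on_subset[OF g]) auto
  have h_meas[measurable]: "h n \<in> borel_measurable borel" for n
    using h_cont by (rule borel_measurable_continuous_onI)
  have h_bd: "\<bar>h n \<theta>\<bar> \<le> B" if "\<theta> \<in> {0..2 * pi}" for n \<theta>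
  proof -
    have "\<bar>h n \<theta>\<bar> \<le> B * 1" unfolding h_def abs_mult using that B0
      by (intro mult_mono) auto
    thus ?thesis by simp
  qed
  have h_lim: "(\<lambda>n. h n \<theta>) \<longlonglongrightarrow> s \<theta>" if "\<theta> \<notin> N" "\<theta> \<in> {0<..<2 * pi}" for \<theta>
  proof -
    have "(\<lambda>n. max (- B) (min B (g n \<theta>))) \<longlonglongrightarrow> max (- B) (min B (s \<theta>))"
      using lim[OF that(1)] that(2) by (intro tendsto_intros) auto
    also have "max (- B) (min B (s \<theta>)) = s \<theta>" using B[of \<theta>] that by (auto simp: abs_le_iff)
    finally have 1: "(\<lambda>n. max (- B) (min B (g n \<theta>))) \<longlonglongrightarrow> s \<theta>" .
    define d where "d = min \<theta> (2 * pi - \<theta>)"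
    have d: "d > 0" using that by (auto simp: d_def)
    obtain n0 where n0: "1 / d \<le> real n0" using real_arch_simple by blast
    have "min 1 (real n * d) = 1" if "n \<ge> n0" for n
    proof -
      have "1 / d \<le> real n" using n0 that by linarith
      thus ?thesis using d by (simp add: field_simps)
    qed
    hence "eventually (\<lambda>n. min 1 (real n * d) = 1) sequentially"
      by (auto simp: eventually_sequentially)
    hence "(\<lambda>n. min 1 (real n * d)) \<longlonglongrightarrow> 1" by (rule tendsto_eventually)
    from tendsto_mult[OF 1 this] show ?thesis unfolding h_def d_def by simp
  qed
  have "(\<lambda>n. LINT \<theta>|?U. (s \<theta> - h n \<theta>)\<^sup>2) \<longlonglongrightarrow> (LINT \<theta>|?U. 0)"
  proof (rule integral_dominated_convergence[where w = "\<lambda>_. (2 * B)\<^sup>2"])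
    have "AE \<theta> in lebesgue. \<theta> \<notin> N \<union> {0, 2 * pi}"
      using N by (intro AE_not_in) (auto simp: negligible_iff_null_sets[symmetric])
    hence "AE \<theta> in ?U. \<theta> \<notin> N \<union> {0, 2 * pi}"
      by (subst AE_restrict_space_iff) auto
    moreover have "AE \<theta> in ?U. \<theta> \<in> {0..2 * pi}" by (rule AE_I2) auto
    ultimately show "AE \<theta> in ?U. (\<lambda>n. (s \<theta> - h n \<theta>)\<^sup>2) \<longlonglongrightarrow> 0"
    proof eventually_elim
      case (elim \<theta>)
      have "(\<lambda>n. (s \<theta> - h n \<theta>)\<^sup>2) \<longlonglongrightarrow> (s \<theta> - s \<theta>)\<^sup>2"
        using elim by (intro tendsto_intros h_lim) auto
      thus ?case by simp
    qed
    show "AE \<theta> in ?U. norm ((s \<theta> - h n \<theta>)\<^sup>2) \<le> (2 * B)\<^sup>2" for n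
    proof (rule AE_I2)
      fix \<theta> assume "\<theta> \<in> space ?U"
      hence t: "\<theta> \<in> {0..2 * pi}" by simp
      have "\<bar>s \<theta> - h n \<theta>\<bar> \<le> 2 * B" using B[OF t] h_bd[OF t, of n] by linarith
      from power_mono[OF this, of 2] show "norm ((s \<theta> - h n \<theta>)\<^sup>2) \<le> (2 * B)\<^sup>2" by simp
    qed
  qed (use s bm[OF h_meas] in auto)
  hence "eventually (\<lambda>n. (LINT \<theta>|?U. (s \<theta> - h n \<theta>)\<^sup>2) < e / 4) sequentially"
    using e by (intro order_tendstoD(2)) auto
  then obtain n0 where n0: "\<And>n. n \<ge> n0 \<Longrightarrow> (LINT \<theta>|?U. (s \<theta> - h n \<theta>)\<^sup>2) < e / 4"
    unfolding eventually_sequentially by blast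
  define n where "n = n0"
  have n: "(LINT \<theta>|?U. (s \<theta> - h n \<theta>)\<^sup>2) < e / 4" using n0[of n] by (simp add: n_def)
  \<comment> \<open>chosen so that \<open>2 * d\<^sup>2\<close> integrates to \<open>e / 4\<close> over the circle\<close>
  define d where "d = sqrt (e / (8 * (2 * pi)))"
  have d: "d > 0" "d\<^sup>2 = e / (8 * (2 * pi))" using e by (auto simp: d_def)
  have h0: "h n 0 = 0" "h n (2 * pi) = 0" by (simp_all add: h_def)
  obtain J p where p: "\<And>\<theta>. \<theta> \<in> {0..2 * pi} \<Longrightarrow> cmod (of_real (h n \<theta>) - trig_poly J p \<theta>) < d"
    using trig_poly_uniformly_dense[OF h_cont h0 d(1)] by blast
  have int1: "integrable ?U (\<lambda>\<theta>. (s \<theta> - h n \<theta>)\<^sup>2)"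
  proof (rule U.integrable_const_bound[of _ "(2 * B)\<^sup>2"])
    show "AE \<theta> in ?U. norm ((s \<theta> - h n \<theta>)\<^sup>2) \<le> (2 * B)\<^sup>2"
    proof (rule AE_I2)
      fix \<theta> assume "\<theta> \<in> space ?U"
      hence t: "\<theta> \<in> {0..2 * pi}" by simp
      have "\<bar>s \<theta> - h n \<theta>\<bar> \<le> 2 * B" using B[OF t] h_bd[OF t, of n] by linarith
      from power_mono[OF this, of 2] show "norm ((s \<theta> - h n \<theta>)\<^sup>2) \<le> (2 * B)\<^sup>2" by simp
    qed
  qed (use s bm[OF h_meas] in auto)
  have pt: "(cmod (of_real (s \<theta>) - trig_poly J p \<theta>))\<^sup>2 \<le> 2 * (s \<theta> - h n \<theta>)\<^sup>2 + 2 * d\<^sup>2"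
    if t: "\<theta> \<in> {0..2 * pi}" for \<theta>
  proof -
    have "cmod (of_real (s \<theta>) - trig_poly J p \<theta>) \<le> cmod (of_real (s \<theta> - h n \<theta>)) + cmod (of_real (h n \<theta>) - trig_poly J p \<theta>)"
      by (rule order_trans[OF _ norm_triangle_ineq]) simp
    also have "\<dots> \<le> \<bar>s \<theta> - h n \<theta>\<bar> + d" using p[OF t] unfolding norm_of_real by simp
    finally have "(cmod (of_real (s \<theta>) - trig_poly J p \<theta>))\<^sup>2 \<le> (\<bar>s \<theta> - h n \<theta>\<bar> + d)\<^sup>2"
      by (rule power_mono) simp
    also have "\<dots> \<le> 2 * (s \<theta> - h n \<theta>)\<^sup>2 + 2 * d\<^sup>2"
      using sum_squares_bound[of "\<bar>s \<theta> - h n \<theta>\<bar>" d] by (simp add: power2_sum)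
    finally show ?thesis .
  qed
  have "(LINT \<theta>|?U. (cmod (of_real (s \<theta>) - trig_poly J p \<theta>))\<^sup>2) \<le> (LINT \<theta>|?U. 2 * (s \<theta> - h n \<theta>)\<^sup>2 + 2 * d\<^sup>2)"
  proof (rule integral_mono_AE)
    show "integrable ?U (\<lambda>\<theta>. 2 * (s \<theta> - h n \<theta>)\<^sup>2 + 2 * d\<^sup>2)" using int1 by auto
    thus "integrable ?U (\<lambda>\<theta>. (cmod (of_real (s \<theta>) - trig_poly J p \<theta>))\<^sup>2)"
      by (rule Bochner_Integration.integrable_bound)
         (use s bm[OF measurable_trig_poly] pt in \<open>auto intro!: AE_I2 order_trans[OF _ abs_ge_self]\<close>)
  qed (use pt in \<open>auto intro!: AE_I2\<close>)
  also have "\<dots> = 2 * (LINT \<theta>|?U. (s \<theta> - h n \<theta>)\<^sup>2) + 2 * d\<^sup>2 * (2 * pi)"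
    using int1 by (simp add: measure_restrict_space)
  also have "\<dots> < e" using n d e by (simp add: field_simps)
  finally show ?thesis by blast
qed

section \<open>Square-integrable functions and orthogonal projections\<close>

definition sq_integrable :: "'a measure \<Rightarrow> ('a \<Rightarrow> complex) \<Rightarrow> bool" where
  "sq_integrable M f \<longleftrightarrow> f \<in> borel_measurable M \<and> integrable M (\<lambda>x. (cmod (f x))\<^sup>2)"

lemma sq_integrable_measurable: "sq_integrable M f \<Longrightarrow> f \<in> borel_measurable M"
  by (simp add: sq_integrable_def)

lemma borel_measurable_cnj [measurable (raw)]:
  "f \<in> borel_measurable M \<Longrightarrow> (\<lambda>x. cnj (f x)) \<in> borel_measurable M"
  by (rule borel_measurable_continuous_on[OF continuous_on_cnj[OF continuous_on_id]])

lemma integrable_mult_cnj: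
  assumes f: "sq_integrable M f" and g: "sq_integrable M g"
  shows "integrable M (\<lambda>x. f x * cnj (g x))"
proof (rule Bochner_Integration.integrable_bound)
  show "integrable M (\<lambda>x. (cmod (f x))\<^sup>2 + (cmod (g x))\<^sup>2)"
    using f g by (auto simp: sq_integrable_def)
  show "(\<lambda>x. f x * cnj (g x)) \<in> borel_measurable M"
    using f g by (intro borel_measurable_times borel_measurable_cnj) (auto simp: sq_integrable_def)
  have "a * b \<le> a\<^sup>2 + b\<^sup>2" if "a \<ge> 0" "b \<ge> 0" for a b :: real
  proof -
    have "2 * (a * b) \<le> a\<^sup>2 + b\<^sup>2" using sum_squares_bound[of a b] by simp
    thus ?thesis using mult_nonneg_nonneg[OF that] by linarith
  qed
  thus "AE x in M. norm (f x * cnj (g x)) \<le> norm ((cmod (f x))\<^sup>2 + (cmod (g x))\<^sup>2)"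
    by (intro AE_I2) (simp add: norm_mult)
qed

lemma sq_integrable_cmult: "sq_integrable M f \<Longrightarrow> sq_integrable M (\<lambda>x. t * f x)"
  by (auto simp: sq_integrable_def norm_mult power_mult_distrib)

lemma sq_integrable_add:
  assumes f: "sq_integrable M f" and g: "sq_integrable M g"
  shows "sq_integrable M (\<lambda>x. f x + g x)"
  unfolding sq_integrable_def
proof
  show m: "(\<lambda>x. f x + g x) \<in> borel_measurable M"
    using f g by (auto simp: sq_integrable_def)
  show "integrable M (\<lambda>x. (cmod (f x + g x))\<^sup>2)"
  proof (rule Bochner_Integration.integrable_bound)
    show "integrable M (\<lambda>x. 2 * (cmod (f x))\<^sup>2 + 2 * (cmod (g x))\<^sup>2)"
      using f g by (auto simp: sq_integrable_def)
    have "(cmod (a + b))\<^sup>2 \<le> 2 * (cmod a)\<^sup>2 + 2 * (cmod b)\<^sup>2" for a b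
    proof -
      have "(cmod (a + b))\<^sup>2 \<le> (cmod a + cmod b)\<^sup>2"
        by (intro power_mono norm_triangle_ineq) auto
      also have "\<dots> \<le> 2 * (cmod a)\<^sup>2 + 2 * (cmod b)\<^sup>2"
        using sum_squares_bound[of "cmod a" "cmod b"] by (simp add: power2_sum)
      finally show ?thesis .
    qed
    thus "AE x in M. norm ((cmod (f x + g x))\<^sup>2) \<le> norm (2 * (cmod (f x))\<^sup>2 + 2 * (cmod (g x))\<^sup>2)"
      by (intro AE_I2) simp
  qed (use m in measurable)
qed

lemma sq_integrable_diff:
  assumes f: "sq_integrable M f" and g: "sq_integrable M g"
  shows "sq_integrable M (\<lambda>x. f x - g x)"
  using sq_integrable_add[OF f sq_integrable_cmult[OF g, of "-1"]] by simp

lemma sq_integrable_zero: "sq_integrable M (\<lambda>x. 0)"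
  by (simp add: sq_integrable_def)

lemma sq_integrable_sum:
  "(\<And>i. i \<in> I \<Longrightarrow> sq_integrable M (f i)) \<Longrightarrow> sq_integrable M (\<lambda>x. \<Sum>i\<in>I. f i x)"
proof (induction I rule: infinite_finite_induct)
  case (insert i I)
  thus ?case using sq_integrable_add[of M "f i" "\<lambda>x. \<Sum>i\<in>I. f i x"] by simp
qed (auto simp: sq_integrable_zero)

lemma sq_integrable_lincomb:
  "(\<And>i. i \<in> I \<Longrightarrow> sq_integrable M (f i)) \<Longrightarrow> sq_integrable M (\<lambda>x. \<Sum>i\<in>I. a i * f i x)"
  by (intro sq_integrable_sum sq_integrable_cmult)

lemma sq_integrable_bounded_mult:
  assumes g: "sq_integrable M g" and s: "s \<in> borel_measurable M"
    and B: "\<And>x. x \<in> space M \<Longrightarrow> cmod (s x) \<le> B"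
  shows "sq_integrable M (\<lambda>x. s x * g x)"
  unfolding sq_integrable_def
proof
  show m: "(\<lambda>x. s x * g x) \<in> borel_measurable M"
    using g s by (auto simp: sq_integrable_def)
  show "integrable M (\<lambda>x. (cmod (s x * g x))\<^sup>2)"
  proof (rule Bochner_Integration.integrable_bound)
    show "integrable M (\<lambda>x. B\<^sup>2 * (cmod (g x))\<^sup>2)"
      using g by (auto simp: sq_integrable_def)
    show "AE x in M. norm ((cmod (s x * g x))\<^sup>2) \<le> norm (B\<^sup>2 * (cmod (g x))\<^sup>2)"
      using B by (intro AE_I2) (auto simp: norm_mult power_mult_distrib intro!: mult_right_mono power_mono)
  qed (use m in measurable)
qed

lemma L2_inner_diff_left:
  "\<lbrakk>sq_integrable M f; sq_integrable M g; sq_integrable M h\<rbrakk> \<Longrightarrow>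
   L2_inner M (\<lambda>x. f x - g x) h = L2_inner M f h - L2_inner M g h"
  unfolding L2_inner_def by (simp add: left_diff_distrib integrable_mult_cnj)

lemma L2_inner_diff_right:
  "\<lbrakk>sq_integrable M f; sq_integrable M g; sq_integrable M h\<rbrakk> \<Longrightarrow>
   L2_inner M h (\<lambda>x. f x - g x) = L2_inner M h f - L2_inner M h g"
  unfolding L2_inner_def by (simp add: right_diff_distrib integrable_mult_cnj)

lemma L2_inner_cnj: "cnj (L2_inner M f g) = L2_inner M g f"
  unfolding L2_inner_def by (subst Bochner_Integration.integral_cnj[symmetric]) (simp add: mult.commute)

lemma L2_inner_lincomb_left:
  assumes f: "\<And>i. i \<in> I \<Longrightarrow> sq_integrable M (f i)" and h: "sq_integrable M h"
  shows "L2_inner M (\<lambda>x. \<Sum>i\<in>I. a i * f i x) h = (\<Sum>i\<in>I. a i * L2_inner M (f i) h)"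
proof -
  have "L2_inner M (\<lambda>x. \<Sum>i\<in>I. a i * f i x) h = (LINT x|M. (\<Sum>i\<in>I. a i * f i x * cnj (h x)))"
    unfolding L2_inner_def by (simp add: sum_distrib_right)
  also have "\<dots> = (\<Sum>i\<in>I. LINT x|M. a i * f i x * cnj (h x))"
    by (rule Bochner_Integration.integral_sum) (use integrable_mult_cnj[OF sq_integrable_cmult[OF f] h] in auto)
  also have "\<dots> = (\<Sum>i\<in>I. a i * L2_inner M (f i) h)"
    unfolding L2_inner_def by (simp add: mult.assoc)
  finally show ?thesis .
qed

lemma L2_inner_lincomb_right:
  assumes f: "\<And>i. i \<in> I \<Longrightarrow> sq_integrable M (f i)" and h: "sq_integrable M h"
  shows "L2_inner M h (\<lambda>x. \<Sum>i\<in>I. a i * f i x) = (\<Sum>i\<in>I. cnj (a i) * L2_inner M h (f i))"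
  using arg_cong[OF L2_inner_lincomb_left[OF f h, where a = a], where f = cnj] by (simp add: L2_inner_cnj)

lemma L2_inner_self: "L2_inner M f f = of_real (LINT x|M. (cmod (f x))\<^sup>2)"
  unfolding L2_inner_def complex_norm_square[symmetric] integral_complex_of_real ..

text \<open>The pointwise bound \<open>\<bar>g\<bar> \<bar>h\<bar> \<le> t \<bar>g\<bar>\<^sup>2 + \<bar>h\<bar>\<^sup>2 / t\<close>, with \<open>t\<close> chosen small after \<open>g\<close>, replaces
  the Cauchy--Schwarz inequality.\<close>

lemma L2_inner_tendsto_zero:
  assumes g: "sq_integrable M g" and h: "\<And>n. sq_integrable M (h n)"
    and lim: "(\<lambda>n::nat. LINT x|M. (cmod (h n x))\<^sup>2) \<longlonglongrightarrow> 0"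
  shows "(\<lambda>n. L2_inner M g (h n)) \<longlonglongrightarrow> 0"
proof (rule LIMSEQ_I)
  fix e :: real assume e: "e > 0"
  define G where "G = (LINT x|M. (cmod (g x))\<^sup>2)"
  have G: "G \<ge> 0" by (simp add: G_def)
  define t where "t = e / (2 * (G + 1))"
  have t: "t > 0" "t * G < e / 2" using e G by (auto simp: t_def field_simps)
  have bound: "cmod (L2_inner M g (h n)) \<le> t * G + (LINT x|M. (cmod (h n x))\<^sup>2) / t" for n
  proof -
    have "cmod (L2_inner M g (h n)) \<le> (LINT x|M. cmod (g x * cnj (h n x)))"
      unfolding L2_inner_def by (rule integral_norm_bound)
    also have "\<dots> \<le> (LINT x|M. t * (cmod (g x))\<^sup>2 + (cmod (h n x))\<^sup>2 / t)"
    proof (rule integral_mono)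
      show "integrable M (\<lambda>x. cmod (g x * cnj (h n x)))"
        by (intro integrable_norm integrable_mult_cnj g h)
      show "integrable M (\<lambda>x. t * (cmod (g x))\<^sup>2 + (cmod (h n x))\<^sup>2 / t)"
        using g h[of n] by (auto simp: sq_integrable_def)
      fix x
      have "a * b \<le> t * a\<^sup>2 + b\<^sup>2 / t" if "a \<ge> 0" "b \<ge> 0" for a b :: real
      proof -
        have "2 * (t * a) * b \<le> (t * a)\<^sup>2 + b\<^sup>2" by (rule sum_squares_bound)
        moreover have "0 \<le> t * a * b" using that t by simp
        ultimately have "t * a * b \<le> (t * a)\<^sup>2 + b\<^sup>2" by linarith
        also have "\<dots> = t * (t * a\<^sup>2 + b\<^sup>2 / t)" using t by (simp add: power2_eq_square field_simps)
        finally show ?thesis using t by (simp add: mult.assoc)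
      qed
      thus "cmod (g x * cnj (h n x)) \<le> t * (cmod (g x))\<^sup>2 + (cmod (h n x))\<^sup>2 / t"
        by (simp add: norm_mult)
    qed
    also have "\<dots> = t * G + (LINT x|M. (cmod (h n x))\<^sup>2) / t"
      using g h[of n] by (simp add: sq_integrable_def G_def)
    finally show ?thesis .
  qed
  have "eventually (\<lambda>n. (LINT x|M. (cmod (h n x))\<^sup>2) < e / 2 * t) sequentially"
    using lim e t by (intro order_tendstoD(2)) auto
  then obtain n0 where n0: "\<And>n. n \<ge> n0 \<Longrightarrow> (LINT x|M. (cmod (h n x))\<^sup>2) < e / 2 * t"
    unfolding eventually_sequentially by blast
  have "cmod (L2_inner M g (h n)) < e" if "n \<ge> n0" for n
  proof -
    have "(LINT x|M. (cmod (h n x))\<^sup>2) / t < e / 2" using n0[OF that] t by (simp add: field_simps)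
    thus ?thesis using bound[of n] t by linarith
  qed
  thus "\<exists>no. \<forall>n\<ge>no. norm (L2_inner M g (h n) - 0) < e" by auto
qed

definition orthonormal_on :: "'i set \<Rightarrow> complex measure \<Rightarrow> ('i \<Rightarrow> complex \<Rightarrow> complex) \<Rightarrow> bool" where
  "orthonormal_on I M v \<longleftrightarrow> (\<forall>i\<in>I. sq_integrable M (v i)) \<and>
     (\<forall>i\<in>I. \<forall>j\<in>I. L2_inner M (v i) (v j) = (if i = j then 1 else 0))"

lemma L2_inner_orthonormal_coeff:
  assumes I: "finite I" and v: "orthonormal_on I M v" and j: "j \<in> I"
  shows "L2_inner M (\<lambda>z. \<Sum>i\<in>I. a i * v i z) (v j) = a j"
proof -
  have "L2_inner M (\<lambda>z. \<Sum>i\<in>I. a i * v i z) (v j) = (\<Sum>i\<in>I. a i * L2_inner M (v i) (v j))"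
    using v j by (intro L2_inner_lincomb_left) (auto simp: orthonormal_on_def)
  also have "\<dots> = (\<Sum>i\<in>I. if i = j then a i else 0)"
    using v j by (intro sum.cong) (auto simp: orthonormal_on_def)
  finally show ?thesis using I j by simp
qed

lemma L2_norm_lincomb:
  assumes I: "finite I" and v: "orthonormal_on I M v"
  shows "L2_inner M (\<lambda>z. \<Sum>i\<in>I. a i * v i z) (\<lambda>z. \<Sum>i\<in>I. b i * v i z) = (\<Sum>i\<in>I. a i * cnj (b i))"
proof -
  have vi: "sq_integrable M (v i)" if "i \<in> I" for i using v that by (auto simp: orthonormal_on_def)
  have "L2_inner M (\<lambda>z. \<Sum>i\<in>I. a i * v i z) (\<lambda>z. \<Sum>i\<in>I. b i * v i z)
     = (\<Sum>i\<in>I. cnj (b i) * L2_inner M (\<lambda>z. \<Sum>i\<in>I. a i * v i z) (v i))"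
    by (intro L2_inner_lincomb_right sq_integrable_lincomb vi)
  also have "\<dots> = (\<Sum>i\<in>I. a i * cnj (b i))"
    by (intro sum.cong) (auto simp: L2_inner_orthonormal_coeff[OF I v])
  finally show ?thesis .
qed

text \<open>Orthogonality to each \<open>v i\<close> determines the coefficients, which gives uniqueness without any reference to
  almost everywhere equality. It applies both to \<open>KN\<close> and to eigenspaces.\<close>

lemma orth_proj_orthonormal:
  assumes I: "finite I" and v: "orthonormal_on I M v" and g: "sq_integrable M g"
    and S: "S = {f. \<exists>a. f = (\<lambda>z. \<Sum>i\<in>I. a i * v i z)}"
  shows "orth_proj M S g = (\<lambda>z. \<Sum>i\<in>I. L2_inner M g (v i) * v i z)"
  unfolding orth_proj_def
proof (rule the_equality)
  have vi: "sq_integrable M (v i)" if "i \<in> I" for i using v that by (auto simp: orthonormal_on_def)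
  have coeff: "L2_inner M (\<lambda>z. g z - (\<Sum>i\<in>I. a i * v i z)) (v j) = L2_inner M g (v j) - a j"
    if "j \<in> I" for a j
    using L2_inner_diff_left[OF g sq_integrable_lincomb[of I M v a] vi[OF that]] vi
      L2_inner_orthonormal_coeff[OF I v that] by simp
  let ?p = "\<lambda>z. \<Sum>i\<in>I. L2_inner M g (v i) * v i z"
  have "L2_inner M (\<lambda>z. g z - ?p z) h = 0" if hS: "h \<in> S" for h
  proof -
    obtain a where h: "h = (\<lambda>z. \<Sum>i\<in>I. a i * v i z)" using hS unfolding S by auto
    have "sq_integrable M (\<lambda>z. g z - ?p z)"
      by (intro sq_integrable_diff g sq_integrable_lincomb vi)
    thus ?thesis unfolding h by (subst L2_inner_lincomb_right[OF vi]) (auto simp: coeff)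
  qed
  moreover have "?p \<in> S" unfolding S by (intro CollectI exI[of _ "\<lambda>i. L2_inner M g (v i)"] refl)
  ultimately show "?p \<in> S \<and> (\<forall>h\<in>S. L2_inner M (\<lambda>z. g z - ?p z) h = 0)" by simp
  fix f assume f: "f \<in> S \<and> (\<forall>h\<in>S. L2_inner M (\<lambda>z. g z - f z) h = 0)"
  hence "f \<in> S" ..
  then obtain a where a: "f = (\<lambda>z. \<Sum>i\<in>I. a i * v i z)" unfolding S by auto
  have "a j = L2_inner M g (v j)" if "j \<in> I" for j
  proof -
    have "v j = (\<lambda>z. \<Sum>i\<in>I. (if i = j then 1 else 0) * v i z)"
      using I that by (simp add: if_distrib[of "\<lambda>x. x * _"] cong: if_cong)
    hence "v j \<in> S" unfolding S by (intro CollectI exI)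
    with f have "L2_inner M (\<lambda>z. g z - f z) (v j) = 0" by simp
    thus ?thesis using coeff[OF that, of a] unfolding a by simp
  qed
  thus "f = ?p" unfolding a by (intro ext sum.cong) auto
qed

lemma bessel_L2:
  assumes I: "finite I" and v: "orthonormal_on I M v" and g: "sq_integrable M g"
  shows "(\<Sum>i\<in>I. (cmod (L2_inner M g (v i)))\<^sup>2) \<le> (LINT x|M. (cmod (g x))\<^sup>2)"
proof -
  have vi: "sq_integrable M (v i)" if "i \<in> I" for i using v that by (auto simp: orthonormal_on_def)
  let ?p = "\<lambda>z. \<Sum>i\<in>I. L2_inner M g (v i) * v i z"
  let ?r = "\<lambda>z. g z - ?p z"
  have p: "sq_integrable M ?p" by (intro sq_integrable_lincomb vi)
  have r: "sq_integrable M ?r" by (intro sq_integrable_diff g p)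
  have rv: "L2_inner M ?r (v j) = 0" if "j \<in> I" for j
    using L2_inner_diff_left[OF g p vi[OF that]] L2_inner_orthonormal_coeff[OF I v that] by simp
  have "L2_inner M ?r ?p = 0"
    by (subst L2_inner_lincomb_right[OF vi r]) (auto simp: rv)
  hence "L2_inner M ?r ?r = L2_inner M ?r g"
    by (subst L2_inner_diff_right[OF g p r]) simp
  also have "\<dots> = L2_inner M g g - L2_inner M ?p g" by (rule L2_inner_diff_left[OF g p g])
  also have "L2_inner M ?p g = (\<Sum>i\<in>I. L2_inner M g (v i) * L2_inner M (v i) g)"
    by (rule L2_inner_lincomb_left[OF vi g])
  also have "\<dots> = of_real (\<Sum>i\<in>I. (cmod (L2_inner M g (v i)))\<^sup>2)"
    unfolding of_real_sum by (intro sum.cong refl) (simp only: complex_norm_square L2_inner_cnj)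
  finally have "(LINT x|M. (cmod (?r x))\<^sup>2) = (LINT x|M. (cmod (g x))\<^sup>2) - (\<Sum>i\<in>I. (cmod (L2_inner M g (v i)))\<^sup>2)"
    unfolding L2_inner_self of_real_diff[symmetric] of_real_eq_iff .
  moreover have "(LINT x|M. (cmod (?r x))\<^sup>2) \<ge> 0" by simp
  ultimately show ?thesis by simp
qed

section \<open>Radial measures in polar coordinates\<close>

text \<open>The uniform probability measure on a full turn.\<close>

definition angle_measure :: "real measure" where
  "angle_measure = density lborel (\<lambda>\<theta>. ennreal (indicator {0..2 * pi} \<theta> / (2 * pi)))"

text \<open>The factor \<open>r\<close> comes from the area element, so that the moments of this measure are those of \<open>w\<close>
  shifted by one.\<close>

definition radius_measure :: "(real \<Rightarrow> real) \<Rightarrow> ereal \<Rightarrow> real measure" where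
  "radius_measure w R = density lborel (\<lambda>r. ennreal (indicator {r. 0 < r \<and> ereal r < R} r * (r * w r)))"

lemma sets_angle_measure [measurable_cong, simp]: "sets angle_measure = sets borel"
  by (simp add: angle_measure_def)

lemma space_angle_measure [simp]: "space angle_measure = UNIV"
  by (simp add: angle_measure_def)

lemma sets_radius_measure [measurable_cong, simp]: "sets (radius_measure w R) = sets borel"
  by (simp add: radius_measure_def)

lemma space_radius_measure [simp]: "space (radius_measure w R) = UNIV"
  by (simp add: radius_measure_def)

lemma integral_angle_measure:
  fixes f :: "real \<Rightarrow> 'a::{banach, second_countable_topology}"
  assumes [measurable]: "f \<in> borel_measurable borel"
  shows "(LINT \<theta>|angle_measure. f \<theta>) = (LINT \<theta>|lebesgue_on {0..2 * pi}. f \<theta>) /\<^sub>R (2 * pi)"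
proof -
  have "(LINT \<theta>|angle_measure. f \<theta>) = (LINT \<theta>|lborel. (indicator {0..2 * pi} \<theta> / (2 * pi)) *\<^sub>R f \<theta>)"
    unfolding angle_measure_def by (rule integral_density) auto
  also have "\<dots> = (LINT \<theta>|lborel. (indicator {0..2 * pi} \<theta> *\<^sub>R f \<theta>) /\<^sub>R (2 * pi))"
    by (intro Bochner_Integration.integral_cong) (auto simp: field_simps)
  also have "\<dots> = (LINT \<theta>|lborel. indicator {0..2 * pi} \<theta> *\<^sub>R f \<theta>) /\<^sub>R (2 * pi)"
    by (rule integral_scaleR_right)
  also have "(LINT \<theta>|lborel. indicator {0..2 * pi} \<theta> *\<^sub>R f \<theta>) = (LINT \<theta>|lebesgue. indicator {0..2 * pi} \<theta> *\<^sub>R f \<theta>)"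
    by (rule integral_completion[symmetric]) auto
  also have "\<dots> = (LINT \<theta>|lebesgue_on {0..2 * pi}. f \<theta>)"
    by (rule integral_restrict_space[symmetric]) auto
  finally show ?thesis .
qed

lemma prob_space_angle_measure: "emeasure angle_measure UNIV = 1"
proof -
  have "emeasure angle_measure UNIV = (\<integral>\<^sup>+\<theta>. ennreal (1 / (2 * pi)) * indicator {0..2 * pi} \<theta> \<partial>lborel)"
    unfolding angle_measure_def by (subst emeasure_density) (auto simp: indicator_def intro!: nn_integral_cong)
  also have "\<dots> = 1" by (subst nn_integral_cmult_indicator) (auto simp: ennreal_mult[symmetric])
  finally show ?thesis .
qed

lemma finite_measure_angle_measure: "finite_measure angle_measure"
  by (rule finite_measureI) (simp add: prob_space_angle_measure)

text \<open>Orthogonality of the characters of the circle, the source of the orthogonality of monomials of different degree.\<close>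

lemma integral_cis_angle_measure:
  "(LINT \<theta>|angle_measure. cis (of_int k * \<theta>)) = (if k = 0 then 1 else 0)"
proof (cases "k = 0")
  case True
  interpret finite_measure angle_measure by (rule finite_measure_angle_measure)
  show ?thesis using True prob_space_angle_measure by (simp add: measure_def)
next
  case False
  let ?F = "\<lambda>\<theta>. cis (of_int k * \<theta>) / (\<i> * of_int k)"
  have cont: "continuous_on A (\<lambda>\<theta>. cis (of_int k * \<theta>))" for A by (intro continuous_intros)
  have "((\<lambda>\<theta>. cis (of_int k * \<theta>)) has_integral (?F (2 * pi) - ?F 0)) {0..2 * pi}"
  proof (rule fundamental_theorem_of_calculus)
    fix x :: real
    have "((\<lambda>z. exp (\<i> * (of_int k * z)) / (\<i> * of_int k)) has_field_derivative
       (exp (\<i> * (of_int k * of_real x)))) (at (of_real x))"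
      using False by (auto intro!: derivative_eq_intros simp: mult_ac)
    from has_vector_derivative_real_field[OF this]
    show "(?F has_vector_derivative cis (of_int k * x)) (at x within {0..2 * pi})"
      by (simp add: cis_conv_exp has_vector_derivative_at_within)
  qed simp
  moreover have "cis (of_int k * (2 * pi)) = 1"
    using cis_multiple_2pi[of "of_int k"] by (simp add: mult_ac)
  ultimately have hi: "((\<lambda>\<theta>. cis (of_int k * \<theta>)) has_integral 0) {0..2 * pi}" by simp
  have "integrable lborel (\<lambda>\<theta>. indicator {0..2 * pi} \<theta> *\<^sub>R cis (of_int k * \<theta>))"
    using cont by (intro borel_integrable_compact) auto
  hence "integrable (lebesgue_on {0..2 * pi}) (\<lambda>\<theta>. cis (of_int k * \<theta>))"
    by (subst integrable_restrict_space) (auto simp: integrable_completion)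
  hence "(LINT \<theta>|lebesgue_on {0..2 * pi}. cis (of_int k * \<theta>)) = integral {0..2 * pi} (\<lambda>\<theta>. cis (of_int k * \<theta>))"
    by (intro lebesgue_integral_eq_integral) auto
  also have "\<dots> = 0" using hi by (rule integral_unique)
  finally show ?thesis using False
    by (subst integral_angle_measure) (auto intro!: borel_measurable_continuous_onI cont)
qed

lemma measurable_disc [measurable]: "disc R \<in> sets borel"
proof -
  have "disc R = (\<lambda>z. ereal (cmod z)) -` {..<R} \<inter> space borel" by (auto simp: disc_def)
  also have "\<dots> \<in> sets borel" by (rule measurable_sets[of _ borel borel]) auto
  finally show ?thesis .
qed

lemma sets_radial_measure [simp]: "sets (radial_measure w R) = sets (lebesgue_on (disc R))"
  by (simp add: radial_measure_def)

lemma space_radial_measure [simp]: "space (radial_measure w R) = disc R"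
  by (simp add: radial_measure_def)

lemma measurable_radial_measure:
  "borel_measurable (radial_measure w R) = borel_measurable (lebesgue_on (disc R))"
  by (rule measurable_cong_sets) simp_all

lemma borel_imp_measurable_radial:
  fixes f :: "complex \<Rightarrow> 'a::topological_space"
  shows "f \<in> borel_measurable borel \<Longrightarrow> f \<in> borel_measurable (radial_measure w R)"
  unfolding measurable_radial_measure by (auto intro!: measurable_restrict_space1 measurable_completion)

lemma nn_integral_radial_measure:
  assumes w[measurable]: "w \<in> borel_measurable borel" and w0: "\<And>r. 0 \<le> w r"
    and h[measurable]: "h \<in> borel_measurable borel"
  shows "(\<integral>\<^sup>+z. h z \<partial>radial_measure w R) =
    (\<integral>\<^sup>+\<theta>. (\<integral>\<^sup>+r. h (rcis r \<theta>) \<partial>radius_measure w R) \<partial>angle_measure)"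
proof -
  have [measurable]: "(\<lambda>\<theta>. \<integral>\<^sup>+r. h (rcis r \<theta>) \<partial>radius_measure w R) \<in> borel_measurable borel"
    unfolding radius_measure_def by (subst nn_integral_density) measurable
  have [measurable]: "{r. 0 < r \<and> ereal r < R} \<in> sets borel" by measurable
  have "(\<integral>\<^sup>+z. h z \<partial>radial_measure w R) = (\<integral>\<^sup>+z. ennreal (w (cmod z) / (2 * pi)) * h z \<partial>lebesgue_on (disc R))"
    unfolding radial_measure_def
    by (rule nn_integral_density) (auto intro!: measurable_restrict_space1 measurable_completion)
  also have "\<dots> = (\<integral>\<^sup>+z. ennreal (w (cmod z) / (2 * pi)) * h z * indicator (disc R) z \<partial>lebesgue)"
    by (rule nn_integral_restrict_space) auto
  also have "\<dots> = (\<integral>\<^sup>+z. ennreal (w (cmod z) / (2 * pi)) * h z * indicator (disc R) z \<partial>lborel)"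
    by (rule nn_integral_completion)
  also have "\<dots> = (\<integral>\<^sup>+\<theta>. (\<integral>\<^sup>+r. ennreal r * (ennreal (w (cmod (rcis r \<theta>)) / (2 * pi)) * h (rcis r \<theta>)
       * indicator (disc R) (rcis r \<theta>)) * indicator {0<..} r \<partial>lborel) * indicator {0..<2 * pi} \<theta> \<partial>lborel)"
    by (rule nn_integral_polar) measurable
  also have "\<dots> = (\<integral>\<^sup>+\<theta>. ennreal (indicator {0..2 * pi} \<theta> / (2 * pi)) * (\<integral>\<^sup>+r. h (rcis r \<theta>) \<partial>radius_measure w R) \<partial>lborel)"
  proof (rule nn_integral_cong_AE)
    have "AE \<theta> in lborel. \<theta> \<noteq> 2 * pi" by (rule AE_lborel_singleton)
    thus "AE \<theta> in lborel. (\<integral>\<^sup>+r. ennreal r * (ennreal (w (cmod (rcis r \<theta>)) / (2 * pi)) * h (rcis r \<theta>)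
       * indicator (disc R) (rcis r \<theta>)) * indicator {0<..} r \<partial>lborel) * indicator {0..<2 * pi} \<theta> =
       ennreal (indicator {0..2 * pi} \<theta> / (2 * pi)) * (\<integral>\<^sup>+r. h (rcis r \<theta>) \<partial>radius_measure w R)"
    proof eventually_elim
      case (elim \<theta>)
      have "(\<integral>\<^sup>+r. ennreal r * (ennreal (w (cmod (rcis r \<theta>)) / (2 * pi)) * h (rcis r \<theta>)
       * indicator (disc R) (rcis r \<theta>)) * indicator {0<..} r \<partial>lborel) =
       (\<integral>\<^sup>+r. ennreal (1 / (2 * pi)) * (ennreal (indicator {r. 0 < r \<and> ereal r < R} r * (r * w r)) * h (rcis r \<theta>)) \<partial>lborel)"
      proof (rule nn_integral_cong)
        fix r :: real
        have "ennreal r * ennreal (w r / (2 * pi)) = ennreal (1 / (2 * pi)) * ennreal (r * w r)" if "r > 0"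
          using that w0[of r] by (simp add: ennreal_mult[symmetric])
        thus "ennreal r * (ennreal (w (cmod (rcis r \<theta>)) / (2 * pi)) * h (rcis r \<theta>)
          * indicator (disc R) (rcis r \<theta>)) * indicator {0<..} r =
          ennreal (1 / (2 * pi)) * (ennreal (indicator {r. 0 < r \<and> ereal r < R} r * (r * w r)) * h (rcis r \<theta>))"
          by (auto simp: indicator_def disc_def mult.assoc[symmetric])
      qed
      also have "\<dots> = ennreal (1 / (2 * pi)) * (\<integral>\<^sup>+r. ennreal (indicator {r. 0 < r \<and> ereal r < R} r * (r * w r)) * h (rcis r \<theta>) \<partial>lborel)"
        by (rule nn_integral_cmult) measurable
      also have "(\<integral>\<^sup>+r. ennreal (indicator {r. 0 < r \<and> ereal r < R} r * (r * w r)) * h (rcis r \<theta>) \<partial>lborel)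
         = (\<integral>\<^sup>+r. h (rcis r \<theta>) \<partial>radius_measure w R)"
        unfolding radius_measure_def by (rule nn_integral_density[symmetric]) measurable
      finally show ?case using elim by (auto simp: indicator_def)
    qed
  qed
  also have "\<dots> = (\<integral>\<^sup>+\<theta>. (\<integral>\<^sup>+r. h (rcis r \<theta>) \<partial>radius_measure w R) \<partial>angle_measure)"
    unfolding angle_measure_def by (rule nn_integral_density[symmetric]) measurable
  finally show ?thesis .
qed

locale radial_weight =
  fixes c :: "nat \<Rightarrow> real" and R :: ereal and w :: "real \<Rightarrow> real"
  assumes c_pos: "\<And>n. c n > 0"
    and ratio_lim: "(\<lambda>n. ereal (c (Suc n) / c n)) \<longlonglongrightarrow> R"
    and R_pos: "0 < R"
    and w_meas [measurable]: "w \<in> borel_measurable borel"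
    and w_nonneg: "\<And>r. 0 \<le> w r"
    and moments_int: "\<And>n. set_integrable lborel (radii R) (\<lambda>r. r ^ n * w r)"
    and moments: "\<And>n. c n = (LINT r:radii R|lborel. r ^ n * w r)"
    and infinite_radius: "R = \<infinity> \<Longrightarrow>
      (\<forall>m::nat. (\<lambda>l. c (2 * l + m + 1) / (sqrt (c (2 * l + 2 * m + 1)) * sqrt (c (2 * l + 1))))
         \<longlonglongrightarrow> 1)"
begin

abbreviation "M \<equiv> radial_measure w R"
abbreviation "\<rho> \<equiv> radius_measure w R"

lemma has_moment_radius: "has_bochner_integral \<rho> (\<lambda>r. r ^ k) (c (k + 1))"
proof -
  have ae: "AE r in lborel. indicator (radii R) r *\<^sub>R (r ^ (k + 1) * w r) = (indicator {r. 0 < r \<and> ereal r < R} r * (r * w r)) *\<^sub>R r ^ k"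
  proof -
    have "AE r in lborel. r \<noteq> real_of_ereal R" by (rule AE_lborel_singleton)
    thus ?thesis
    proof eventually_elim
      case (elim r)
      have "r = 0" if "0 \<le> r" "\<not> 0 < r" using that by simp
      moreover have "ereal r < R" if "ereal r \<le> R" using that elim by (cases R) auto
      ultimately show ?case by (auto simp: indicator_def radii_def)
    qed
  qed
  have m: "{r. 0 < r \<and> ereal r < R} \<in> sets borel" by measurable
  have [measurable]: "radii R \<in> sets borel" unfolding radii_def by measurable
  have "has_bochner_integral lborel (\<lambda>r. indicator (radii R) r *\<^sub>R (r ^ (k + 1) * w r)) (c (k + 1))"
    using moments_int[of "k + 1"] moments[of "k + 1"]
    by (simp add: has_bochner_integral_iff set_integrable_def set_lebesgue_integral_def)
  hence "has_bochner_integral lborel (\<lambda>r. (indicator {r. 0 < r \<and> ereal r < R} r * (r * w r)) *\<^sub>R r ^ k) (c (k + 1))"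
    by (subst (asm) has_bochner_integral_cong_AE[OF _ _ ae]) (use m in \<open>auto dest: has_bochner_integral_integrable\<close>)
  thus ?thesis unfolding radius_measure_def
    by (subst has_bochner_integral_density) (use m w_nonneg in \<open>auto simp: indicator_def\<close>)
qed

lemma integrable_radius: "integrable \<rho> (\<lambda>r. r ^ k)" and moment_radius: "(LINT r|\<rho>. r ^ k) = c (k + 1)"
  using has_moment_radius[of k] by (simp_all add: has_bochner_integral_iff)

lemma AE_radius: "AE r in \<rho>. 0 < r \<and> ereal r < R"
proof -
  have m: "{r. 0 < r \<and> ereal r < R} \<in> sets borel" by measurable
  show ?thesis unfolding radius_measure_def
    by (subst AE_density) (use m in \<open>auto simp: indicator_def\<close>)
qed

sublocale radius: finite_measure \<rho>
proof (rule finite_measureI)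
  have "integrable \<rho> (\<lambda>r. 1 :: real)" using integrable_radius[of 0] by simp
  thus "emeasure \<rho> (space \<rho>) \<noteq> \<infinity>"
    by (auto simp: integrable_iff_bounded)
qed

sublocale angle: finite_measure angle_measure by (rule finite_measure_angle_measure)

sublocale polar: pair_sigma_finite angle_measure \<rho> ..

lemma nn_integral_radial_measure_pair:
  assumes [measurable]: "h \<in> borel_measurable borel"
  shows "(\<integral>\<^sup>+z. h z \<partial>M) = (\<integral>\<^sup>+x. h (rcis (snd x) (fst x)) \<partial>(angle_measure \<Otimes>\<^sub>M \<rho>))"
  unfolding nn_integral_radial_measure[OF w_meas w_nonneg assms]
  by (subst radius.nn_integral_fst[symmetric]) auto

text \<open>The image under the identity restricts the measure to Borel sets, where polar
  coordinates exhibit it as the image of a product measure. Integrals of Borel functions then reduce to Fubini's theorem.\<close>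

lemma distr_radial_measure:
  "distr M borel (\<lambda>z. z) = distr (angle_measure \<Otimes>\<^sub>M \<rho>) borel (\<lambda>x. rcis (snd x) (fst x))"
proof (rule measure_eqI)
  fix A assume "A \<in> sets (distr M borel (\<lambda>z. z))"
  hence A[measurable]: "A \<in> sets borel" by simp
  have id: "(\<lambda>z. z) \<in> borel_measurable M" by (rule borel_imp_measurable_radial) simp
  have "emeasure (distr M borel (\<lambda>z. z)) A = (\<integral>\<^sup>+z. indicator A z \<partial>distr M borel (\<lambda>z. z))" by simp
  also have "\<dots> = (\<integral>\<^sup>+z. indicator A z \<partial>M)" by (rule nn_integral_distr[OF id]) simp
  also have "\<dots> = (\<integral>\<^sup>+x. indicator A (rcis (snd x) (fst x)) \<partial>(angle_measure \<Otimes>\<^sub>M \<rho>))"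
    by (rule nn_integral_radial_measure_pair) simp
  also have "\<dots> = (\<integral>\<^sup>+z. indicator A z \<partial>distr (angle_measure \<Otimes>\<^sub>M \<rho>) borel (\<lambda>x. rcis (snd x) (fst x)))"
    by (rule nn_integral_distr[symmetric]) auto
  also have "\<dots> = emeasure (distr (angle_measure \<Otimes>\<^sub>M \<rho>) borel (\<lambda>x. rcis (snd x) (fst x))) A" by simp
  finally show "emeasure (distr M borel (\<lambda>z. z)) A = emeasure (distr (angle_measure \<Otimes>\<^sub>M \<rho>) borel (\<lambda>x. rcis (snd x) (fst x))) A" .
qed simp

lemma integral_radial_measure:
  fixes F :: "complex \<Rightarrow> complex"
  assumes [measurable]: "F \<in> borel_measurable borel"
  shows "integral\<^sup>L M F = (LINT x|(angle_measure \<Otimes>\<^sub>M \<rho>). F (rcis (snd x) (fst x)))"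
    and "integrable M F \<longleftrightarrow> integrable (angle_measure \<Otimes>\<^sub>M \<rho>) (\<lambda>x. F (rcis (snd x) (fst x)))"
proof -
  have id: "(\<lambda>z. z) \<in> borel_measurable M" by (rule borel_imp_measurable_radial) simp
  have "integral\<^sup>L M F = integral\<^sup>L (distr M borel (\<lambda>z. z)) F"
    by (rule integral_distr[OF id, symmetric]) simp
  also have "\<dots> = (LINT x|(angle_measure \<Otimes>\<^sub>M \<rho>). F (rcis (snd x) (fst x)))"
    unfolding distr_radial_measure by (rule integral_distr) auto
  finally show "integral\<^sup>L M F = (LINT x|(angle_measure \<Otimes>\<^sub>M \<rho>). F (rcis (snd x) (fst x)))" .
  have "integrable M F \<longleftrightarrow> integrable (distr M borel (\<lambda>z. z)) F"
    by (rule integrable_distr_eq[OF id, symmetric]) simp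
  also have "\<dots> \<longleftrightarrow> integrable (angle_measure \<Otimes>\<^sub>M \<rho>) (\<lambda>x. F (rcis (snd x) (fst x)))"
    unfolding distr_radial_measure by (rule integrable_distr_eq) auto
  finally show "integrable M F \<longleftrightarrow> integrable (angle_measure \<Otimes>\<^sub>M \<rho>) (\<lambda>x. F (rcis (snd x) (fst x)))" .
qed

lemma integrable_monomials:
  fixes s :: "complex \<Rightarrow> complex"
  assumes s[measurable]: "s \<in> borel_measurable borel" and B: "\<And>z. cmod (s z) \<le> B"
  shows "integrable M (\<lambda>z. s z * (z ^ n * cnj (z ^ m)))"
proof (rule integrableI_bounded)
  have mm: "(\<lambda>z. s z * (z ^ n * cnj (z ^ m))) \<in> borel_measurable borel" by measurable
  show "(\<lambda>z. s z * (z ^ n * cnj (z ^ m))) \<in> borel_measurable M"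
    by (rule borel_imp_measurable_radial[OF mm])
  have "(\<integral>\<^sup>+z. ennreal (cmod (s z * (z ^ n * cnj (z ^ m)))) \<partial>M)
    = (\<integral>\<^sup>+\<theta>. \<integral>\<^sup>+r. ennreal (cmod (s (rcis r \<theta>) * ((rcis r \<theta>) ^ n * cnj ((rcis r \<theta>) ^ m)))) \<partial>\<rho> \<partial>angle_measure)"
    by (rule nn_integral_radial_measure[OF w_meas w_nonneg]) measurable
  also have "\<dots> \<le> (\<integral>\<^sup>+\<theta>. ennreal (B * c (n + m + 1)) \<partial>angle_measure)"
  proof (rule nn_integral_mono)
    fix \<theta>
    have "(\<integral>\<^sup>+r. ennreal (cmod (s (rcis r \<theta>) * ((rcis r \<theta>) ^ n * cnj ((rcis r \<theta>) ^ m)))) \<partial>\<rho>)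
      \<le> (\<integral>\<^sup>+r. ennreal (B * r ^ (n + m)) \<partial>\<rho>)"
    proof (rule nn_integral_mono_AE)
      show "AE r in \<rho>. ennreal (cmod (s (rcis r \<theta>) * ((rcis r \<theta>) ^ n * cnj ((rcis r \<theta>) ^ m)))) \<le> ennreal (B * r ^ (n + m))"
        using AE_radius
      proof eventually_elim
        case (elim r)
        thus ?case using B[of "rcis r \<theta>"]
          by (intro ennreal_leI) (auto simp: norm_mult norm_power power_add intro!: mult_right_mono)
      qed
    qed
    also have "\<dots> = ennreal (LINT r|\<rho>. B * r ^ (n + m))"
    proof (rule nn_integral_eq_integral)
      have "B \<ge> 0" using B[of 0] norm_ge_zero order_trans by blast
      thus "AE r in \<rho>. 0 \<le> B * r ^ (n + m)" using AE_radius by (auto elim: eventually_mono)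
    qed (use integrable_radius in auto)
    also have "(LINT r|\<rho>. B * r ^ (n + m)) = B * c (n + m + 1)" using moment_radius[of "n + m"] by simp
    finally show "(\<integral>\<^sup>+r. ennreal (cmod (s (rcis r \<theta>) * ((rcis r \<theta>) ^ n * cnj ((rcis r \<theta>) ^ m)))) \<partial>\<rho>)
      \<le> ennreal (B * c (n + m + 1))" .
  qed
  also have "\<dots> < \<infinity>" using prob_space_angle_measure by simp
  finally show "(\<integral>\<^sup>+z. ennreal (cmod (s z * (z ^ n * cnj (z ^ m)))) \<partial>M) < \<infinity>" .
qed

lemma integral_monomials:
  fixes s :: "complex \<Rightarrow> complex"
  assumes s[measurable]: "s \<in> borel_measurable borel" and B: "\<And>z. cmod (s z) \<le> B"
  shows "(LINT z|M. s z * (z ^ n * cnj (z ^ m))) =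
     (LINT \<theta>|angle_measure. (LINT r|\<rho>. s (rcis r \<theta>) * of_real (r ^ (n + m))) * cis ((real n - real m) * \<theta>))"
proof -
  have mm: "(\<lambda>z. s z * (z ^ n * cnj (z ^ m))) \<in> borel_measurable borel" by measurable
  have mon: "rcis r \<theta> ^ n * cnj (rcis r \<theta> ^ m) = of_real (r ^ (n + m)) * cis ((real n - real m) * \<theta>)" for r \<theta>
  proof -
    have "cnj (rcis r \<theta> ^ m) = rcis (r ^ m) (- (real m * \<theta>))"
      unfolding DeMoivre2 by (simp add: rcis_def cis_cnj)
    thus ?thesis unfolding DeMoivre2 by (simp add: rcis_mult) (simp add: rcis_def power_add algebra_simps)
  qed
  have "(LINT z|M. s z * (z ^ n * cnj (z ^ m))) =
    (LINT x|(angle_measure \<Otimes>\<^sub>M \<rho>). (s (rcis (snd x) (fst x)) * (rcis (snd x) (fst x) ^ n * cnj (rcis (snd x) (fst x) ^ m))))"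
    by (rule integral_radial_measure(1)[OF mm])
  also have "\<dots> = (LINT \<theta>|angle_measure. LINT r|\<rho>. s (rcis r \<theta>) * (rcis r \<theta> ^ n * cnj (rcis r \<theta> ^ m)))"
    using polar.integral_fst'[of "\<lambda>x. s (rcis (snd x) (fst x)) * (rcis (snd x) (fst x) ^ n * cnj (rcis (snd x) (fst x) ^ m))"]
      integrable_monomials[OF s B, of n m] unfolding integral_radial_measure(2)[OF mm] by simp
  also have "\<dots> = (LINT \<theta>|angle_measure. (LINT r|\<rho>. s (rcis r \<theta>) * of_real (r ^ (n + m))) * cis ((real n - real m) * \<theta>))"
    unfolding mon mult.assoc[symmetric] by simp
  finally show ?thesis .
qed

text \<open>Symbols are only Lebesgue measurable, while the product decomposition sees Borel
  functions. A Borel modification agrees with the symbol outside a null set of the plane, which meets almost every ray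
  in a null set of radii. Integrals along almost every ray are therefore unchanged, while the radial limits can still be taken from
  the original symbol.\<close>

lemma symbol_borel_version:
  fixes s :: "complex \<Rightarrow> complex"
  assumes s: "s \<in> borel_measurable (lebesgue_on (disc R))" and B: "\<And>z. z \<in> disc R \<Longrightarrow> cmod (s z) \<le> B"
    and B0: "B \<ge> 0"
  shows "\<exists>sb. sb \<in> borel_measurable borel \<and> (\<forall>z. cmod (sb z) \<le> B) \<and> (AE z in M. s z = sb z) \<and>
     (AE \<theta> in angle_measure. AE r in \<rho>. s (rcis r \<theta>) = sb (rcis r \<theta>))"
proof -
  define t where "t z = (if z \<in> disc R then s z else 0)" for z
  have t: "t \<in> borel_measurable lebesgue"
    using s unfolding t_def by (subst (asm) borel_measurable_if[symmetric]) auto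
  have "(\<lambda>z. Re (t z)) \<in> borel_measurable lebesgue" "(\<lambda>z. Im (t z)) \<in> borel_measurable lebesgue"
    using t by measurable
  from this[THEN completion_ex_borel_measurable_real]
  obtain u v where [measurable]: "u \<in> borel_measurable borel" "v \<in> borel_measurable borel"
     and uv: "AE z in lborel. Re (t z) = u z" "AE z in lborel. Im (t z) = v z" by auto
  define f where "f z = Complex (u z) (v z)" for z
  have f[measurable]: "f \<in> borel_measurable borel" unfolding f_def Complex_eq by measurable
  \<comment> \<open>The truncation makes the bound hold everywhere and not only almost everywhere.\<close>
  define sb where "sb z = (if cmod (f z) \<le> B then f z else 0)" for z
  have sb[measurable]: "sb \<in> borel_measurable borel" unfolding sb_def by measurable
  have "AE z in lborel. t z = sb z"
    using uv
  proof eventually_elim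
    case (elim z)
    hence "t z = f z" by (simp add: f_def complex_eq_iff)
    moreover have "cmod (t z) \<le> B" using B B0 by (auto simp: t_def)
    ultimately show ?case by (simp add: sb_def)
  qed
  then obtain N where N: "{z. t z \<noteq> sb z} \<subseteq> N" "N \<in> null_sets lborel" by (auto simp: eventually_ae_filter)
  hence Nb[measurable]: "N \<in> sets borel" by auto
  have "AE z in lebesgue. z \<notin> N" using N by (intro AE_completion AE_not_in) auto
  hence ae_on: "AE z in lebesgue_on (disc R). z \<notin> N" by (subst AE_restrict_space_iff) auto
  have ae1: "AE z in M. z \<notin> N"
    unfolding radial_measure_def using ae_on
    by (subst AE_density) (auto elim: eventually_mono intro!: measurable_restrict_space1 measurable_completion)
  have "AE z in M. s z = sb z"
    using ae1 AE_space
  proof eventually_elim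
    case (elim z)
    hence "t z = sb z" using N(1) by blast
    thus ?case using elim by (simp add: t_def)
  qed
  moreover have "AE \<theta> in angle_measure. AE r in \<rho>. s (rcis r \<theta>) = sb (rcis r \<theta>)"
  proof -
    have id: "(\<lambda>z. z) \<in> borel_measurable M" by (rule borel_imp_measurable_radial) simp
    have "AE z in distr M borel (\<lambda>z. z). z \<notin> N"
      by (subst AE_distr_iff[OF id]) (use ae1 in auto)
    hence "AE x in angle_measure \<Otimes>\<^sub>M \<rho>. rcis (snd x) (fst x) \<notin> N"
      unfolding distr_radial_measure by (subst (asm) AE_distr_iff) auto
    from polar.AE_pair[OF this] have "AE \<theta> in angle_measure. AE r in \<rho>. rcis r \<theta> \<notin> N" by simp
    thus ?thesis
    proof eventually_elim
      case (elim \<theta>)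
      from elim AE_radius show ?case
      proof eventually_elim
        case (elim r)
        from elim have "rcis r \<theta> \<in> disc R" by (simp add: disc_def)
        moreover have "t (rcis r \<theta>) = sb (rcis r \<theta>)" using elim N(1) by blast
        ultimately show ?case by (simp add: t_def)
      qed
    qed
  qed
  moreover have "cmod (sb z) \<le> B" for z using B0 by (simp add: sb_def)
  ultimately show ?thesis using sb by blast
qed

end

section \<open>Limits of matrix entries along diagonals\<close>

context radial_weight begin

text \<open>The ratio test: consecutive quotients tend to \<open>r / R < 1\<close>, with \<open>r / \<infinity> = 0\<close>.\<close>

lemma power_over_moment_tendsto_zero:
  assumes r: "0 < r" "ereal r < R"
  shows "(\<lambda>k. r ^ k / c (k + 1)) \<longlonglongrightarrow> 0"
proof -
  obtain t where t: "ereal r < ereal t" "ereal t < R"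
    using ereal_dense2[OF r(2)] r by blast
  hence rt: "r < t" by simp
  have "eventually (\<lambda>n. ereal t < ereal (c (Suc n) / c n)) sequentially"
    using order_tendstoD(1)[OF ratio_lim t(2)] .
  then obtain n0 where n0: "\<And>n. n \<ge> n0 \<Longrightarrow> t < c (Suc n) / c n"
    unfolding eventually_sequentially by auto
  have "summable (\<lambda>k. r ^ k / c (k + 1))"
  proof (rule summable_ratio_test[of "r / t" n0])
    show "r / t < 1" using rt r by simp
    fix n assume n: "n \<ge> n0"
    have "t * c (n + 1) < c (n + 2)" using n0[of "n + 1"] n c_pos[of "n + 1"] by (simp add: field_simps)
    hence "1 / c (n + 2) \<le> 1 / (t * c (n + 1))"
      using rt r c_pos[of "n+1"] c_pos[of "n+2"] by (intro divide_left_mono) auto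
    hence "r ^ Suc n * (1 / c (n + 2)) \<le> r ^ Suc n * (1 / (t * c (n + 1)))"
      using r by (intro mult_left_mono) auto
    thus "norm (r ^ Suc n / c (Suc n + 1)) \<le> r / t * norm (r ^ n / c (n + 1))"
      using r c_pos[of "n+1"] c_pos[of "n+2"] by simp
  qed
  thus ?thesis by (rule summable_LIMSEQ_zero)
qed

lemma bounded_radius_moment:
  fixes f :: "real \<Rightarrow> complex"
  assumes f[measurable]: "f \<in> borel_measurable borel" and B: "\<And>r. cmod (f r) \<le> B"
  shows "integrable \<rho> (\<lambda>r. f r * of_real (r ^ k))"
    and "cmod (LINT r|\<rho>. f r * of_real (r ^ k)) \<le> B * c (k + 1)"
proof -
  have B0: "B \<ge> 0" using B[of 0] norm_ge_zero order_trans by blast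
  have int: "integrable \<rho> (\<lambda>r. B * r ^ k)" using integrable_radius by auto
  have bound: "AE r in \<rho>. cmod (f r * of_real (r ^ k)) \<le> B * r ^ k"
    using AE_radius
  proof eventually_elim
    case (elim r)
    thus ?case using B by (auto simp: norm_mult norm_power intro!: mult_right_mono)
  qed
  show i: "integrable \<rho> (\<lambda>r. f r * of_real (r ^ k))"
  proof (rule Bochner_Integration.integrable_bound[OF int])
    show "AE r in \<rho>. cmod (f r * of_real (r ^ k)) \<le> norm (B * r ^ k)"
      using bound by eventually_elim simp
  qed measurable
  have "cmod (LINT r|\<rho>. f r * of_real (r ^ k)) \<le> (LINT r|\<rho>. B * r ^ k)"
    by (rule order_trans[OF integral_norm_bound], rule integral_mono_AE) (use i int bound in auto)
  thus "cmod (LINT r|\<rho>. f r * of_real (r ^ k)) \<le> B * c (k + 1)"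
    using moment_radius[of k] by simp
qed

text \<open>The probability measures with density \<open>r ^ k / c (k + 1)\<close> with respect to \<open>\<rho>\<close> concentrate at \<open>R\<close>: the part
  below \<open>r0 < R\<close> has mass at most a constant times \<open>r0 ^ k / c (k + 1)\<close>, which tends to \<open>0\<close>.\<close>

lemma radial_concentration:
  fixes f :: "real \<Rightarrow> complex"
  assumes f[measurable]: "f \<in> borel_measurable borel" and B: "\<And>r. cmod (f r) \<le> B"
    and lim: "\<And>e. e > 0 \<Longrightarrow> \<exists>r0. 0 < r0 \<and> ereal r0 < R \<and> (AE r in \<rho>. r > r0 \<longrightarrow> cmod (f r - L) \<le> e)"
  shows "(\<lambda>k. (LINT r|\<rho>. f r * of_real (r ^ k)) / of_real (c (k + 1))) \<longlonglongrightarrow> L"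
proof (rule LIMSEQ_I)
  fix e :: real assume e: "e > 0"
  obtain r0 where r0: "0 < r0" "ereal r0 < R" and near: "AE r in \<rho>. r > r0 \<longrightarrow> cmod (f r - L) \<le> e / 2"
    using lim[of "e / 2"] e by auto
  define C where "C = (B + cmod L) * c 1"
  have B0: "B \<ge> 0" using B[of 0] norm_ge_zero order_trans by blast
  have C0: "C \<ge> 0" using B0 c_pos[of 1] by (simp add: C_def)
  note int_f = bounded_radius_moment(1)[OF f B]
  have bound: "cmod ((LINT r|\<rho>. f r * of_real (r ^ k)) / of_real (c (k + 1)) - L) \<le> e / 2 + C * (r0 ^ k / c (k + 1))" for k
  proof -
    have int_L: "integrable \<rho> (\<lambda>r. L * of_real (r ^ k))"
      using integrable_radius[of k] by (simp del: of_real_power)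
    have "(LINT r|\<rho>. (f r - L) * of_real (r ^ k)) = (LINT r|\<rho>. f r * of_real (r ^ k)) - (LINT r|\<rho>. L * of_real (r ^ k))"
      unfolding left_diff_distrib by (rule Bochner_Integration.integral_diff[OF int_f int_L])
    also have "(LINT r|\<rho>. L * of_real (r ^ k)) = L * of_real (c (k + 1))"
      using moment_radius[of k] by (simp del: of_real_power)
    finally have "(LINT r|\<rho>. f r * of_real (r ^ k)) / of_real (c (k + 1)) - L
        = (LINT r|\<rho>. (f r - L) * of_real (r ^ k)) / of_real (c (k + 1))"
      using c_pos[of "k + 1"] by (simp add: field_simps)
    hence "cmod ((LINT r|\<rho>. f r * of_real (r ^ k)) / of_real (c (k + 1)) - L) =
        cmod (LINT r|\<rho>. (f r - L) * of_real (r ^ k)) / c (k + 1)"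
      using c_pos[of "k + 1"] by (simp add: norm_divide)
    also have "cmod (LINT r|\<rho>. (f r - L) * of_real (r ^ k)) \<le> (LINT r|\<rho>. e / 2 * r ^ k + (B + cmod L) * r0 ^ k)"
    proof (rule order_trans[OF integral_norm_bound], rule integral_mono_AE)
      show "integrable \<rho> (\<lambda>r. cmod ((f r - L) * of_real (r ^ k)))"
        unfolding left_diff_distrib by (intro integrable_norm Bochner_Integration.integrable_diff int_f int_L)
      show "integrable \<rho> (\<lambda>r. e / 2 * r ^ k + (B + cmod L) * r0 ^ k)"
        using integrable_radius by auto
      show "AE r in \<rho>. cmod ((f r - L) * of_real (r ^ k)) \<le> e / 2 * r ^ k + (B + cmod L) * r0 ^ k"
        using near AE_radius
      proof eventually_elim
        case (elim r)
        show ?case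
        proof (cases "r > r0")
          case True
          have "cmod (f r - L) * r ^ k \<le> e / 2 * r ^ k" using elim True by (intro mult_right_mono) auto
          moreover have "0 \<le> (B + cmod L) * r0 ^ k" using B0 r0 by simp
          moreover have "cmod ((f r - L) * of_real (r ^ k)) = cmod (f r - L) * r ^ k"
            using elim by (simp add: norm_mult norm_power)
          ultimately show ?thesis by linarith
        next
          case False
          have "cmod (f r - L) \<le> B + cmod L" using norm_triangle_ineq4[of "f r" L] B[of r] by linarith
          moreover have "r ^ k \<le> r0 ^ k" using False elim by (intro power_mono) auto
          ultimately have "cmod (f r - L) * r ^ k \<le> (B + cmod L) * r0 ^ k"
            using elim B0 by (intro mult_mono) auto
          moreover have "0 \<le> e / 2 * r ^ k" using e elim by simp
          moreover have "cmod ((f r - L) * of_real (r ^ k)) = cmod (f r - L) * r ^ k"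
            using elim by (simp add: norm_mult norm_power)
          ultimately show ?thesis by linarith
        qed
      qed
    qed
    also have "(LINT r|\<rho>. e / 2 * r ^ k + (B + cmod L) * r0 ^ k) = e / 2 * c (k + 1) + C * r0 ^ k"
      using integrable_radius moment_radius[of k] moment_radius[of 0]
      by (simp add: C_def)
    finally show ?thesis using c_pos[of "k + 1"] by (simp add: field_simps)
  qed
  have "(\<lambda>k. C * (r0 ^ k / c (k + 1))) \<longlonglongrightarrow> C * 0"
    by (intro tendsto_intros power_over_moment_tendsto_zero r0)
  hence "eventually (\<lambda>k. C * (r0 ^ k / c (k + 1)) < e / 2) sequentially"
    using e by (intro order_tendstoD(2)) auto
  then obtain k0 where k0: "\<And>k. k \<ge> k0 \<Longrightarrow> C * (r0 ^ k / c (k + 1)) < e / 2"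
    unfolding eventually_sequentially by blast
  have "cmod ((LINT r|\<rho>. f r * of_real (r ^ k)) / of_real (c (k + 1)) - L) < e" if "k \<ge> k0" for k
    using bound[of k] k0[OF that] by linarith
  thus "\<exists>k0. \<forall>k\<ge>k0. norm ((LINT r|\<rho>. f r * of_real (r ^ k)) / of_real (c (k + 1)) - L) < e" by blast
qed

lemma moment_ratio_tendsto:
  assumes R: "R = ereal q"
  shows "(\<lambda>k. c (k + m) / c k) \<longlonglongrightarrow> q ^ m"
proof (induction m)
  case 0
  have "c k / c k = 1" for k using c_pos[of k] by simp
  thus ?case by simp
next
  case (Suc m)
  have "(\<lambda>n. c (Suc n) / c n) \<longlonglongrightarrow> q" using ratio_lim unfolding R by simp
  hence "(\<lambda>k. c (Suc (k + m)) / c (k + m)) \<longlonglongrightarrow> q"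
    by (rule LIMSEQ_ignore_initial_segment)
  from tendsto_mult[OF this Suc] show ?case using c_pos by (simp add: less_imp_neq[OF c_pos, symmetric])
qed

text \<open>For finite \<open>R\<close> the square of the quotient is a quotient of two ratios of moments with the same
  limit \<open>R ^ m\<close>; for infinite \<open>R\<close> it is the additional hypothesis.\<close>

lemma moment_log_convexity_limit:
  "(\<lambda>l. c (2 * l + m + 1) / (sqrt (c (2 * l + 2 * m + 1)) * sqrt (c (2 * l + 1)))) \<longlonglongrightarrow> 1"
proof (cases "R = \<infinity>")
  case True
  thus ?thesis using infinite_radius by blast
next
  case False
  then obtain q where R: "R = ereal q" using R_pos by (cases R) auto
  have q: "q > 0" using R_pos R by simp
  have "(\<lambda>k. sqrt (c (k + m) / c k / (c (k + m + m) / c (k + m)))) \<longlonglongrightarrow> sqrt (q ^ m / q ^ m)"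
    using q by (intro tendsto_intros moment_ratio_tendsto R LIMSEQ_ignore_initial_segment[OF moment_ratio_tendsto[OF R]]) auto
  hence "(\<lambda>k. sqrt (c (k + m) / c k / (c (k + m + m) / c (k + m)))) \<longlonglongrightarrow> 1" using q by simp
  moreover have "sqrt (c (k + m) / c k / (c (k + m + m) / c (k + m))) = c (k + m) / (sqrt (c (k + 2 * m)) * sqrt (c k))" for k
  proof -
    have "c (k + m) / c k / (c (k + m + m) / c (k + m)) = (c (k + m))\<^sup>2 / (c (k + 2 * m) * c k)"
      by (simp add: power2_eq_square mult_2 add.assoc)
    thus ?thesis using c_pos[of "k + m"] by (simp add: real_sqrt_divide real_sqrt_mult)
  qed
  ultimately have "(\<lambda>k. c (k + m) / (sqrt (c (k + 2 * m)) * sqrt (c k))) \<longlonglongrightarrow> 1" by simp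
  moreover have "filterlim (\<lambda>l. 2 * l + 1 :: nat) sequentially sequentially"
    by (rule filterlim_subseq) (auto simp: strict_mono_def)
  ultimately have "(\<lambda>l. c ((2 * l + 1) + m) / (sqrt (c ((2 * l + 1) + 2 * m)) * sqrt (c (2 * l + 1)))) \<longlonglongrightarrow> 1"
    by (rule filterlim_compose)
  thus ?thesis by (simp add: add_ac)
qed

text \<open>The factor by which the normalisation of \<open>e (n + i)\<close> and \<open>e (n + j)\<close> differs from that of the moment
  occurring in their product.\<close>

lemma normalisation_limit:
  "(\<lambda>n. c (2 * n + i + j + 1) / (sqrt (c (2 * (n + i) + 1)) * sqrt (c (2 * (n + j) + 1)))) \<longlonglongrightarrow> 1"
proof -
  have *: "(\<lambda>n. c (2 * n + i + j + 1) / (sqrt (c (2 * (n + j) + 1)) * sqrt (c (2 * (n + i) + 1)))) \<longlonglongrightarrow> 1"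
    if "i \<le> j" for i j
  proof -
    have idx: "2 * (n + i) + (j - i) = 2 * n + i + j" "2 * (n + i) + 2 * (j - i) = 2 * (n + j)" for n
      using that by auto
    show ?thesis
      using LIMSEQ_ignore_initial_segment[OF moment_log_convexity_limit[of "j - i"], of i]
      unfolding idx .
  qed
  show ?thesis
  proof (cases "i \<le> j")
    case True
    thus ?thesis using *[OF True] by (simp add: mult.commute)
  next
    case False
    thus ?thesis using *[of j i] by (simp add: add_ac)
  qed
qed

text \<open>Unifies the two cases of \<open>to_radius\<close>, so that finite and infinite \<open>R\<close> need no separate treatment later.\<close>

lemma radial_limit_near_boundary:
  fixes f :: "real \<Rightarrow> complex"
  assumes "(f \<longlongrightarrow> L) (to_radius R)" "e > 0"
  shows "\<exists>r0. 0 < r0 \<and> ereal r0 < R \<and> (\<forall>r. r0 < r \<longrightarrow> ereal r < R \<longrightarrow> cmod (f r - L) < e)"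
proof -
  have ev: "eventually (\<lambda>r. cmod (f r - L) < e) (to_radius R)"
    using assms by (auto simp: tendsto_iff dist_norm)
  show ?thesis
  proof (cases "R = \<infinity>")
    case True
    then obtain b where b: "\<And>r. r \<ge> b \<Longrightarrow> cmod (f r - L) < e"
      using ev by (auto simp: to_radius_def eventually_at_top_linorder)
    show ?thesis by (rule exI[of _ "max 1 b"]) (use True b in \<open>auto simp: max_def\<close>)
  next
    case False
    then obtain q where R: "R = ereal q" using R_pos by (cases R) auto
    hence q: "q > 0" using R_pos by simp
    obtain b where b: "b < q" "\<And>r. b < r \<Longrightarrow> r < q \<Longrightarrow> cmod (f r - L) < e"
      using ev unfolding to_radius_def R by (auto simp: eventually_at_left[of 0 q, OF q])
    show ?thesis by (rule exI[of _ "max (q / 2) b"]) (use q b R in auto)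
  qed
qed

text \<open>In polar coordinates the entry is a normalisation factor times the integral over the angle of a
  radial average, weighted by a character. By concentration, the radial averages converge to \<open>L \<theta>\<close> on almost every ray; they are
  bounded by \<open>B\<close>, so dominated convergence over the angle applies. As an almost everywhere limit of Borel functions, \<open>L\<close> is
  Lebesgue measurable.\<close>

theorem matrix_entry_limit:
  fixes s :: "complex \<Rightarrow> complex" and L :: "real \<Rightarrow> complex"
  assumes s: "s \<in> borel_measurable (lebesgue_on (disc R))" and B: "\<And>z. z \<in> disc R \<Longrightarrow> cmod (s z) \<le> B"
    and lim: "AE \<theta> in lebesgue. \<theta> \<in> {0..<2 * pi} \<longrightarrow> ((\<lambda>r. s (rcis r \<theta>)) \<longlongrightarrow> L \<theta>) (to_radius R)"
  shows "L \<in> borel_measurable (lebesgue_on {0..2 * pi})" (is ?th1)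
    and "(\<lambda>n. LINT z|M. s z * mono_basis c R (n + i) z * cnj (mono_basis c R (n + j) z))
       \<longlonglongrightarrow> (LINT \<theta>|lebesgue_on {0..2 * pi}. L \<theta> * cis ((real i - real j) * \<theta>)) / of_real (2 * pi)" (is ?th2)
proof -
  let ?U = "lebesgue_on {0..2 * pi}"
  interpret U: finite_measure ?U by (rule finite_measure_lebesgue_on) auto
  have "0 \<in> disc R" using R_pos by (simp add: disc_def zero_ereal_def)
  hence B0: "B \<ge> 0" using B[of 0] norm_ge_zero order_trans by blast
  obtain sb where sb[measurable]: "sb \<in> borel_measurable borel" and sbB: "\<And>z. cmod (sb z) \<le> B"
    and ae: "AE z in M. s z = sb z" "AE \<theta> in angle_measure. AE r in \<rho>. s (rcis r \<theta>) = sb (rcis r \<theta>)"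
    using symbol_borel_version[OF s B B0] by blast
  \<comment> \<open>the mean of the symbol on the ray at angle \<open>\<theta>\<close> under the concentrating radial measure\<close>
  define J where "J k \<theta> = (LINT r|\<rho>. sb (rcis r \<theta>) * of_real (r ^ k)) / of_real (c (k + 1))" for k \<theta>
  have J_meas[measurable]: "J k \<in> borel_measurable borel" for k
    unfolding J_def by measurable
  have bm: "f \<in> borel_measurable ?U" if "f \<in> borel_measurable borel" for f :: "real \<Rightarrow> complex"
    using that by (auto intro!: measurable_restrict_space1 measurable_completion)
  have J_bd: "cmod (J k \<theta>) \<le> B" for k \<theta>
  proof -
    have "cmod (LINT r|\<rho>. sb (rcis r \<theta>) * of_real (r ^ k)) \<le> B * c (k + 1)"
      by (rule bounded_radius_moment(2)[OF _ sbB]) measurable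
    thus ?thesis using c_pos[of "k + 1"] by (simp add: J_def norm_divide field_simps)
  qed
  have "AE \<theta> in lebesgue. \<theta> \<in> {0..2 * pi} \<longrightarrow> (AE r in \<rho>. s (rcis r \<theta>) = sb (rcis r \<theta>))"
  proof -
    have "AE \<theta> in lborel. \<theta> \<in> {0..2 * pi} \<longrightarrow> (AE r in \<rho>. s (rcis r \<theta>) = sb (rcis r \<theta>))"
      using ae(2) unfolding angle_measure_def
      by (subst (asm) AE_density) (auto elim!: eventually_mono simp: indicator_def)
    thus ?thesis by (rule AE_completion)
  qed
  moreover have "AE \<theta> in lebesgue. \<theta> \<noteq> 2 * pi" by (rule AE_completion[OF AE_lborel_singleton])
  ultimately have "AE \<theta> in lebesgue. \<theta> \<in> {0..2 * pi} \<longrightarrow> (\<lambda>k. J k \<theta>) \<longlonglongrightarrow> L \<theta>"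
    using lim
  proof eventually_elim
    case (elim \<theta>)
    show ?case
    proof
      assume \<theta>: "\<theta> \<in> {0..2 * pi}"
      with elim have lim': "((\<lambda>r. s (rcis r \<theta>)) \<longlongrightarrow> L \<theta>) (to_radius R)"
        and eq: "AE r in \<rho>. s (rcis r \<theta>) = sb (rcis r \<theta>)" by auto
      show "(\<lambda>k. J k \<theta>) \<longlonglongrightarrow> L \<theta>"
        unfolding J_def
      proof (rule radial_concentration[OF _ sbB])
        fix e :: real assume "e > 0"
        from radial_limit_near_boundary[OF lim' this] obtain r0 where r0: "0 < r0" "ereal r0 < R"
          "\<And>r. r0 < r \<Longrightarrow> ereal r < R \<Longrightarrow> cmod (s (rcis r \<theta>) - L \<theta>) < e" by blast
        have "AE r in \<rho>. r > r0 \<longrightarrow> cmod (sb (rcis r \<theta>) - L \<theta>) \<le> e"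
          using eq AE_radius
        proof eventually_elim
          case (elim r)
          thus ?case using r0(3)[of r] by auto
        qed
        thus "\<exists>r0. 0 < r0 \<and> ereal r0 < R \<and> (AE r in \<rho>. r > r0 \<longrightarrow> cmod (sb (rcis r \<theta>) - L \<theta>) \<le> e)"
          using r0 by blast
      qed measurable
    qed
  qed
  note J_lim' = this
  hence J_lim: "AE \<theta> in ?U. (\<lambda>k. J k \<theta>) \<longlonglongrightarrow> L \<theta>"
    by (subst AE_restrict_space_iff) auto
  have L_meas: ?th1
  proof -
    have [measurable]: "(\<lambda>\<theta>. lim (\<lambda>k. J k \<theta>)) \<in> borel_measurable borel" by measurable
    have "(\<lambda>\<theta>. if \<theta> \<in> {0..2 * pi} then lim (\<lambda>k. J k \<theta>) else 0) \<in> borel_measurable borel" by measurable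
    hence "(\<lambda>\<theta>. if \<theta> \<in> {0..2 * pi} then lim (\<lambda>k. J k \<theta>) else 0) \<in> borel_measurable lebesgue"
      by (auto intro: measurable_completion)
    moreover have "AE \<theta> in lebesgue. (if \<theta> \<in> {0..2 * pi} then lim (\<lambda>k. J k \<theta>) else 0) =
        (if \<theta> \<in> {0..2 * pi} then L \<theta> else 0)"
      using J_lim' by eventually_elim (auto intro: limI)
    ultimately have "(\<lambda>\<theta>. if \<theta> \<in> {0..2 * pi} then L \<theta> else 0) \<in> borel_measurable lebesgue"
      by (rule borel_measurable_AE)
    thus ?thesis by (subst (asm) borel_measurable_if) auto
  qed
  show ?th1 by fact
  let ?e = "\<lambda>\<theta>. cis ((real i - real j) * \<theta>)"
  have e_meas[measurable]: "?e \<in> borel_measurable borel" by (intro borel_measurable_continuous_onI continuous_intros)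
  have "(\<lambda>k. LINT \<theta>|?U. J k \<theta> * ?e \<theta>) \<longlonglongrightarrow> (LINT \<theta>|?U. L \<theta> * ?e \<theta>)"
  proof (rule integral_dominated_convergence[where w = "\<lambda>_. B"])
    show "AE \<theta> in ?U. (\<lambda>k. J k \<theta> * ?e \<theta>) \<longlonglongrightarrow> L \<theta> * ?e \<theta>"
      using J_lim by eventually_elim (intro tendsto_intros)
    show "AE \<theta> in ?U. cmod (J k \<theta> * ?e \<theta>) \<le> B" for k
      using J_bd by (intro AE_I2) (simp add: norm_mult)
  qed (use L_meas bm[OF J_meas] bm[OF e_meas] in auto)
  moreover have "filterlim (\<lambda>n. 2 * n + i + j :: nat) sequentially sequentially"
    by (rule filterlim_subseq) (auto simp: strict_mono_def)
  ultimately have lim1: "(\<lambda>n. LINT \<theta>|?U. J (2 * n + i + j) \<theta> * ?e \<theta>) \<longlonglongrightarrow> (LINT \<theta>|?U. L \<theta> * ?e \<theta>)"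
    by (rule filterlim_compose)
  have entry: "(LINT z|M. s z * mono_basis c R (n + i) z * cnj (mono_basis c R (n + j) z)) =
     of_real (c (2 * n + i + j + 1) / (sqrt (c (2 * (n + i) + 1)) * sqrt (c (2 * (n + j) + 1)))) *
     ((LINT \<theta>|?U. J (2 * n + i + j) \<theta> * ?e \<theta>) / of_real (2 * pi))" for n
  proof -
    let ?a = "sqrt (c (2 * (n + i) + 1))" and ?b = "sqrt (c (2 * (n + j) + 1))"
    have sm: "s \<in> borel_measurable M" using s by (simp add: measurable_radial_measure)
    have mb: "(\<lambda>z. z ^ k) \<in> borel_measurable M" "(\<lambda>z. cnj (z ^ k)) \<in> borel_measurable M" for k
      by (intro borel_imp_measurable_radial; measurable)+
    have "(LINT z|M. s z * mono_basis c R (n + i) z * cnj (mono_basis c R (n + j) z)) =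
       (LINT z|M. (s z * (z ^ (n + i) * cnj (z ^ (n + j)))) / of_real (?a * ?b))"
      by (rule Bochner_Integration.integral_cong) (auto simp: mono_basis_def)
    also have "\<dots> = (LINT z|M. s z * (z ^ (n + i) * cnj (z ^ (n + j)))) / of_real (?a * ?b)"
      by (rule integral_divide_zero)
    also have "(LINT z|M. s z * (z ^ (n + i) * cnj (z ^ (n + j)))) = (LINT z|M. sb z * (z ^ (n + i) * cnj (z ^ (n + j))))"
    proof (rule integral_cong_AE)
      show "(\<lambda>z. s z * (z ^ (n + i) * cnj (z ^ (n + j)))) \<in> borel_measurable M"
        using sm mb by (intro borel_measurable_times)
      show "(\<lambda>z. sb z * (z ^ (n + i) * cnj (z ^ (n + j)))) \<in> borel_measurable M"
        using mb by (intro borel_measurable_times borel_imp_measurable_radial[OF sb])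
      show "AE z in M. s z * (z ^ (n + i) * cnj (z ^ (n + j))) = sb z * (z ^ (n + i) * cnj (z ^ (n + j)))"
        using ae(1) by eventually_elim simp
    qed
    also have "\<dots> = (LINT \<theta>|angle_measure. (LINT r|\<rho>. sb (rcis r \<theta>) * of_real (r ^ (n + i + (n + j)))) * cis ((real (n + i) - real (n + j)) * \<theta>))"
      by (rule integral_monomials[OF sb sbB])
    also have "\<dots> = (LINT \<theta>|angle_measure. of_real (c (2 * n + i + j + 1)) * (J (2 * n + i + j) \<theta> * ?e \<theta>))"
    proof (rule Bochner_Integration.integral_cong)
      fix \<theta>
      have "n + i + (n + j) = 2 * n + i + j" by simp
      thus "(LINT r|\<rho>. sb (rcis r \<theta>) * of_real (r ^ (n + i + (n + j)))) * cis ((real (n + i) - real (n + j)) * \<theta>)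
        = of_real (c (2 * n + i + j + 1)) * (J (2 * n + i + j) \<theta> * ?e \<theta>)"
        using c_pos[of "2 * n + i + j + 1"] unfolding J_def by (simp only:) simp
    qed simp
    also have "\<dots> = of_real (c (2 * n + i + j + 1)) * (LINT \<theta>|angle_measure. J (2 * n + i + j) \<theta> * ?e \<theta>)"
      by (rule integral_mult_right_zero)
    also have "(LINT \<theta>|angle_measure. J (2 * n + i + j) \<theta> * ?e \<theta>) = (LINT \<theta>|?U. J (2 * n + i + j) \<theta> * ?e \<theta>) /\<^sub>R (2 * pi)"
      by (rule integral_angle_measure) measurable
    finally show ?thesis by (simp add: scaleR_conv_of_real field_simps)
  qed
  have "(\<lambda>n. of_real (c (2 * n + i + j + 1) / (sqrt (c (2 * (n + i) + 1)) * sqrt (c (2 * (n + j) + 1)))) *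
     ((LINT \<theta>|?U. J (2 * n + i + j) \<theta> * ?e \<theta>) / of_real (2 * pi))) \<longlonglongrightarrow> of_real 1 * ((LINT \<theta>|?U. L \<theta> * ?e \<theta>) / of_real (2 * pi))"
    by (intro tendsto_intros lim1 normalisation_limit) auto
  thus ?th2 unfolding entry by simp
qed

end

section \<open>The projection onto the weighted space of analytic functions\<close>

context radial_weight begin

abbreviation "e \<equiv> mono_basis c R"

lemma measurable_mono_basis: "e n \<in> borel_measurable M"
proof -
  have "e n \<in> borel_measurable borel" unfolding mono_basis_def by measurable
  thus ?thesis by (rule borel_imp_measurable_radial)
qed

lemma mono_basis_mult_cnj:
  "z \<in> disc R \<Longrightarrow> e n z * cnj (e m z) = 1 * (z ^ n * cnj (z ^ m)) / of_real (sqrt (c (2 * n + 1)) * sqrt (c (2 * m + 1)))"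
  by (simp add: mono_basis_def)

lemma integrable_mono_basis: "integrable M (\<lambda>z. e n z * cnj (e m z))"
proof -
  have "integrable M (\<lambda>z. 1 * (z ^ n * cnj (z ^ m)) / of_real (sqrt (c (2 * n + 1)) * sqrt (c (2 * m + 1))))"
    by (intro integrable_divide integrable_monomials[where B = 1]) auto
  thus ?thesis
    by (subst Bochner_Integration.integrable_cong[OF refl mono_basis_mult_cnj]) auto
qed

lemma sq_integrable_mono_basis: "sq_integrable M (e n)"
  using measurable_mono_basis[of n] integrable_norm[OF integrable_mono_basis[of n n]]
  by (simp add: sq_integrable_def norm_mult power2_eq_square)

lemma inner_mono_basis: "L2_inner M (e n) (e m) = (if n = m then 1 else 0)"
proof -
  let ?s = "sqrt (c (2 * n + 1)) * sqrt (c (2 * m + 1))"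
  have cis: "cis ((real n - real m) * \<theta>) = cis (of_int (int n - int m) * \<theta>)" for \<theta> by simp
  have "L2_inner M (e n) (e m) = (LINT z|M. 1 * (z ^ n * cnj (z ^ m)) / of_real ?s)"
    unfolding L2_inner_def by (rule Bochner_Integration.integral_cong) (auto simp: mono_basis_mult_cnj)
  also have "\<dots> = (LINT z|M. 1 * (z ^ n * cnj (z ^ m))) / of_real ?s"
    by (rule integral_divide_zero)
  also have "(LINT z|M. 1 * (z ^ n * cnj (z ^ m))) =
     (LINT \<theta>|angle_measure. (LINT r|\<rho>. 1 * of_real (r ^ (n + m))) * cis ((real n - real m) * \<theta>))"
    by (rule integral_monomials[where B = 1]) auto
  also have "\<dots> = (LINT \<theta>|angle_measure. of_real (c (n + m + 1)) * cis (of_int (int n - int m) * \<theta>))"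
    unfolding cis using moment_radius[of "n + m"] by (simp del: of_real_power of_int_diff)
  also have "\<dots> = of_real (c (n + m + 1)) * (LINT \<theta>|angle_measure. cis (of_int (int n - int m) * \<theta>))"
    by (rule integral_mult_right_zero)
  also have "(LINT \<theta>|angle_measure. cis (of_int (int n - int m) * \<theta>)) = (if n = m then 1 else 0)"
    by (subst integral_cis_angle_measure) auto
  finally have eq: "L2_inner M (e n) (e m) = of_real (c (n + m + 1)) * (if n = m then 1 else 0) / of_real ?s" .
  show ?thesis
  proof (cases "n = m")
    case True
    hence "?s = c (n + m + 1)" using c_pos[of "2 * n + 1"] by (simp add: mult_2)
    thus ?thesis using eq True c_pos[of "n + m + 1"] by simp
  qed (use eq in simp)
qed

lemma orthonormal_mono_basis: "orthonormal_on I M e"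
  by (simp add: orthonormal_on_def sq_integrable_mono_basis inner_mono_basis)

text \<open>Fatou's lemma bounds the norm of \<open>f\<close> minus a partial sum by the tail of the squared coefficients, so the
  pointwise sum is also the limit in the mean square.\<close>

lemma basis_series_L2:
  assumes f: "\<And>z. z \<in> disc R \<Longrightarrow> (\<lambda>n. b n * e n z) sums f z"
    and b: "summable (\<lambda>n. (cmod (b n))\<^sup>2)"
  shows "sq_integrable M f"
    and "(\<lambda>N. LINT z|M. (cmod (f z - (\<Sum>n<N. b n * e n z)))\<^sup>2) \<longlonglongrightarrow> 0"
proof -
  define S where "S N z = (\<Sum>n<N. b n * e n z)" for N z
  define T where "T N = (\<Sum>n. (cmod (b (n + N)))\<^sup>2)" for N
  have Slim: "(\<lambda>K. S K z) \<longlonglongrightarrow> f z" if "z \<in> disc R" for z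
    using f[OF that] unfolding sums_def S_def .
  have Sl2: "sq_integrable M (S N)" for N unfolding S_def
    by (intro sq_integrable_lincomb sq_integrable_mono_basis)
  have Smeas[measurable]: "S N \<in> borel_measurable M" for N using Sl2 by (rule sq_integrable_measurable)
  have fmeas[measurable]: "f \<in> borel_measurable M"
    by (rule borel_measurable_LIMSEQ_metric[OF Smeas]) (use Slim in auto)
  have diff: "(\<integral>\<^sup>+z. ennreal ((cmod (S K z - S N z))\<^sup>2) \<partial>M) \<le> ennreal (T N)" if "K \<ge> N" for K N
  proof -
    have SKN: "S K z - S N z = (\<Sum>n\<in>{N..<K}. b n * e n z)" for z
      unfolding S_def using sum_diff_nat_ivl[of 0 N K "\<lambda>n. b n * e n z"] that
      by (simp add: atLeast0LessThan)
    have "(LINT z|M. (cmod (S K z - S N z))\<^sup>2) = (\<Sum>n\<in>{N..<K}. (cmod (b n))\<^sup>2)"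
    proof -
      have "complex_of_real (LINT z|M. (cmod (S K z - S N z))\<^sup>2) = (\<Sum>n\<in>{N..<K}. b n * cnj (b n))"
        unfolding SKN L2_inner_self[symmetric] by (rule L2_norm_lincomb[OF _ orthonormal_mono_basis]) simp
      also have "\<dots> = complex_of_real (\<Sum>n\<in>{N..<K}. (cmod (b n))\<^sup>2)"
        unfolding of_real_sum by (intro sum.cong refl) (simp only: complex_norm_square)
      finally show ?thesis unfolding of_real_eq_iff .
    qed
    also have "\<dots> = (\<Sum>n<K - N. (cmod (b (n + N)))\<^sup>2)"
      using sum.shift_bounds_nat_ivl[of "\<lambda>n. (cmod (b n))\<^sup>2" 0 N "K - N"] that by (simp add: atLeast0LessThan)
    also have "\<dots> \<le> T N" unfolding T_def
      by (rule sum_le_suminf) (use summable_ignore_initial_segment[OF b] in auto)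
    finally have "(LINT z|M. (cmod (S K z - S N z))\<^sup>2) \<le> T N" .
    moreover have "(\<integral>\<^sup>+z. ennreal ((cmod (S K z - S N z))\<^sup>2) \<partial>M) = ennreal (LINT z|M. (cmod (S K z - S N z))\<^sup>2)"
      using sq_integrable_diff[OF Sl2[of K] Sl2[of N]] by (intro nn_integral_eq_integral) (auto simp: sq_integrable_def)
    ultimately show ?thesis by (simp add: ennreal_leI)
  qed
  have fatou: "(\<integral>\<^sup>+z. ennreal ((cmod (f z - S N z))\<^sup>2) \<partial>M) \<le> ennreal (T N)" for N
  proof -
    have "(\<integral>\<^sup>+z. ennreal ((cmod (f z - S N z))\<^sup>2) \<partial>M) = (\<integral>\<^sup>+z. liminf (\<lambda>K. ennreal ((cmod (S K z - S N z))\<^sup>2)) \<partial>M)"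
    proof (rule nn_integral_cong)
      fix z assume "z \<in> space M"
      hence "(\<lambda>K. ennreal ((cmod (S K z - S N z))\<^sup>2)) \<longlonglongrightarrow> ennreal ((cmod (f z - S N z))\<^sup>2)"
        by (intro tendsto_intros tendsto_ennrealI Slim) auto
      thus "ennreal ((cmod (f z - S N z))\<^sup>2) = liminf (\<lambda>K. ennreal ((cmod (S K z - S N z))\<^sup>2))"
        by (intro lim_imp_Liminf[symmetric]) auto
    qed
    also have "\<dots> \<le> liminf (\<lambda>K. \<integral>\<^sup>+z. ennreal ((cmod (S K z - S N z))\<^sup>2) \<partial>M)"
      by (rule nn_integral_liminf) measurable
    also have "\<dots> \<le> liminf (\<lambda>K. ennreal (T N))"
      by (rule Liminf_mono) (use diff in \<open>auto simp: eventually_sequentially\<close>)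
    finally show ?thesis by (simp add: Liminf_const)
  qed
  have int: "integrable M (\<lambda>z. (cmod (f z - S N z))\<^sup>2)" for N
    by (rule integrableI_bounded) (use le_less_trans[OF fatou[of N] ennreal_less_top] in auto)
  have le: "(LINT z|M. (cmod (f z - S N z))\<^sup>2) \<le> T N" for N
  proof -
    have "ennreal (LINT z|M. (cmod (f z - S N z))\<^sup>2) \<le> ennreal (T N)"
      using fatou[of N] nn_integral_eq_integral[OF int[of N]] by simp
    moreover have "T N \<ge> 0" unfolding T_def
      by (rule suminf_nonneg[OF summable_ignore_initial_segment[OF b]]) simp
    ultimately show ?thesis by simp
  qed
  have "sq_integrable M (\<lambda>z. f z - S 0 z)" using int[of 0] by (simp add: sq_integrable_def)
  thus "sq_integrable M f" by (simp add: S_def)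
  have T0: "T \<longlonglongrightarrow> 0"
  proof -
    have "T = (\<lambda>N. suminf (\<lambda>n. (cmod (b n))\<^sup>2) - (\<Sum>n<N. (cmod (b n))\<^sup>2))"
      unfolding T_def by (intro ext suminf_minus_initial_segment[OF b])
    moreover have "(\<lambda>N. suminf (\<lambda>n. (cmod (b n))\<^sup>2) - (\<Sum>n<N. (cmod (b n))\<^sup>2)) \<longlonglongrightarrow> suminf (\<lambda>n. (cmod (b n))\<^sup>2) - suminf (\<lambda>n. (cmod (b n))\<^sup>2)"
      by (intro tendsto_intros summable_LIMSEQ b)
    ultimately show ?thesis by simp
  qed
  show "(\<lambda>N. LINT z|M. (cmod (f z - (\<Sum>n<N. b n * e n z)))\<^sup>2) \<longlonglongrightarrow> 0"
    by (rule tendsto_sandwich[OF _ _ tendsto_const T0]) (use le in \<open>auto simp: S_def[symmetric]\<close>)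
qed

lemma inner_basis_series_tendsto:
  assumes f: "\<And>z. z \<in> disc R \<Longrightarrow> (\<lambda>n. b n * e n z) sums f z"
    and b: "summable (\<lambda>n. (cmod (b n))\<^sup>2)" and g: "sq_integrable M g"
  shows "(\<lambda>N. \<Sum>n<N. cnj (b n) * L2_inner M g (e n)) \<longlonglongrightarrow> L2_inner M g f"
proof -
  let ?S = "\<lambda>N z. \<Sum>n<N. b n * e n z"
  have S: "sq_integrable M (?S N)" for N by (intro sq_integrable_lincomb sq_integrable_mono_basis)
  have f2: "sq_integrable M f" by (rule basis_series_L2(1)[OF f b])
  have "(\<lambda>N. L2_inner M g (\<lambda>z. f z - ?S N z)) \<longlonglongrightarrow> 0"
    by (rule L2_inner_tendsto_zero[OF g _ basis_series_L2(2)[OF f b]]) (intro sq_integrable_diff f2 S)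
  moreover have "L2_inner M g (\<lambda>z. f z - ?S N z) = L2_inner M g f - (\<Sum>n<N. cnj (b n) * L2_inner M g (e n))" for N
    unfolding L2_inner_diff_right[OF f2 S g] by (subst L2_inner_lincomb_right[OF sq_integrable_mono_basis g]) simp
  ultimately have "(\<lambda>N. L2_inner M g f - (\<Sum>n<N. cnj (b n) * L2_inner M g (e n))) \<longlonglongrightarrow> 0" by simp
  from tendsto_diff[OF tendsto_const[of "L2_inner M g f"] this] show ?thesis by simp
qed

lemma basis_series_coeff:
  assumes f: "\<And>z. z \<in> disc R \<Longrightarrow> (\<lambda>n. b n * e n z) sums f z"
    and b: "summable (\<lambda>n. (cmod (b n))\<^sup>2)"
  shows "L2_inner M f (e m) = b m"
proof -
  have "(\<lambda>N. \<Sum>n<N. cnj (b n) * L2_inner M (e m) (e n)) \<longlonglongrightarrow> L2_inner M (e m) f"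
    by (rule inner_basis_series_tendsto[OF f b sq_integrable_mono_basis])
  moreover have "(\<Sum>n<N. cnj (b n) * L2_inner M (e m) (e n)) = cnj (b m)" if "N \<ge> Suc m" for N
    using that by (simp add: inner_mono_basis if_distrib[of "\<lambda>x. _ * x"] cong: if_cong)
  hence "(\<lambda>N. \<Sum>n<N. cnj (b n) * L2_inner M (e m) (e n)) \<longlonglongrightarrow> cnj (b m)"
    by (intro tendsto_eventually) (auto simp: eventually_sequentially)
  ultimately have "L2_inner M (e m) f = cnj (b m)" by (rule LIMSEQ_unique)
  thus ?thesis using L2_inner_cnj[of M "e m" f] by simp
qed

lemma Hc_iff_basis_series:
  "f \<in> Hc c R \<longleftrightarrow> (\<forall>z. z \<notin> disc R \<longrightarrow> f z = 0) \<and>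
     (\<exists>b. (\<forall>z\<in>disc R. (\<lambda>n. b n * e n z) sums f z) \<and> summable (\<lambda>n. (cmod (b n))\<^sup>2))"
proof -
  let ?q = "\<lambda>n. complex_of_real (sqrt (c (2 * n + 1)))"
  have q: "?q n \<noteq> 0" "(cmod (?q n))\<^sup>2 = c (2 * n + 1)" for n
    using c_pos[of "2 * n + 1"] by auto
  have fwd: "\<exists>b. (\<forall>z\<in>disc R. (\<lambda>n. b n * e n z) sums f z) \<and> summable (\<lambda>n. (cmod (b n))\<^sup>2)"
    if "\<forall>z\<in>disc R. (\<lambda>n. a n * z ^ n) sums f z" "summable (\<lambda>n. (cmod (a n))\<^sup>2 * c (2 * n + 1))" for a
  proof (intro exI conjI ballI)
    have "(\<lambda>n. (a n * ?q n) * e n z) = (\<lambda>n. a n * z ^ n)" if "z \<in> disc R" for z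
      using that q by (simp add: mono_basis_def)
    thus "(\<lambda>n. (a n * ?q n) * e n z) sums f z" if "z \<in> disc R" for z
      using \<open>\<forall>z\<in>disc R. (\<lambda>n. a n * z ^ n) sums f z\<close> that by simp
    show "summable (\<lambda>n. (cmod (a n * ?q n))\<^sup>2)"
      using that(2) unfolding norm_mult power_mult_distrib q .
  qed
  have bwd: "\<exists>a. (\<forall>z\<in>disc R. (\<lambda>n. a n * z ^ n) sums f z) \<and> summable (\<lambda>n. (cmod (a n))\<^sup>2 * c (2 * n + 1))"
    if "\<forall>z\<in>disc R. (\<lambda>n. b n * e n z) sums f z" "summable (\<lambda>n. (cmod (b n))\<^sup>2)" for b
  proof (intro exI conjI ballI)
    have "(\<lambda>n. (b n / ?q n) * z ^ n) = (\<lambda>n. b n * e n z)" if "z \<in> disc R" for z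
      using that q by (simp add: mono_basis_def)
    thus "(\<lambda>n. (b n / ?q n) * z ^ n) sums f z" if "z \<in> disc R" for z
      using \<open>\<forall>z\<in>disc R. (\<lambda>n. b n * e n z) sums f z\<close> that by simp
    have "(cmod (b n / ?q n))\<^sup>2 * c (2 * n + 1) = (cmod (b n))\<^sup>2" for n
      unfolding norm_divide power_divide q using c_pos[of "2 * n + 1"] by simp
    thus "summable (\<lambda>n. (cmod (b n / ?q n))\<^sup>2 * c (2 * n + 1))" using that(2) by simp
  qed
  show ?thesis
    unfolding Hc_def mem_Collect_eq
    by (intro arg_cong2[where f = conj] refl iffI; elim exE conjE; (rule fwd | rule bwd); assumption)
qed

text \<open>For \<open>\<bar>z\<bar> < t < R\<close> the basis functions decay like \<open>(\<bar>z\<bar> / t) ^ n\<close>, since \<open>t ^ n / sqrt (c (2 n + 1))\<close> is bounded.\<close>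

lemma basis_series_summable:
  assumes z: "z \<in> disc R" and b: "\<And>n. cmod (b n) \<le> C"
  shows "summable (\<lambda>n. b n * e n z)"
proof -
  have "ereal (cmod z) < R" using z by (simp add: disc_def)
  then obtain t where t: "ereal (cmod z) < ereal t" "ereal t < R" using ereal_dense2 by blast
  have zt: "cmod z < t" using t(1) by simp
  have t0: "0 < t" "cmod z < t" using zt le_less_trans[OF norm_ge_zero zt] by simp_all
  have C: "C \<ge> 0" using b[of 0] norm_ge_zero order_trans by blast
  obtain K where K: "\<And>k. norm (t ^ k / c (k + 1)) \<le> K" and K0: "K > 0"
    using convergent_imp_Bseq[OF convergentI[OF power_over_moment_tendsto_zero[OF t0(1) t(2)]]]
    unfolding Bseq_def by blast
  show ?thesis
  proof (rule summable_comparison_test)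
    show "summable (\<lambda>n. C * sqrt K * (cmod z / t) ^ n)"
      using t0 by (intro summable_mult summable_geometric) simp
    have "norm (b n * e n z) \<le> C * sqrt K * (cmod z / t) ^ n" for n
    proof -
      have "t ^ (2 * n) / c (2 * n + 1) \<le> K" using order_trans[OF abs_ge_self K[of "2 * n", unfolded real_norm_def]] by simp
      hence "sqrt (t ^ (2 * n) / c (2 * n + 1)) \<le> sqrt K" by simp
      moreover have "sqrt (t ^ (2 * n) / c (2 * n + 1)) = t ^ n / sqrt (c (2 * n + 1))"
        using t0 unfolding real_sqrt_divide power_even_eq by simp
      ultimately have "t ^ n / sqrt (c (2 * n + 1)) \<le> sqrt K" by linarith
      hence "(cmod z / t) ^ n * (t ^ n / sqrt (c (2 * n + 1))) \<le> (cmod z / t) ^ n * sqrt K"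
        using t0 by (intro mult_left_mono) auto
      moreover have "cmod (e n z) = (cmod z / t) ^ n * (t ^ n / sqrt (c (2 * n + 1)))"
        using z t0 c_pos[of "2 * n + 1"] by (simp add: mono_basis_def norm_divide norm_power power_divide)
      ultimately have "cmod (e n z) \<le> (cmod z / t) ^ n * sqrt K" by linarith
      hence "cmod (b n) * cmod (e n z) \<le> C * ((cmod z / t) ^ n * sqrt K)"
        using b[of n] C by (intro mult_mono) auto
      thus ?thesis by (simp add: norm_mult mult_ac)
    qed
    thus "\<exists>N. \<forall>n\<ge>N. norm (b n * e n z) \<le> C * sqrt K * (cmod z / t) ^ n" by blast
  qed
qed

text \<open>The Fourier coefficients of \<open>g\<close> are square summable by Bessel's inequality, so their series defines an
  element of \<open>Hc\<close>; the residual is orthogonal to the basis, hence to all of \<open>Hc\<close> by continuity of the inner product.\<close>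

theorem orth_proj_Hc:
  assumes g: "sq_integrable M g"
  shows "sq_integrable M (orth_proj M (Hc c R) g)"
    and "L2_inner M (orth_proj M (Hc c R) g) (e n) = L2_inner M g (e n)"
proof -
  define b where "b n = L2_inner M g (e n)" for n
  define G where "G = (LINT z|M. (cmod (g z))\<^sup>2)"
  have bessel: "(\<Sum>n<N. (cmod (b n))\<^sup>2) \<le> G" for N
    unfolding b_def G_def by (rule bessel_L2[OF _ orthonormal_mono_basis g]) simp
  have bsum: "summable (\<lambda>n. (cmod (b n))\<^sup>2)"
  proof (rule summableI_nonneg_bounded)
    show "(\<Sum>n<N. (cmod (b n))\<^sup>2) \<le> G" for N by (rule bessel)
  qed simp
  have bbd: "cmod (b n) \<le> sqrt G" for n
  proof (rule real_le_rsqrt)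
    have "(cmod (b n))\<^sup>2 \<le> (\<Sum>n<Suc n. (cmod (b n))\<^sup>2)" by (simp add: sum_nonneg)
    thus "(cmod (b n))\<^sup>2 \<le> G" using bessel[of "Suc n"] by linarith
  qed
  define f where "f z = (if z \<in> disc R then \<Sum>n. b n * e n z else 0)" for z
  have f: "(\<lambda>n. b n * e n z) sums f z" if "z \<in> disc R" for z
    using summable_sums[OF basis_series_summable[OF that bbd]] that by (simp add: f_def)
  have fHc: "f \<in> Hc c R" unfolding Hc_iff_basis_series using f bsum by (auto simp: f_def)
  have f2: "sq_integrable M f" by (rule basis_series_L2(1)[OF f bsum])
  have coeff: "L2_inner M f (e n) = b n" for n by (rule basis_series_coeff[OF f bsum])
  have "orth_proj M (Hc c R) g = f"
    unfolding orth_proj_def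
  proof (rule the_equality)
    have r: "sq_integrable M (\<lambda>z. g z - f z)" by (intro sq_integrable_diff g f2)
    have re: "L2_inner M (\<lambda>z. g z - f z) (e n) = 0" for n
      unfolding L2_inner_diff_left[OF g f2 sq_integrable_mono_basis] coeff b_def by simp
    have "L2_inner M (\<lambda>z. g z - f z) h = 0" if h: "h \<in> Hc c R" for h
    proof -
      obtain d where d: "\<And>z. z \<in> disc R \<Longrightarrow> (\<lambda>n. d n * e n z) sums h z" "summable (\<lambda>n. (cmod (d n))\<^sup>2)"
        using h unfolding Hc_iff_basis_series by blast
      show ?thesis using inner_basis_series_tendsto[OF d r] by (simp add: re LIMSEQ_const_iff)
    qed
    thus "f \<in> Hc c R \<and> (\<forall>h\<in>Hc c R. L2_inner M (\<lambda>z. g z - f z) h = 0)" using fHc by blast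
    fix f' assume f': "f' \<in> Hc c R \<and> (\<forall>h\<in>Hc c R. L2_inner M (\<lambda>z. g z - f' z) h = 0)"
    then obtain d where d: "\<And>z. z \<in> disc R \<Longrightarrow> (\<lambda>n. d n * e n z) sums f' z" "summable (\<lambda>n. (cmod (d n))\<^sup>2)"
      and out: "\<And>z. z \<notin> disc R \<Longrightarrow> f' z = 0"
      unfolding Hc_iff_basis_series by blast
    have "e n \<in> Hc c R" for n
      unfolding Hc_iff_basis_series
    proof (intro conjI exI ballI)
      show "(\<lambda>k. (if k = n then 1 else 0) * e k z) sums e n z" for z
        using sums_single[of n "\<lambda>k. e k z"] by (simp add: if_distrib[of "\<lambda>x. x * _"] cong: if_cong)
      show "summable (\<lambda>k. (cmod (if k = n then 1 else 0))\<^sup>2)"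
        by (rule summable_finite[of "{n}"]) auto
    qed (simp add: mono_basis_def)
    hence orth: "L2_inner M (\<lambda>z. g z - f' z) (e n) = 0" for n using f' by blast
    have f'2: "sq_integrable M f'" by (rule basis_series_L2(1)[OF d])
    have "d n = b n" for n
      using orth[of n] L2_inner_diff_left[OF g f'2 sq_integrable_mono_basis] basis_series_coeff[OF d, of n]
      by (simp add: b_def)
    hence "d = b" by blast
    show "f' = f"
    proof
      fix z
      show "f' z = f z"
        using d(1)[of z] f[of z] out[of z] unfolding \<open>d = b\<close> by (cases "z \<in> disc R") (auto simp: f_def dest: sums_unique2)
    qed
  qed
  thus "sq_integrable M (orth_proj M (Hc c R) g)" "L2_inner M (orth_proj M (Hc c R) g) (e n) = L2_inner M g (e n)"
    using f2 coeff by (simp_all add: b_def)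
qed

end

section \<open>The compression as a Hermitian matrix\<close>

text \<open>The bounds \<open>lo\<close> and \<open>hi\<close> stand for the infimum and supremum of the symbol.\<close>

locale radial_symbol = radial_weight +
  fixes \<sigma> :: "complex \<Rightarrow> real" and lo hi :: real
  assumes sigma_meas: "\<sigma> \<in> borel_measurable (lebesgue_on (disc R))"
    and sigma_range: "\<And>z. z \<in> disc R \<Longrightarrow> \<sigma> z \<in> {lo..hi}"
begin

definition entry :: "nat \<Rightarrow> nat \<Rightarrow> complex" where
  "entry m n = (LINT z|M. of_real (\<sigma> z) * e n z * cnj (e m z))"

text \<open>The isometry from coefficient vectors onto \<open>KN\<close>.\<close>

definition poly_of :: "nat \<Rightarrow> (nat \<Rightarrow> complex) \<Rightarrow> complex \<Rightarrow> complex" where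
  "poly_of N a z = (\<Sum>n\<le>N. a n * e n z)"

lemma sigma_meas_M [measurable]: "\<sigma> \<in> borel_measurable M"
  using sigma_meas by (simp add: measurable_radial_measure)

lemma sigma_bound: "z \<in> disc R \<Longrightarrow> \<bar>\<sigma> z\<bar> \<le> \<bar>lo\<bar> + \<bar>hi\<bar>"
  using sigma_range[of z] by auto

lemma sq_integrable_sigma_mult:
  assumes "sq_integrable M f"
  shows "sq_integrable M (\<lambda>z. of_real (\<sigma> z) * f z)"
  by (rule sq_integrable_bounded_mult[OF assms, where B = "\<bar>lo\<bar> + \<bar>hi\<bar>"]) (auto simp: sigma_bound)

lemma entry_inner: "entry m n = L2_inner M (\<lambda>z. of_real (\<sigma> z) * e n z) (e m)"
  by (simp add: entry_def L2_inner_def)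

lemma entry_hermitian: "entry m n = cnj (entry n m)"
  unfolding entry_inner[of n m] L2_inner_cnj by (simp add: L2_inner_def entry_def mult_ac)

lemma sq_integrable_poly: "sq_integrable M (poly_of N a)"
  unfolding poly_of_def by (intro sq_integrable_lincomb sq_integrable_mono_basis)

lemma inner_poly: "L2_inner M (poly_of N a) (poly_of N b) = cip N a b"
  unfolding poly_of_def cip_def
  by (rule L2_norm_lincomb[OF _ orthonormal_mono_basis]) simp

lemma inner_poly_basis: "n \<le> N \<Longrightarrow> L2_inner M (poly_of N a) (e n) = a n"
  unfolding poly_of_def
  by (rule L2_inner_orthonormal_coeff[OF _ orthonormal_mono_basis]) simp_all

lemma poly_eqD: "poly_of N a = poly_of N b \<Longrightarrow> n \<le> N \<Longrightarrow> a n = b n"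
  using inner_poly_basis[of n N a] inner_poly_basis[of n N b] by simp

lemma inner_sigma_poly_basis:
  assumes "m \<le> N"
  shows "L2_inner M (\<lambda>z. of_real (\<sigma> z) * poly_of N a z) (e m) = mat_app N entry a m"
proof -
  have "(\<lambda>z. of_real (\<sigma> z) * poly_of N a z) = (\<lambda>z. \<Sum>n\<le>N. a n * (of_real (\<sigma> z) * e n z))"
    by (simp add: poly_of_def sum_distrib_left mult_ac)
  hence "L2_inner M (\<lambda>z. of_real (\<sigma> z) * poly_of N a z) (e m) = (\<Sum>n\<le>N. a n * entry m n)"
    unfolding entry_inner
    by (simp only:) (intro L2_inner_lincomb_left sq_integrable_sigma_mult sq_integrable_mono_basis)
  thus ?thesis using assms by (simp add: mat_app_def mult_ac)
qed

lemma inner_sigma_poly: "L2_inner M (\<lambda>z. of_real (\<sigma> z) * poly_of N a z) (poly_of N b) = cip N (mat_app N entry a) b"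
proof -
  have "L2_inner M (\<lambda>z. of_real (\<sigma> z) * poly_of N a z) (poly_of N b) =
    (\<Sum>m\<le>N. cnj (b m) * L2_inner M (\<lambda>z. of_real (\<sigma> z) * poly_of N a z) (e m))"
    unfolding poly_of_def[of N b]
    by (intro L2_inner_lincomb_right sq_integrable_mono_basis sq_integrable_sigma_mult sq_integrable_poly)
  thus ?thesis by (simp add: inner_sigma_poly_basis cip_def mult.commute)
qed

lemma KN_eq: "KN c R N = range (poly_of N)"
  unfolding KN_def poly_of_def by auto

lemma KN_eq': "KN c R N = {f. \<exists>a. f = (\<lambda>z. \<Sum>n\<in>{..N}. a n * e n z)}"
  unfolding KN_def ..

lemma orth_proj_KN:
  assumes "sq_integrable M g"
  shows "orth_proj M (KN c R N) g = poly_of N (\<lambda>n. L2_inner M g (e n))"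
  unfolding poly_of_def
  by (rule orth_proj_orthonormal[OF _ orthonormal_mono_basis assms KN_eq']) simp

lemma poly_of_cong: "(\<And>n. n \<le> N \<Longrightarrow> a n = b n) \<Longrightarrow> poly_of N a = poly_of N b"
  unfolding poly_of_def by (intro ext sum.cong) auto

text \<open>The projection onto \<open>KN\<close> reads off the first \<open>N + 1\<close> coefficients, which the projection onto \<open>Hc\<close> does
  not change; so the compression acts on coefficients by the matrix of entries.\<close>

theorem compression_poly: "compression c w R \<sigma> N (poly_of N a) = poly_of N (mat_app N entry a)"
proof -
  have "orth_proj M (KN c R N) (poly_of N a) = poly_of N a"
    unfolding orth_proj_KN[OF sq_integrable_poly] by (rule poly_of_cong) (rule inner_poly_basis)
  moreover have g: "sq_integrable M (\<lambda>z. of_real (\<sigma> z) * poly_of N a z)"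
    by (intro sq_integrable_sigma_mult sq_integrable_poly)
  have "orth_proj M (KN c R N) (toeplitz c w R \<sigma> (poly_of N a)) = poly_of N (mat_app N entry a)"
    unfolding toeplitz_def orth_proj_KN[OF orth_proj_Hc(1)[OF g]] orth_proj_Hc(2)[OF g]
    by (rule poly_of_cong) (rule inner_sigma_poly_basis)
  ultimately show ?thesis by (simp add: compression_def)
qed

lemma ex_eigenbasis: "\<exists>S l. eigenbasis N entry S l"
  by (rule hermitian_spectral_theorem) (rule entry_hermitian)

text \<open>Each eigenspace is spanned by the eigenbasis vectors belonging to its eigenvalue. Grouping
  the eigenbasis by eigenvalues therefore turns the sum of the spectral projections into a sum over the eigenbasis, and
  the projection onto each eigenvector has trace one.\<close>

lemma trace_fun_calc_eigenbasis:
  assumes eb: "eigenbasis N entry S l"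
  shows "trace_KN c w R N (fun_calc M (KN c R N) \<psi> (compression c w R \<sigma> N)) = (\<Sum>v\<in>S. \<psi> (l v))"
proof -
  note fin = eigenbasisD(1)[OF eb] and orth = eigenbasisD(3)[OF eb]
    and eig = eigenbasisD(4)[OF eb] and cpl = eigenbasisD(5)[OF eb]
  let ?F = "poly_of N" and ?A = "compression c w R \<sigma> N"
  have F_sum: "?F (\<lambda>n. \<Sum>v\<in>T. a v * v n) = (\<lambda>z. \<Sum>v\<in>T. a v * ?F v z)" for T and a :: "(nat \<Rightarrow> complex) \<Rightarrow> complex"
    unfolding poly_of_def
    by (rule ext) (simp add: sum_distrib_left sum_distrib_right sum.swap[of _ "{..N}" T] mult.assoc)
  have F_scale: "(\<lambda>z. t * ?F a z) = ?F (\<lambda>n. t * a n)" for t a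
    by (rule ext) (simp add: poly_of_def sum_distrib_left mult.assoc)
  have eigsp: "eigsp (KN c R N) ?A t = {f. \<exists>a. f = (\<lambda>z. \<Sum>v\<in>{v\<in>S. l v = t}. a v * ?F v z)}" (is "_ = ?E t") for t
  proof (rule set_eqI, rule iffI)
    fix f assume f: "f \<in> eigsp (KN c R N) ?A t"
    then obtain a0 where a0: "f = ?F a0" by (auto simp: eigsp_def KN_eq)
    define a where "a n = (if n \<le> N then a0 n else 0)" for n
    have fa: "f = ?F a" unfolding a0 by (rule poly_of_cong) (simp add: a_def)
    have "?F (mat_app N entry a) = ?F (\<lambda>n. of_real t * a n)"
      using f unfolding eigsp_def fa by (simp add: compression_poly F_scale)
    hence Aa: "mat_app N entry a n = of_real t * a n" if "n \<le> N" for n using poly_eqD that by blast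
    have zero: "cip N a v = 0" if v: "v \<in> S" "l v \<noteq> t" for v
    proof -
      have "of_real t * cip N a v = cip N (mat_app N entry a) v"
        using Aa by (simp add: cip_def sum_distrib_left mult.assoc)
      also have "\<dots> = of_real (l v) * cip N a v"
        unfolding mat_app_self_adjoint[OF entry_hermitian] eig[OF v(1)] cip_scale_right by simp
      finally show ?thesis using v by simp
    qed
    have "f = ?F (\<lambda>n. \<Sum>v\<in>S. cip N a v * v n)"
      unfolding fa by (rule arg_cong[where f = ?F], rule cpl) (simp add: a_def)
    also have "\<dots> = ?F (\<lambda>n. \<Sum>v\<in>{v\<in>S. l v = t}. cip N a v * v n)"
      by (rule poly_of_cong, rule sum.mono_neutral_right) (use fin zero in auto)
    also have "\<dots> = (\<lambda>z. \<Sum>v\<in>{v\<in>S. l v = t}. cip N a v * ?F v z)" by (rule F_sum)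
    finally show "f \<in> ?E t" by blast
  next
    fix f assume "f \<in> ?E t"
    then obtain a where "f = (\<lambda>z. \<Sum>v\<in>{v\<in>S. l v = t}. a v * ?F v z)" by blast
    hence f: "f = ?F (\<lambda>n. \<Sum>v\<in>{v\<in>S. l v = t}. a v * v n)" unfolding F_sum .
    have "mat_app N entry (\<lambda>n. \<Sum>v\<in>{v\<in>S. l v = t}. a v * v n) m = of_real t * (\<Sum>v\<in>{v\<in>S. l v = t}. a v * v m)"
      if m: "m \<le> N" for m
    proof -
      have "mat_app N entry (\<lambda>n. \<Sum>v\<in>{v\<in>S. l v = t}. a v * v n) m = (\<Sum>v\<in>{v\<in>S. l v = t}. a v * mat_app N entry v m)"
        using m unfolding mat_app_def
        by (simp add: sum_distrib_left sum.swap[of _ "{..N}"] mult_ac)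
      also have "\<dots> = (\<Sum>v\<in>{v\<in>S. l v = t}. of_real t * (a v * v m))"
        by (intro sum.cong) (auto simp: eig)
      finally show ?thesis by (simp add: sum_distrib_left)
    qed
    hence "?A f = (\<lambda>z. of_real t * f z)"
      unfolding f compression_poly F_scale by (intro poly_of_cong)
    thus "f \<in> eigsp (KN c R N) ?A t" unfolding eigsp_def using f by (auto simp: KN_eq)
  qed
  have orthF: "orthonormal_on T M ?F" if "T \<subseteq> S" for T
    using that orth by (auto simp: orthonormal_on_def sq_integrable_poly inner_poly subset_iff)
  have eigvals: "eigvals (KN c R N) ?A = l ` S"
  proof (rule set_eqI, rule iffI)
    fix t assume "t \<in> eigvals (KN c R N) ?A"
    then obtain a where "(\<lambda>z. \<Sum>v\<in>{v\<in>S. l v = t}. a v * ?F v z) \<noteq> (\<lambda>z. 0)"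
      unfolding eigvals_def eigsp by auto
    hence "{v\<in>S. l v = t} \<noteq> {}" by (intro notI) (simp add: fun_eq_iff)
    thus "t \<in> l ` S" by auto
  next
    fix t assume "t \<in> l ` S"
    then obtain v where v: "v \<in> S" "t = l v" by blast
    have "?F v \<in> ?E t"
    proof -
      have "?F v = (\<lambda>z. \<Sum>u\<in>{u\<in>S. l u = t}. (if u = v then 1 else 0) * ?F u z)"
        using fin v by (simp add: if_distrib[of "\<lambda>x. x * _"] cong: if_cong)
      thus ?thesis by (intro CollectI exI)
    qed
    hence "?F v \<in> eigsp (KN c R N) ?A t" unfolding eigsp using v by simp
    moreover have "?F v \<noteq> (\<lambda>z. 0)"
    proof
      assume "?F v = (\<lambda>z. 0)"
      hence "cip N v v = 0" using inner_poly[of N v v] by (simp add: L2_inner_def)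
      thus False using orth[of v v] v by simp
    qed
    ultimately show "t \<in> eigvals (KN c R N) ?A" unfolding eigvals_def by blast
  qed
  have calc: "fun_calc M (KN c R N) \<psi> ?A f = (\<lambda>z. \<Sum>v\<in>S. (\<psi> (l v) * L2_inner M f (?F v)) * ?F v z)"
    if f: "sq_integrable M f" for f
  proof
    fix z
    have "fun_calc M (KN c R N) \<psi> ?A f z = (\<Sum>t\<in>l ` S. \<psi> t * (\<Sum>v\<in>{v\<in>S. l v = t}. L2_inner M f (?F v) * ?F v z))"
      unfolding fun_calc_def eigvals
      by (intro sum.cong refl arg_cong2[where f = "(*)"]
            fun_cong[OF orth_proj_orthonormal[OF _ orthF f eigsp]]) (use fin in auto)
    also have "\<dots> = (\<Sum>t\<in>l ` S. \<Sum>v\<in>{v\<in>S. l v = t}. (\<psi> (l v) * L2_inner M f (?F v)) * ?F v z)"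
      by (intro sum.cong refl) (auto simp: sum_distrib_left mult.assoc intro!: sum.cong)
    also have "\<dots> = (\<Sum>v\<in>S. (\<psi> (l v) * L2_inner M f (?F v)) * ?F v z)"
      by (rule sum.image_gen[OF fin, symmetric])
    finally show "fun_calc M (KN c R N) \<psi> ?A f z = (\<Sum>v\<in>S. (\<psi> (l v) * L2_inner M f (?F v)) * ?F v z)" .
  qed
  have inF: "L2_inner M (?F v) (e n) = v n" "L2_inner M (e n) (?F v) = cnj (v n)" if "n \<le> N" for v n
    using inner_poly_basis[OF that, of v] L2_inner_cnj[of M "?F v" "e n"] by simp_all
  have "trace_KN c w R N (fun_calc M (KN c R N) \<psi> ?A) = (\<Sum>n\<le>N. \<Sum>v\<in>S. \<psi> (l v) * (v n * cnj (v n)))"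
    unfolding trace_KN_def
  proof (intro sum.cong refl)
    fix n assume n: "n \<in> {..N}"
    have "L2_inner M (fun_calc M (KN c R N) \<psi> ?A (e n)) (e n) =
      (\<Sum>v\<in>S. (\<psi> (l v) * L2_inner M (e n) (?F v)) * L2_inner M (?F v) (e n))"
      unfolding calc[OF sq_integrable_mono_basis]
      by (rule L2_inner_lincomb_left) (intro sq_integrable_poly sq_integrable_mono_basis)+
    thus "L2_inner M (fun_calc M (KN c R N) \<psi> ?A (e n)) (e n) = (\<Sum>v\<in>S. \<psi> (l v) * (v n * cnj (v n)))"
      using n by (simp add: inF mult_ac)
  qed
  also have "\<dots> = (\<Sum>v\<in>S. \<psi> (l v) * cip N v v)"
    unfolding cip_def sum_distrib_left by (rule sum.swap)
  also have "\<dots> = (\<Sum>v\<in>S. \<psi> (l v))" using orth by simp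
  finally show ?thesis .
qed

end

section \<open>Traces and variances\<close>

context radial_symbol begin

lemma integrable_bounded_weight:
  fixes s :: "complex \<Rightarrow> complex"
  assumes s: "s \<in> borel_measurable M" and B: "\<And>z. z \<in> disc R \<Longrightarrow> cmod (s z) \<le> B"
    and f: "sq_integrable M f"
  shows "integrable M (\<lambda>z. s z * of_real ((cmod (f z))\<^sup>2))"
proof (rule Bochner_Integration.integrable_bound)
  show "integrable M (\<lambda>z. B * (cmod (f z))\<^sup>2)" using f by (simp add: sq_integrable_def)
  have [measurable]: "f \<in> borel_measurable M" using f by (rule sq_integrable_measurable)
  show "(\<lambda>z. s z * of_real ((cmod (f z))\<^sup>2)) \<in> borel_measurable M" using s by measurable
  show "AE z in M. norm (s z * of_real ((cmod (f z))\<^sup>2)) \<le> norm (B * (cmod (f z))\<^sup>2)"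
  proof (rule AE_I2)
    fix z assume "z \<in> space M"
    hence "cmod (s z) \<le> B" using B by simp
    hence "cmod (s z) * (cmod (f z))\<^sup>2 \<le> B * (cmod (f z))\<^sup>2" by (rule mult_right_mono) simp
    thus "norm (s z * of_real ((cmod (f z))\<^sup>2)) \<le> norm (B * (cmod (f z))\<^sup>2)"
      by (simp add: norm_mult norm_power)
  qed
qed

lemma integrable_bounded_weight_real:
  fixes s :: "complex \<Rightarrow> real"
  assumes s: "s \<in> borel_measurable M" and B: "\<And>z. z \<in> disc R \<Longrightarrow> \<bar>s z\<bar> \<le> B"
    and f: "sq_integrable M f"
  shows "integrable M (\<lambda>z. s z * (cmod (f z))\<^sup>2)"
proof -
  have "integrable M (\<lambda>z. complex_of_real (s z) * of_real ((cmod (f z))\<^sup>2))"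
    by (rule integrable_bounded_weight[OF _ _ f, where B = B]) (use s B in auto)
  thus ?thesis unfolding of_real_mult[symmetric] complex_of_real_integrable_eq .
qed

text \<open>The mean of \<open>\<phi>\<close> applied to the symbol under the probability measure with density \<open>\<bar>e n\<bar>\<^sup>2\<close>.\<close>

definition diag_mean :: "(real \<Rightarrow> complex) \<Rightarrow> nat \<Rightarrow> complex" where
  "diag_mean \<phi> n = (LINT z|M. \<phi> (\<sigma> z) * e n z * cnj (e n z))"

lemma diag_mean_weight: "diag_mean \<phi> n = (LINT z|M. \<phi> (\<sigma> z) * of_real ((cmod (e n z))\<^sup>2))"
  unfolding diag_mean_def complex_norm_square by (simp add: mult.assoc)

text \<open>By Parseval's identity the squared moduli of the monomials and of the eigenfunctions have the same sum at
  every point.\<close>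

lemma sum_diag_mean_eigenbasis:
  assumes eb: "eigenbasis N entry S l"
    and m: "(\<lambda>z. \<phi> (\<sigma> z)) \<in> borel_measurable M" and C: "\<And>x. x \<in> {lo..hi} \<Longrightarrow> cmod (\<phi> x) \<le> C"
  shows "(\<Sum>n\<le>N. diag_mean \<phi> n) = (\<Sum>v\<in>S. LINT z|M. \<phi> (\<sigma> z) * of_real ((cmod (poly_of N v z))\<^sup>2))"
proof -
  have C': "cmod (\<phi> (\<sigma> z)) \<le> C" if "z \<in> disc R" for z using C sigma_range[OF that] .
  have PQ: "(\<Sum>n\<le>N. (cmod (e n z))\<^sup>2) = (\<Sum>v\<in>S. (cmod (poly_of N v z))\<^sup>2)" for z
  proof -
    have "cmod (poly_of N v z) = cmod (cip N (\<lambda>n. cnj (e n z)) v)" for v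
    proof -
      have "poly_of N v z = cnj (cip N (\<lambda>n. cnj (e n z)) v)" by (simp add: poly_of_def cip_def mult.commute)
      thus ?thesis by simp
    qed
    thus ?thesis using parseval_cip[OF eb, of "\<lambda>n. cnj (e n z)"] by simp
  qed
  have "(\<Sum>n\<le>N. diag_mean \<phi> n) = (LINT z|M. (\<Sum>n\<le>N. \<phi> (\<sigma> z) * of_real ((cmod (e n z))\<^sup>2)))"
    unfolding diag_mean_weight
    by (rule Bochner_Integration.integral_sum[symmetric]) (intro integrable_bounded_weight[OF m C'] sq_integrable_mono_basis)
  also have "\<dots> = (LINT z|M. (\<Sum>v\<in>S. \<phi> (\<sigma> z) * of_real ((cmod (poly_of N v z))\<^sup>2)))"
    unfolding sum_distrib_left[symmetric] of_real_sum[symmetric] PQ ..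
  also have "\<dots> = (\<Sum>v\<in>S. LINT z|M. \<phi> (\<sigma> z) * of_real ((cmod (poly_of N v z))\<^sup>2))"
    by (rule Bochner_Integration.integral_sum) (intro integrable_bounded_weight[OF m C'] sq_integrable_poly)
  finally show ?thesis .
qed

text \<open>This is the sum, over an orthonormal eigenbasis \<open>f v\<close> of the compression, of the variances of the symbol under the densities \<open>\<bar>f v\<bar>\<^sup>2\<close>,
  written in terms of matrix entries for the symbols \<open>\<sigma>\<^sup>2\<close> and \<open>\<sigma>\<close>.\<close>

definition variance_sum :: "nat \<Rightarrow> real" where
  "variance_sum N = (\<Sum>n\<le>N. Re (diag_mean (\<lambda>x. of_real (x\<^sup>2)) n)) - (\<Sum>m\<le>N. \<Sum>n\<le>N. (cmod (entry m n))\<^sup>2)"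

text \<open>Let \<open>f v = poly_of N v\<close> for an eigenvector \<open>v\<close> of the matrix of entries. The eigenvalue \<open>l v\<close> is the mean of \<open>\<sigma>\<close> under the probability measure with density \<open>\<bar>f v\<bar>\<^sup>2\<close>, so the mean of
  \<open>(\<sigma> z - l v)\<^sup>2\<close> is a variance. Integrating the hypothesis on \<open>\<psi>\<close> with \<open>y = l v\<close> and summing over the
  eigenbasis gives the bound.\<close>

theorem trace_variance_bound:
  fixes \<psi> :: "real \<Rightarrow> complex"
  assumes m: "(\<lambda>z. \<psi> (\<sigma> z)) \<in> borel_measurable M" and C: "\<And>x. x \<in> {lo..hi} \<Longrightarrow> cmod (\<psi> x) \<le> C"
    and osc: "\<And>x y. x \<in> {lo..hi} \<Longrightarrow> y \<in> {lo..hi} \<Longrightarrow> cmod (\<psi> x - \<psi> y) \<le> \<epsilon> + K * (x - y)\<^sup>2"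
  shows "cmod ((\<Sum>n\<le>N. diag_mean \<psi> n) - trace_KN c w R N (fun_calc M (KN c R N) \<psi> (compression c w R \<sigma> N)))
    \<le> \<epsilon> * (real N + 1) + K * variance_sum N"
proof -
  obtain S l where eb: "eigenbasis N entry S l" using ex_eigenbasis[of N] by (elim exE)
  note fin = eigenbasisD(1)[OF eb] and orth = eigenbasisD(3)[OF eb] and eig = eigenbasisD(4)[OF eb]
  define P where "P v z = (cmod (poly_of N v z))\<^sup>2" for v z
  have P2: "sq_integrable M (poly_of N v)" for v by (rule sq_integrable_poly)
  have intP: "integrable M (P v)" for v using P2[of v] by (simp add: sq_integrable_def P_def[abs_def])
  have P0: "P v z \<ge> 0" for v z by (simp add: P_def)
  have P1: "(LINT z|M. P v z) = 1" if "v \<in> S" for v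
  proof -
    have "complex_of_real (LINT z|M. P v z) = 1"
      unfolding P_def L2_inner_self[symmetric] inner_poly using orth[OF that that] by simp
    thus ?thesis by simp
  qed
  let ?B = "\<bar>lo\<bar> + \<bar>hi\<bar>"
  have sB2: "\<bar>(\<sigma> z)\<^sup>2\<bar> \<le> ?B\<^sup>2" if "z \<in> disc R" for z
    using power_mono[OF sigma_bound[OF that], of 2] by simp
  have intsP: "integrable M (\<lambda>z. \<sigma> z * P v z)" for v
    unfolding P_def by (rule integrable_bounded_weight_real[OF _ sigma_bound P2]) auto
  have ints2P: "integrable M (\<lambda>z. (\<sigma> z)\<^sup>2 * P v z)" for v
    unfolding P_def by (rule integrable_bounded_weight_real[OF _ sB2 P2]) auto
  have intpP: "integrable M (\<lambda>z. \<psi> (\<sigma> z) * of_real (P v z))" for v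
    unfolding P_def by (rule integrable_bounded_weight[OF m C P2]) (use sigma_range in auto)
  have lP: "l v = (LINT z|M. \<sigma> z * P v z)" if v: "v \<in> S" for v
  proof -
    have "L2_inner M (\<lambda>z. of_real (\<sigma> z) * poly_of N v z) (poly_of N v) = (LINT z|M. of_real (\<sigma> z * P v z))"
      unfolding L2_inner_def P_def of_real_mult complex_norm_square by (simp add: mult.assoc)
    also have "\<dots> = of_real (LINT z|M. \<sigma> z * P v z)" by (rule integral_complex_of_real)
    finally have "of_real (LINT z|M. \<sigma> z * P v z) = of_real (l v) * cip N v v"
      unfolding inner_sigma_poly eig[OF v] cip_scale_left by simp
    thus ?thesis using orth[OF v v] by simp
  qed
  have l_range: "l v \<in> {lo..hi}" if v: "v \<in> S" for v
  proof -
    have "(LINT z|M. lo * P v z) \<le> (LINT z|M. \<sigma> z * P v z)"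
      using intP intsP sigma_range P0 by (intro integral_mono) (auto intro!: mult_right_mono)
    moreover have "(LINT z|M. \<sigma> z * P v z) \<le> (LINT z|M. hi * P v z)"
      using intP intsP sigma_range P0 by (intro integral_mono) (auto intro!: mult_right_mono)
    ultimately show ?thesis using P1[OF v] lP[OF v] by simp
  qed
  have summand: "cmod ((LINT z|M. \<psi> (\<sigma> z) * of_real (P v z)) - \<psi> (l v)) \<le> \<epsilon> + K * ((LINT z|M. (\<sigma> z)\<^sup>2 * P v z) - (l v)\<^sup>2)"
    if v: "v \<in> S" for v
  proof -
    have "(LINT z|M. \<psi> (l v) * of_real (P v z)) = \<psi> (l v)"
      using P1[OF v] by simp
    hence "(LINT z|M. \<psi> (\<sigma> z) * of_real (P v z)) - \<psi> (l v) =
       (LINT z|M. \<psi> (\<sigma> z) * of_real (P v z)) - (LINT z|M. \<psi> (l v) * of_real (P v z))" by simp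
    also have "\<dots> = (LINT z|M. (\<psi> (\<sigma> z) - \<psi> (l v)) * of_real (P v z))"
      unfolding left_diff_distrib by (rule Bochner_Integration.integral_diff[symmetric]) (use intpP intP in auto)
    finally have eq: "(LINT z|M. \<psi> (\<sigma> z) * of_real (P v z)) - \<psi> (l v) = (LINT z|M. (\<psi> (\<sigma> z) - \<psi> (l v)) * of_real (P v z))" .
    have "cmod (LINT z|M. (\<psi> (\<sigma> z) - \<psi> (l v)) * of_real (P v z)) \<le> (LINT z|M. \<epsilon> * P v z + K * ((\<sigma> z)\<^sup>2 * P v z - 2 * l v * (\<sigma> z * P v z) + (l v)\<^sup>2 * P v z))"
    proof (rule order_trans[OF integral_norm_bound], rule integral_mono)
      show "integrable M (\<lambda>z. cmod ((\<psi> (\<sigma> z) - \<psi> (l v)) * of_real (P v z)))"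
        unfolding left_diff_distrib using intpP intP by (intro integrable_norm Bochner_Integration.integrable_diff) auto
      show "integrable M (\<lambda>z. \<epsilon> * P v z + K * ((\<sigma> z)\<^sup>2 * P v z - 2 * l v * (\<sigma> z * P v z) + (l v)\<^sup>2 * P v z))"
        using intP intsP ints2P by auto
      fix z assume "z \<in> space M"
      hence "cmod (\<psi> (\<sigma> z) - \<psi> (l v)) \<le> \<epsilon> + K * (\<sigma> z - l v)\<^sup>2"
        using sigma_range l_range[OF v] by (intro osc) auto
      hence "cmod (\<psi> (\<sigma> z) - \<psi> (l v)) * P v z \<le> (\<epsilon> + K * (\<sigma> z - l v)\<^sup>2) * P v z"
        using P0 by (intro mult_right_mono)
      also have "\<dots> = \<epsilon> * P v z + K * ((\<sigma> z)\<^sup>2 * P v z - 2 * l v * (\<sigma> z * P v z) + (l v)\<^sup>2 * P v z)"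
        by (simp add: power2_diff algebra_simps)
      finally show "cmod ((\<psi> (\<sigma> z) - \<psi> (l v)) * of_real (P v z)) \<le>
         \<epsilon> * P v z + K * ((\<sigma> z)\<^sup>2 * P v z - 2 * l v * (\<sigma> z * P v z) + (l v)\<^sup>2 * P v z)"
        using P0 by (simp add: norm_mult)
    qed
    also have "\<dots> = \<epsilon> + K * ((LINT z|M. (\<sigma> z)\<^sup>2 * P v z) - 2 * l v * l v + (l v)\<^sup>2)"
    proof -
      note h = has_bochner_integral_integrable[OF intP[of v], unfolded P1[OF v]]
        has_bochner_integral_integrable[OF intsP[of v], folded lP[OF v]]
        has_bochner_integral_integrable[OF ints2P[of v]]
      have "has_bochner_integral M
          (\<lambda>z. \<epsilon> * P v z + K * ((\<sigma> z)\<^sup>2 * P v z - 2 * l v * (\<sigma> z * P v z) + (l v)\<^sup>2 * P v z))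
          (\<epsilon> * 1 + K * ((LINT z|M. (\<sigma> z)\<^sup>2 * P v z) - 2 * l v * l v + (l v)\<^sup>2 * 1))"
        by (intro has_bochner_integral_add has_bochner_integral_diff has_bochner_integral_mult_right h)
      thus ?thesis by (simp add: has_bochner_integral_integral_eq)
    qed
    finally show ?thesis unfolding eq by (simp add: power2_eq_square)
  qed
  have card: "(\<Sum>v\<in>S. (1::real)) = real N + 1"
  proof -
    have "(\<Sum>v\<in>S. (1::real)) = (\<Sum>v\<in>S. \<Sum>n\<le>N. (cmod (v n))\<^sup>2)"
    proof (rule sum.cong)
      fix v assume v: "v \<in> S"
      have "complex_of_real (\<Sum>n\<le>N. (cmod (v n))\<^sup>2) = 1" using orth[OF v v] unfolding cip_self by simp
      thus "1 = (\<Sum>n\<le>N. (cmod (v n))\<^sup>2)" by (metis of_real_eq_1_iff)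
    qed simp
    also have "\<dots> = (\<Sum>n\<le>N. \<Sum>v\<in>S. (cmod (v n))\<^sup>2)" by (rule sum.swap)
    also have "\<dots> = (\<Sum>n\<le>N. 1)"
    proof (rule sum.cong)
      fix n assume n: "n \<in> {..N}"
      let ?d = "\<lambda>k. if k = n then 1 else 0 :: complex"
      have "cip N ?d v = cnj (v n)" for v
        using n by (simp add: cip_def if_distrib[of "\<lambda>x. x * _"] cong: if_cong)
      hence "(\<Sum>v\<in>S. (cmod (v n))\<^sup>2) = (\<Sum>k\<le>N. (cmod (?d k))\<^sup>2)"
        using parseval_cip[OF eb, of ?d] by simp
      also have "\<dots> = (\<Sum>k\<le>N. if k = n then 1 else 0)" by (intro sum.cong) auto
      also have "\<dots> = 1" using n by simp
      finally show "(\<Sum>v\<in>S. (cmod (v n))\<^sup>2) = 1" .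
    qed simp
    finally show ?thesis by simp
  qed
  have sum_l2: "(\<Sum>v\<in>S. (l v)\<^sup>2) = (\<Sum>m\<le>N. \<Sum>n\<le>N. (cmod (entry m n))\<^sup>2)"
  proof -
    have "(l v)\<^sup>2 = (\<Sum>m\<le>N. (cmod (cip N (\<lambda>n. cnj (entry m n)) v))\<^sup>2)" if v: "v \<in> S" for v
    proof -
      have "complex_of_real (\<Sum>n\<le>N. (cmod (v n))\<^sup>2) = 1" using orth[OF v v] unfolding cip_self by simp
      hence v1: "(\<Sum>n\<le>N. (cmod (v n))\<^sup>2) = 1" by (metis of_real_eq_1_iff)
      have "cmod (cip N (\<lambda>n. cnj (entry m n)) v) = \<bar>l v\<bar> * cmod (v m)" if "m \<le> N" for m
      proof -
        have "cip N (\<lambda>n. cnj (entry m n)) v = cnj (mat_app N entry v m)"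
          using that by (simp add: cip_def mat_app_def)
        thus ?thesis by (simp add: eig[OF v] norm_mult)
      qed
      hence "(\<Sum>m\<le>N. (cmod (cip N (\<lambda>n. cnj (entry m n)) v))\<^sup>2) = (\<Sum>m\<le>N. (l v)\<^sup>2 * (cmod (v m))\<^sup>2)"
        by (intro sum.cong) (auto simp: power_mult_distrib)
      thus ?thesis using v1 by (simp add: sum_distrib_left[symmetric])
    qed
    hence "(\<Sum>v\<in>S. (l v)\<^sup>2) = (\<Sum>v\<in>S. \<Sum>m\<le>N. (cmod (cip N (\<lambda>n. cnj (entry m n)) v))\<^sup>2)"
      by (intro sum.cong) auto
    also have "\<dots> = (\<Sum>m\<le>N. \<Sum>v\<in>S. (cmod (cip N (\<lambda>n. cnj (entry m n)) v))\<^sup>2)" by (rule sum.swap)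
    also have "\<dots> = (\<Sum>m\<le>N. \<Sum>n\<le>N. (cmod (entry m n))\<^sup>2)"
      by (subst parseval_cip[OF eb]) auto
    finally show ?thesis .
  qed
  have sum_s2: "(\<Sum>v\<in>S. LINT z|M. (\<sigma> z)\<^sup>2 * P v z) = (\<Sum>n\<le>N. Re (diag_mean (\<lambda>x. of_real (x\<^sup>2)) n))"
  proof -
    have xB: "cmod (of_real (x\<^sup>2)) \<le> ?B\<^sup>2" if "x \<in> {lo..hi}" for x :: real
    proof -
      have "\<bar>x\<bar> \<le> ?B" using that by auto
      from power_mono[OF this, of 2] show ?thesis by (simp add: norm_power)
    qed
    have "(\<Sum>n\<le>N. diag_mean (\<lambda>x. of_real (x\<^sup>2)) n) = (\<Sum>v\<in>S. LINT z|M. of_real ((\<sigma> z)\<^sup>2) * of_real ((cmod (poly_of N v z))\<^sup>2))"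
      by (rule sum_diag_mean_eigenbasis[OF eb _ xB]) auto
    also have "\<dots> = of_real (\<Sum>v\<in>S. LINT z|M. (\<sigma> z)\<^sup>2 * P v z)"
      unfolding of_real_mult[symmetric] integral_complex_of_real P_def by simp
    finally have "Re (\<Sum>n\<le>N. diag_mean (\<lambda>x. of_real (x\<^sup>2)) n) = (\<Sum>v\<in>S. LINT z|M. (\<sigma> z)\<^sup>2 * P v z)" by simp
    thus ?thesis by simp
  qed
  have tr: "trace_KN c w R N (fun_calc M (KN c R N) \<psi> (compression c w R \<sigma> N)) = (\<Sum>v\<in>S. \<psi> (l v))"
    by (rule trace_fun_calc_eigenbasis[OF eb])
  have eq: "(\<Sum>n\<le>N. diag_mean \<psi> n) - trace_KN c w R N (fun_calc M (KN c R N) \<psi> (compression c w R \<sigma> N))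
     = (\<Sum>v\<in>S. (LINT z|M. \<psi> (\<sigma> z) * of_real (P v z)) - \<psi> (l v))"
  proof -
    have "(\<Sum>n\<le>N. diag_mean \<psi> n) = (\<Sum>v\<in>S. LINT z|M. \<psi> (\<sigma> z) * of_real (P v z))"
      unfolding P_def by (rule sum_diag_mean_eigenbasis[OF eb m C])
    thus ?thesis unfolding tr sum_subtractf by (rule arg_cong)
  qed
  have "cmod (\<Sum>v\<in>S. (LINT z|M. \<psi> (\<sigma> z) * of_real (P v z)) - \<psi> (l v)) \<le> (\<Sum>v\<in>S. \<epsilon> + K * ((LINT z|M. (\<sigma> z)\<^sup>2 * P v z) - (l v)\<^sup>2))"
    by (rule order_trans[OF norm_sum]) (intro sum_mono summand)
  also have "\<dots> = \<epsilon> * (\<Sum>v\<in>S. 1) + K * ((\<Sum>v\<in>S. LINT z|M. (\<sigma> z)\<^sup>2 * P v z) - (\<Sum>v\<in>S. (l v)\<^sup>2))"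
    by (simp add: sum.distrib sum_distrib_left[symmetric] sum_subtractf)
  also have "\<dots> = \<epsilon> * (real N + 1) + K * variance_sum N"
    unfolding card sum_s2 sum_l2 variance_sum_def ..
  finally show ?thesis unfolding eq .
qed

end

section \<open>Asymptotic negligibility of the variance\<close>

lemma cesaro_mean:
  fixes a :: "nat \<Rightarrow> 'a::real_normed_field"
  assumes "a \<longlonglongrightarrow> L"
  shows "(\<lambda>N. (\<Sum>n\<le>N. a n) / of_nat (N + 1)) \<longlonglongrightarrow> L"
proof (rule LIMSEQ_I)
  fix r :: real assume r: "r > 0"
  obtain n0 where n0: "\<And>n. n \<ge> n0 \<Longrightarrow> norm (a n - L) < r / 2"
    using LIMSEQ_D[OF assms, of "r / 2"] r by auto
  define C where "C = (\<Sum>n<n0. norm (a n - L))"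
  obtain N0 where N0: "real N0 > C / (r / 2)" using reals_Archimedean2 by blast
  have "norm ((\<Sum>n\<le>N. a n) / of_nat (N + 1) - L) < r" if N: "N \<ge> N0" for N
  proof -
    have "(\<Sum>n\<le>N. a n) / of_nat (N + 1) - L = (\<Sum>n\<le>N. a n - L) / of_nat (N + 1)"
      using of_nat_neq_0[of N, where 'a = 'a] by (simp add: sum_subtractf field_simps)
    hence "norm ((\<Sum>n\<le>N. a n) / of_nat (N + 1) - L) = norm (\<Sum>n\<le>N. a n - L) / real (N + 1)"
      by (simp only: norm_divide norm_of_nat)
    moreover have "norm (\<Sum>n\<le>N. a n - L) \<le> C + r / 2 * real (N + 1)"
    proof -
      have "norm (\<Sum>n\<le>N. a n - L) \<le> (\<Sum>n\<le>N. norm (a n - L))" by (rule norm_sum)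
      also have "\<dots> \<le> (\<Sum>n\<le>N. (if n < n0 then norm (a n - L) else 0) + r / 2)"
        using n0 r by (intro sum_mono) (auto simp: not_less less_imp_le)
      also have "\<dots> = (\<Sum>n\<in>{..N} \<inter> {..<n0}. norm (a n - L)) + r / 2 * real (N + 1)"
        by (simp add: sum.distrib sum.inter_restrict algebra_simps)
      also have "(\<Sum>n\<in>{..N} \<inter> {..<n0}. norm (a n - L)) \<le> C"
        unfolding C_def by (rule sum_mono2) auto
      finally show ?thesis by simp
    qed
    moreover have "C < r / 2 * real (N + 1)"
    proof -
      have "C < r / 2 * real N0" using N0 r by (simp add: field_simps)
      also have "\<dots> \<le> r / 2 * real (N + 1)" using N r by (intro mult_left_mono) auto
      finally show ?thesis .
    qed
    ultimately have "norm ((\<Sum>n\<le>N. a n) / of_nat (N + 1) - L) * real (N + 1) < r * real (N + 1)"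
      by (simp add: field_simps)
    thus ?thesis by (simp only: mult_less_cancel_right_pos of_nat_0_less_iff)
  qed
  thus "\<exists>no. \<forall>N\<ge>no. norm ((\<Sum>n\<le>N. a n) / of_nat (N + 1) - L) < r" by blast
qed

text \<open>Close points are covered by uniform continuity, and for points at distance at least \<open>d\<close> the bound
  \<open>2 C\<close> on the difference is absorbed by \<open>K d\<^sup>2\<close>.\<close>

lemma continuous_oscillation_bound:
  fixes \<psi> :: "real \<Rightarrow> complex"
  assumes cont: "continuous_on {a..b} \<psi>" and eps: "\<epsilon> > 0"
  obtains C K where "K \<ge> 0" "\<And>x. x \<in> {a..b} \<Longrightarrow> cmod (\<psi> x) \<le> C"
    "\<And>x y. x \<in> {a..b} \<Longrightarrow> y \<in> {a..b} \<Longrightarrow> cmod (\<psi> x - \<psi> y) \<le> \<epsilon> + K * (x - y)\<^sup>2"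
proof -
  have "bounded (\<psi> ` {a..b})"
    by (intro compact_imp_bounded compact_continuous_image cont) simp
  then obtain C where C0: "C > 0" and C': "\<forall>y\<in>\<psi> ` {a..b}. cmod y \<le> C" unfolding bounded_pos by blast
  have C: "cmod (\<psi> x) \<le> C" if "x \<in> {a..b}" for x using C' that by blast
  have "uniformly_continuous_on {a..b} \<psi>" by (intro compact_uniformly_continuous cont) simp
  then obtain d where d: "d > 0" "\<And>x y. x \<in> {a..b} \<Longrightarrow> y \<in> {a..b} \<Longrightarrow> dist y x < d \<Longrightarrow> dist (\<psi> y) (\<psi> x) < \<epsilon>"
    using eps unfolding uniformly_continuous_on_def by metis
  define K where "K = 2 * C / d\<^sup>2"
  have K: "K \<ge> 0" using C0 by (simp add: K_def)
  have "cmod (\<psi> x - \<psi> y) \<le> \<epsilon> + K * (x - y)\<^sup>2" if xy: "x \<in> {a..b}" "y \<in> {a..b}" for x y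
  proof (cases "\<bar>x - y\<bar> < d")
    case True
    hence "cmod (\<psi> x - \<psi> y) < \<epsilon>" using d(2)[OF xy(2,1)] by (simp add: dist_norm)
    moreover have "0 \<le> K * (x - y)\<^sup>2" using K by simp
    ultimately show ?thesis by linarith
  next
    case False
    have "cmod (\<psi> x - \<psi> y) \<le> 2 * C" using norm_triangle_ineq4[of "\<psi> x" "\<psi> y"] C[OF xy(1)] C[OF xy(2)] by linarith
    also have "2 * C = K * d\<^sup>2" using d by (simp add: K_def)
    also have "\<dots> \<le> K * (x - y)\<^sup>2"
    proof (intro mult_left_mono K)
      have "d\<^sup>2 \<le> \<bar>x - y\<bar>\<^sup>2" using False d by (intro power_mono) auto
      thus "d\<^sup>2 \<le> (x - y)\<^sup>2" by simp
    qed
    finally show ?thesis using eps by linarith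
  qed
  thus thesis using that[OF K C] by blast
qed

context radial_symbol begin

lemma lo_le_hi: "lo \<le> hi"
proof -
  have "0 \<in> disc R" using R_pos by (simp add: disc_def zero_ereal_def)
  from sigma_range[OF this] show ?thesis by simp
qed

text \<open>Retraction onto the range of the symbol. It extends functions on \<open>{lo..hi}\<close> continuously to the line and turns the radial
  limit, which lies in \<open>{lo..hi}\<close> only on almost every ray, into an everywhere bounded function.\<close>

definition clip :: "real \<Rightarrow> real" where "clip x = max lo (min hi x)"

lemma clip_range: "clip x \<in> {lo..hi}" using lo_le_hi by (auto simp: clip_def)

lemma clip_id: "x \<in> {lo..hi} \<Longrightarrow> clip x = x" by (auto simp: clip_def)

lemma continuous_clip: "continuous_on {lo..hi} \<phi> \<Longrightarrow> continuous_on UNIV (\<lambda>x. \<phi> (clip x))"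
  for \<phi> :: "real \<Rightarrow> complex"
  by (rule continuous_on_compose2[of "{lo..hi}"]) (use clip_range in \<open>auto simp: clip_def intro!: continuous_intros\<close>)

lemma measurable_continuous_symbol:
  fixes \<phi> :: "real \<Rightarrow> complex"
  assumes "continuous_on {lo..hi} \<phi>"
  shows "(\<lambda>z. \<phi> (\<sigma> z)) \<in> borel_measurable M"
proof -
  have "(\<lambda>z. \<phi> (clip (\<sigma> z))) \<in> borel_measurable M"
    by (rule borel_measurable_continuous_on[OF continuous_clip[OF assms] sigma_meas_M])
  thus ?thesis
    by (subst measurable_cong[of _ _ "\<lambda>z. \<phi> (clip (\<sigma> z))"]) (use sigma_range in \<open>auto simp: clip_id\<close>)
qed

lemma continuous_symbol_limit:
  fixes \<phi> :: "real \<Rightarrow> complex"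
  assumes lim: "has_radial_limit R \<sigma> \<sigma>'" and cont: "continuous_on {lo..hi} \<phi>"
  shows "(\<lambda>\<theta>. \<phi> (clip (\<sigma>' \<theta>))) \<in> borel_measurable (lebesgue_on {0..2 * pi})"
    and "(\<lambda>n. LINT z|M. \<phi> (\<sigma> z) * e (n + i) z * cnj (e (n + j) z)) \<longlonglongrightarrow>
      (LINT \<theta>|lebesgue_on {0..2 * pi}. \<phi> (clip (\<sigma>' \<theta>)) * cis ((real i - real j) * \<theta>)) / of_real (2 * pi)"
proof -
  obtain C where C: "\<And>x. x \<in> {lo..hi} \<Longrightarrow> cmod (\<phi> x) \<le> C"
    using continuous_oscillation_bound[OF cont zero_less_one] by metis
  have cont': "continuous_on UNIV (\<lambda>x. \<phi> (clip x))" by (rule continuous_clip[OF cont])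
  have m: "(\<lambda>z. \<phi> (clip (\<sigma> z))) \<in> borel_measurable (lebesgue_on (disc R))"
    by (rule borel_measurable_continuous_on[OF cont' sigma_meas])
  have b: "cmod (\<phi> (clip (\<sigma> z))) \<le> C" for z using C clip_range by blast
  have l: "AE \<theta> in lebesgue. \<theta> \<in> {0..<2 * pi} \<longrightarrow> ((\<lambda>r. \<phi> (clip (\<sigma> (rcis r \<theta>)))) \<longlongrightarrow> \<phi> (clip (\<sigma>' \<theta>))) (to_radius R)"
    using lim unfolding has_radial_limit_def
  proof eventually_elim
    case (elim \<theta>)
    have "isCont (\<lambda>x. \<phi> (clip x)) (\<sigma>' \<theta>)" using cont' by (simp add: continuous_on_eq_continuous_at)
    thus ?case using elim by (auto intro: isCont_tendsto_compose)
  qed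
  show "(\<lambda>\<theta>. \<phi> (clip (\<sigma>' \<theta>))) \<in> borel_measurable (lebesgue_on {0..2 * pi})"
    by (rule matrix_entry_limit(1)[OF m b l])
  have eq: "(LINT z|M. \<phi> (clip (\<sigma> z)) * e n z * cnj (e k z)) = (LINT z|M. \<phi> (\<sigma> z) * e n z * cnj (e k z))" for n k
    by (rule Bochner_Integration.integral_cong) (use sigma_range in \<open>auto simp: clip_id\<close>)
  show "(\<lambda>n. LINT z|M. \<phi> (\<sigma> z) * e (n + i) z * cnj (e (n + j) z)) \<longlonglongrightarrow>
      (LINT \<theta>|lebesgue_on {0..2 * pi}. \<phi> (clip (\<sigma>' \<theta>)) * cis ((real i - real j) * \<theta>)) / of_real (2 * pi)"
    using matrix_entry_limit(2)[OF m b l, of i j] unfolding eq .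
qed

lemma diag_mean_limit:
  fixes \<phi> :: "real \<Rightarrow> complex"
  assumes lim: "has_radial_limit R \<sigma> \<sigma>'" and cont: "continuous_on {lo..hi} \<phi>"
  shows "(\<lambda>n. diag_mean \<phi> n) \<longlonglongrightarrow> (LINT \<theta>|lebesgue_on {0..2 * pi}. \<phi> (clip (\<sigma>' \<theta>))) / of_real (2 * pi)"
  using continuous_symbol_limit(2)[OF lim cont, of 0 0] by (simp add: diag_mean_def)

lemma column_energy_bound:
  "Re (diag_mean (\<lambda>x. of_real (x\<^sup>2)) n) \<le> (\<bar>lo\<bar> + \<bar>hi\<bar>)\<^sup>2"
proof -
  let ?B = "\<bar>lo\<bar> + \<bar>hi\<bar>"
  have sB2: "\<bar>(\<sigma> z)\<^sup>2\<bar> \<le> ?B\<^sup>2" if "z \<in> disc R" for z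
    using power_mono[OF sigma_bound[OF that], of 2] by simp
  have i: "integrable M (\<lambda>z. (\<sigma> z)\<^sup>2 * (cmod (e n z))\<^sup>2)"
    by (rule integrable_bounded_weight_real[OF _ sB2 sq_integrable_mono_basis]) auto
  have i1: "integrable M (\<lambda>z. (cmod (e n z))\<^sup>2)" using sq_integrable_mono_basis by (simp add: sq_integrable_def)
  have "diag_mean (\<lambda>x. of_real (x\<^sup>2)) n = of_real (LINT z|M. (\<sigma> z)\<^sup>2 * (cmod (e n z))\<^sup>2)"
    unfolding diag_mean_weight of_real_mult[symmetric] integral_complex_of_real ..
  hence "Re (diag_mean (\<lambda>x. of_real (x\<^sup>2)) n) = (LINT z|M. (\<sigma> z)\<^sup>2 * (cmod (e n z))\<^sup>2)" by simp
  also have "\<dots> \<le> (LINT z|M. ?B\<^sup>2 * (cmod (e n z))\<^sup>2)"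
    using i i1 sB2 by (intro integral_mono) (auto intro!: mult_right_mono)
  also have "\<dots> = ?B\<^sup>2 * 1"
  proof -
    have "complex_of_real (LINT z|M. (cmod (e n z))\<^sup>2) = 1"
      unfolding L2_inner_self[symmetric] inner_mono_basis by simp
    hence "(LINT z|M. (cmod (e n z))\<^sup>2) = 1" by simp
    thus ?thesis by simp
  qed
  finally show ?thesis by simp
qed

lemma entry_limit:
  assumes lim: "has_radial_limit R \<sigma> \<sigma>'"
  shows "(\<lambda>n. entry (n + j) (n + i)) \<longlonglongrightarrow>
      (LINT \<theta>|lebesgue_on {0..2 * pi}. of_real (clip (\<sigma>' \<theta>)) * cis ((real i - real j) * \<theta>)) / of_real (2 * pi)"
  unfolding entry_def
  by (rule continuous_symbol_limit(2)[OF lim]) (intro continuous_intros)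

end

lemma integral_cis_circle:
  "(LINT \<theta>|lebesgue_on {0..2 * pi}. cis ((real i - real k) * \<theta>)) = (if i = k then of_real (2 * pi) else 0)"
proof -
  have m: "(\<lambda>\<theta>. cis (of_int (int i - int k) * \<theta>)) \<in> borel_measurable borel"
    by (intro borel_measurable_continuous_onI continuous_intros)
  have "(if int i - int k = 0 then 1 else 0) = (LINT \<theta>|lebesgue_on {0..2 * pi}. cis (of_int (int i - int k) * \<theta>)) /\<^sub>R (2 * pi)"
    unfolding integral_cis_angle_measure[symmetric] by (rule integral_angle_measure[OF m])
  thus ?thesis by (simp add: scaleR_conv_of_real field_simps split: if_splits)
qed

lemma trig_poly_sum:
  "trig_poly J p \<theta> = (\<Sum>i\<le>degree p. coeff p i * cis ((real i - real J) * \<theta>))"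
proof -
  have "cis (- (real J * \<theta>)) * cis \<theta> ^ i = cis ((real i - real J) * \<theta>)" for i
    by (simp add: Complex.DeMoivre cis_mult algebra_simps)
  thus ?thesis unfolding trig_poly_def poly_altdef sum_distrib_left
    by (intro sum.cong refl) (simp add: mult.left_commute)
qed

text \<open>For \<open>x\<close> the radial limit, its mean square and its Fourier coefficients on the right are limits of
  diagonal means and of matrix entries, up to the factor \<open>2 * pi\<close>; this is how the distance enters the estimate of the variance.\<close>

lemma trig_poly_distance_identity:
  fixes x :: "real \<Rightarrow> real"
  assumes x: "x \<in> borel_measurable (lebesgue_on {0..2 * pi})" and B: "\<And>\<theta>. \<bar>x \<theta>\<bar> \<le> B"
  shows "(LINT \<theta>|lebesgue_on {0..2 * pi}. (cmod (of_real (x \<theta>) - trig_poly J p \<theta>))\<^sup>2) =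
     (LINT \<theta>|lebesgue_on {0..2 * pi}. (x \<theta>)\<^sup>2) + (\<Sum>i\<le>degree p. 2 * pi * (cmod (coeff p i))\<^sup>2
       - 2 * Re (cnj (coeff p i) * (LINT \<theta>|lebesgue_on {0..2 * pi}. of_real (x \<theta>) * cis ((real J - real i) * \<theta>))))"
proof -
  let ?U = "lebesgue_on {0..2 * pi}"
  interpret U: finite_measure ?U by (rule finite_measure_lebesgue_on) auto
  let ?D = "{..degree p}"
  have cis_meas: "(\<lambda>\<theta>. cis (t * \<theta>)) \<in> borel_measurable ?U" for t :: real
  proof -
    have "(\<lambda>\<theta>. cis (t * \<theta>)) \<in> borel_measurable borel"
      by (intro borel_measurable_continuous_onI continuous_intros)
    thus ?thesis by (auto intro!: measurable_restrict_space1 measurable_completion)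
  qed
  have x_meas: "(\<lambda>\<theta>. complex_of_real (x \<theta>)) \<in> borel_measurable ?U" using x by measurable
  have int_cis: "integrable ?U (\<lambda>\<theta>. cis (t * \<theta>))" for t :: real
    by (rule U.integrable_const_bound[of _ 1]) (use cis_meas in auto)
  have int_xc: "integrable ?U (\<lambda>\<theta>. of_real (x \<theta>) * cis (t * \<theta>))" for t :: real
    by (rule U.integrable_const_bound[of _ B]) (use cis_meas x_meas B in \<open>auto simp: norm_mult\<close>)
  have int_x2: "integrable ?U (\<lambda>\<theta>. (x \<theta>)\<^sup>2)"
  proof (rule U.integrable_const_bound[of _ "B\<^sup>2"])
    show "AE \<theta> in ?U. norm ((x \<theta>)\<^sup>2) \<le> B\<^sup>2"
      using power_mono[OF B abs_ge_zero, of _ 2] by (intro AE_I2) simp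
  qed (use x in measurable)
  have cnj_q: "cnj (trig_poly J p \<theta>) = (\<Sum>i\<in>?D. cnj (coeff p i) * cis ((real J - real i) * \<theta>))" for \<theta>
    unfolding trig_poly_sum by (simp add: cis_cnj algebra_simps)
  have q2: "complex_of_real ((cmod (trig_poly J p \<theta>))\<^sup>2) =
      (\<Sum>i\<in>?D. \<Sum>k\<in>?D. coeff p i * cnj (coeff p k) * cis ((real i - real k) * \<theta>))" for \<theta>
  proof -
    have "cis ((real i - real J) * \<theta>) * cis ((real J - real k) * \<theta>) = cis ((real i - real k) * \<theta>)" for i k
      by (simp add: cis_mult algebra_simps)
    thus ?thesis unfolding complex_norm_square cnj_q unfolding trig_poly_sum
      by (simp add: sum_product mult_ac)
  qed
  have hq: "has_bochner_integral ?U (\<lambda>\<theta>. complex_of_real ((cmod (trig_poly J p \<theta>))\<^sup>2))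
      (complex_of_real (\<Sum>i\<in>?D. 2 * pi * (cmod (coeff p i))\<^sup>2))"
  proof -
    have "has_bochner_integral ?U (\<lambda>\<theta>. complex_of_real ((cmod (trig_poly J p \<theta>))\<^sup>2))
      (\<Sum>i\<in>?D. \<Sum>k\<in>?D. coeff p i * cnj (coeff p k) * (if i = k then of_real (2 * pi) else 0))"
      unfolding q2 integral_cis_circle[symmetric]
      by (intro has_bochner_integral_sum has_bochner_integral_mult_right has_bochner_integral_integrable int_cis)
    also have "(\<Sum>i\<in>?D. \<Sum>k\<in>?D. coeff p i * cnj (coeff p k) * (if i = k then of_real (2 * pi) else 0))
       = (\<Sum>i\<in>?D. of_real (2 * pi) * (coeff p i * cnj (coeff p i)))"
      by (intro sum.cong refl) (simp add: if_distrib[of "\<lambda>y. _ * y"] cong: if_cong)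
    also have "\<dots> = complex_of_real (\<Sum>i\<in>?D. 2 * pi * (cmod (coeff p i))\<^sup>2)"
      unfolding of_real_sum of_real_mult complex_norm_square ..
    finally show ?thesis .
  qed
  have hq': "has_bochner_integral ?U (\<lambda>\<theta>. (cmod (trig_poly J p \<theta>))\<^sup>2) (\<Sum>i\<in>?D. 2 * pi * (cmod (coeff p i))\<^sup>2)"
    using has_bochner_integral_Re[OF hq] by simp
  have hc: "has_bochner_integral ?U (\<lambda>\<theta>. of_real (x \<theta>) * cnj (trig_poly J p \<theta>))
     (\<Sum>i\<in>?D. cnj (coeff p i) * (LINT \<theta>|?U. of_real (x \<theta>) * cis ((real J - real i) * \<theta>)))"
  proof -
    have "(\<lambda>\<theta>. of_real (x \<theta>) * cnj (trig_poly J p \<theta>)) =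
       (\<lambda>\<theta>. \<Sum>i\<in>?D. cnj (coeff p i) * (of_real (x \<theta>) * cis ((real J - real i) * \<theta>)))"
      unfolding cnj_q by (simp add: sum_distrib_left mult_ac)
    thus ?thesis
      by (simp only:) (intro has_bochner_integral_sum has_bochner_integral_mult_right has_bochner_integral_integrable int_xc)
  qed
  have pt: "(cmod (of_real (x \<theta>) - trig_poly J p \<theta>))\<^sup>2 =
      (x \<theta>)\<^sup>2 + ((cmod (trig_poly J p \<theta>))\<^sup>2 - 2 * Re (of_real (x \<theta>) * cnj (trig_poly J p \<theta>)))" for \<theta>
    unfolding cmod_power2 by (simp add: power2_eq_square algebra_simps)
  have "has_bochner_integral ?U (\<lambda>\<theta>. (cmod (of_real (x \<theta>) - trig_poly J p \<theta>))\<^sup>2)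
     ((LINT \<theta>|?U. (x \<theta>)\<^sup>2) + ((\<Sum>i\<in>?D. 2 * pi * (cmod (coeff p i))\<^sup>2) -
       2 * Re (\<Sum>i\<in>?D. cnj (coeff p i) * (LINT \<theta>|?U. of_real (x \<theta>) * cis ((real J - real i) * \<theta>)))))"
    unfolding pt
    by (intro has_bochner_integral_add has_bochner_integral_diff has_bochner_integral_mult_right hq'
         has_bochner_integral_integrable[OF int_x2] has_bochner_integral_Re[OF hc])
  hence "(LINT \<theta>|?U. (cmod (of_real (x \<theta>) - trig_poly J p \<theta>))\<^sup>2) =
     (LINT \<theta>|?U. (x \<theta>)\<^sup>2) + ((\<Sum>i\<in>?D. 2 * pi * (cmod (coeff p i))\<^sup>2) -
       2 * Re (\<Sum>i\<in>?D. cnj (coeff p i) * (LINT \<theta>|?U. of_real (x \<theta>) * cis ((real J - real i) * \<theta>))))"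
    by (rule has_bochner_integral_integral_eq)
  thus ?thesis by (simp only: sum_subtractf Re_sum sum_distrib_left)
qed

context radial_symbol begin

text \<open>Column \<open>n = m + J\<close> contributes \<open>b n - (\<Sum>k\<le>N. \<bar>entry k n\<bar>\<^sup>2)\<close>. For every complex number \<open>a\<close> one has
  \<open>\<bar>entry k n\<bar>\<^sup>2 \<ge> 2 Re (cnj a * entry k n) - \<bar>a\<bar>\<^sup>2\<close>; with the coefficients of a trigonometric polynomial as \<open>a\<close>, in
  the rows \<open>k = m + i\<close>, the contribution is at most \<open>d m\<close>. The sequence \<open>d\<close> tends to the mean squared distance between that polynomial
  and the radial limit, which is as small as desired. The boundedly many columns near the ends do not affect the average.\<close>

theorem variance_sum_small:
  assumes lim: "has_radial_limit R \<sigma> \<sigma>'" and \<delta>: "\<delta> > 0"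
  shows "eventually (\<lambda>N. variance_sum N / (real N + 1) < \<delta>) sequentially"
proof -
  let ?U = "lebesgue_on {0..2 * pi}"
  define x where "x \<theta> = clip (\<sigma>' \<theta>)" for \<theta>
  define B where "B = \<bar>lo\<bar> + \<bar>hi\<bar>"
  have xB: "\<bar>x \<theta>\<bar> \<le> B" for \<theta> using clip_range[of "\<sigma>' \<theta>"] by (auto simp: x_def B_def)
  have "(\<lambda>\<theta>. complex_of_real (x \<theta>)) \<in> borel_measurable ?U"
    unfolding x_def by (rule continuous_symbol_limit(1)[OF lim]) (intro continuous_intros)
  from measurable_compose[OF this borel_measurable_Re] have x_meas: "x \<in> borel_measurable ?U" by simp
  obtain J p where Jp: "(LINT \<theta>|?U. (cmod (of_real (x \<theta>) - trig_poly J p \<theta>))\<^sup>2) < \<delta> * (2 * pi)"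
    using trig_poly_L2_dense[OF x_meas xB, of "\<delta> * (2 * pi)"] \<delta> by auto
  define b where "b n = Re (diag_mean (\<lambda>x. of_real (x\<^sup>2)) n)" for n
  define X where "X i = (LINT \<theta>|?U. of_real (x \<theta>) * cis ((real J - real i) * \<theta>))" for i
  let ?D = "{..degree p}"
  define d where "d m = b (m + J) + (\<Sum>i\<in>?D. (cmod (coeff p i))\<^sup>2 - 2 * Re (cnj (coeff p i) * entry (m + i) (m + J)))" for m
  define D where "D = (LINT \<theta>|?U. (cmod (of_real (x \<theta>) - trig_poly J p \<theta>))\<^sup>2) / (2 * pi)"
  have D\<delta>: "D < \<delta>" using Jp by (simp add: D_def field_simps)
  have b_lim: "b \<longlonglongrightarrow> (LINT \<theta>|?U. (x \<theta>)\<^sup>2) / (2 * pi)"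
  proof -
    have "(\<lambda>n. diag_mean (\<lambda>x. of_real (x\<^sup>2)) n) \<longlonglongrightarrow> (LINT \<theta>|?U. complex_of_real ((x \<theta>)\<^sup>2)) / of_real (2 * pi)"
      unfolding x_def by (rule diag_mean_limit[OF lim]) (intro continuous_intros)
    from tendsto_Re[OF this] show ?thesis
      unfolding b_def integral_complex_of_real of_real_divide[symmetric] by simp
  qed
  have d_lim: "d \<longlonglongrightarrow> D"
  proof -
    have "d \<longlonglongrightarrow> (LINT \<theta>|?U. (x \<theta>)\<^sup>2) / (2 * pi) +
       (\<Sum>i\<in>?D. (cmod (coeff p i))\<^sup>2 - 2 * Re (cnj (coeff p i) * (X i / of_real (2 * pi))))"
      unfolding d_def X_def x_def
      by (intro tendsto_intros entry_limit[OF lim] LIMSEQ_ignore_initial_segment[OF b_lim[unfolded x_def]])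
    also have "(LINT \<theta>|?U. (x \<theta>)\<^sup>2) / (2 * pi) +
       (\<Sum>i\<in>?D. (cmod (coeff p i))\<^sup>2 - 2 * Re (cnj (coeff p i) * (X i / of_real (2 * pi)))) = D"
    proof -
      have "Re (cnj (coeff p i) * (X i / of_real (2 * pi))) = Re (cnj (coeff p i) * X i) / (2 * pi)" for i
        by (simp only: times_divide_eq_right Re_divide_of_real)
      thus ?thesis
        unfolding D_def trig_poly_distance_identity[OF x_meas xB] X_def[symmetric]
        by (simp add: add_divide_distrib sum_divide_distrib diff_divide_distrib)
    qed
    finally show ?thesis .
  qed
  \<comment> \<open>\<open>g\<close> bounds the contribution of column \<open>n\<close> unless \<open>n\<close> is within \<open>degree p\<close> of \<open>N\<close>. In the first \<open>J\<close> columns,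
    where the lowest frequency would need a negative row index, it is the trivial bound.\<close>
  define g where "g n = (if n < J then B\<^sup>2 else d (n - J))" for n
  have g_lim: "g \<longlonglongrightarrow> D"
  proof (rule LIMSEQ_offset[of _ J])
    show "(\<lambda>n. g (n + J)) \<longlonglongrightarrow> D" using d_lim by (simp add: g_def)
  qed
  obtain G0 where G0: "\<And>n. \<bar>g n\<bar> \<le> G0"
    using convergent_imp_Bseq[OF convergentI[OF g_lim]] unfolding Bseq_def by auto
  define G where "G = B\<^sup>2 + G0"
  have bB: "b n \<le> B\<^sup>2" for n unfolding b_def B_def by (rule column_energy_bound)
  define t where "t N n = b n - (\<Sum>m\<le>N. (cmod (entry m n))\<^sup>2)" for N n
  have tb: "t N n \<le> b n" for N n unfolding t_def by (simp add: sum_nonneg)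
  have key: "t N n \<le> g n + (if N < n + degree p then G else 0)" for N n
  proof (cases "n < J \<or> N < n + degree p")
    case True
    thus ?thesis
    proof
      assume "n < J"
      hence "g n = B\<^sup>2" by (simp add: g_def)
      moreover have "G \<ge> 0" using G0[of 0] by (simp add: G_def)
      ultimately show ?thesis using tb[of N n] bB[of n] by (auto split: if_split)
    next
      assume "N < n + degree p"
      thus ?thesis using tb[of N n] bB[of n] G0[of n] by (simp add: G_def)
    qed
  next
    case False
    define m where "m = n - J"
    have n: "n = m + J" and mN: "m + degree p \<le> N" using False by (auto simp: m_def)
    have "(\<Sum>i\<in>?D. 2 * Re (cnj (coeff p i) * entry (m + i) n) - (cmod (coeff p i))\<^sup>2) \<le> (\<Sum>i\<in>?D. (cmod (entry (m + i) n))\<^sup>2)"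
    proof (rule sum_mono)
      fix i
      have "0 \<le> (cmod (entry (m + i) n - coeff p i))\<^sup>2" by simp
      also have "\<dots> = (cmod (entry (m + i) n))\<^sup>2 - 2 * Re (cnj (coeff p i) * entry (m + i) n) + (cmod (coeff p i))\<^sup>2"
        unfolding cmod_power2 by (simp add: power2_eq_square algebra_simps)
      finally show "2 * Re (cnj (coeff p i) * entry (m + i) n) - (cmod (coeff p i))\<^sup>2 \<le> (cmod (entry (m + i) n))\<^sup>2" by simp
    qed
    also have "\<dots> = (\<Sum>k\<in>(\<lambda>i. m + i) ` ?D. (cmod (entry k n))\<^sup>2)"
      by (subst sum.reindex) auto
    also have "\<dots> \<le> (\<Sum>k\<le>N. (cmod (entry k n))\<^sup>2)"
      using mN by (intro sum_mono2) auto
    finally have "t N n \<le> d m"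
      unfolding t_def d_def n[symmetric] sum_subtractf by simp
    also have "d m = g n" using False by (simp add: g_def m_def)
    finally show ?thesis using False by simp
  qed
  have var: "variance_sum N = (\<Sum>n\<le>N. t N n)" for N
    unfolding variance_sum_def t_def b_def sum_subtractf by (subst sum.swap) simp
  have bound: "variance_sum N / (real N + 1) \<le> (\<Sum>n\<le>N. g n) / of_nat (N + 1) + (real (degree p) * G) / (real N + 1)" for N
  proof -
    have "variance_sum N \<le> (\<Sum>n\<le>N. g n + (if N < n + degree p then G else 0))"
      unfolding var by (intro sum_mono key)
    also have "\<dots> = (\<Sum>n\<le>N. g n) + (\<Sum>n\<in>{n\<in>{..N}. N < n + degree p}. G)"
      unfolding sum.distrib by (simp only: sum.inter_filter finite_atMost)
    also have "(\<Sum>n\<in>{n\<in>{..N}. N < n + degree p}. G) \<le> real (degree p) * G"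
    proof -
      have "{n\<in>{..N}. N < n + degree p} \<subseteq> {N + 1 - degree p..<N + 1}" by auto
      hence "card {n\<in>{..N}. N < n + degree p} \<le> card {N + 1 - degree p..<N + 1}"
        by (intro card_mono) auto
      also have "\<dots> \<le> degree p" by simp
      finally show ?thesis using G0[of 0] by (simp add: G_def mult_right_mono)
    qed
    finally have "variance_sum N \<le> (\<Sum>n\<le>N. g n) + real (degree p) * G" by simp
    from divide_right_mono[OF this, of "real N + 1"] show ?thesis by (simp add: add_divide_distrib add.commute)
  qed
  have "(\<lambda>N. (\<Sum>n\<le>N. g n) / of_nat (N + 1) + (real (degree p) * G) / (real N + 1)) \<longlonglongrightarrow> D + 0"
  proof (intro tendsto_add cesaro_mean g_lim)
    have "(\<lambda>N. (real (degree p) * G) / real (Suc N)) \<longlonglongrightarrow> 0"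
      by (rule LIMSEQ_Suc[OF lim_const_over_n])
    thus "(\<lambda>N. (real (degree p) * G) / (real N + 1)) \<longlonglongrightarrow> 0" by (simp add: add.commute)
  qed
  hence "eventually (\<lambda>N. (\<Sum>n\<le>N. g n) / of_nat (N + 1) + (real (degree p) * G) / (real N + 1) < \<delta>) sequentially"
    using D\<delta> by (intro order_tendstoD(2)) auto
  thus ?thesis by eventually_elim (use bound le_less_trans in blast)
qed

text \<open>The diagonal averages have the right limit, and their difference from the normalised traces is at most
  \<open>\<eta> / 2\<close> plus a fixed multiple of the normalised variance.\<close>

theorem spectral_average_limit:
  assumes lim: "has_radial_limit R \<sigma> \<sigma>'" and cont: "continuous_on {lo..hi} \<psi>"
  shows "(\<lambda>N. trace_KN c w R N (fun_calc M (KN c R N) \<psi> (compression c w R \<sigma> N)) / of_nat (N + 1))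
    \<longlonglongrightarrow> (LINT \<theta>|lebesgue_on {0..2 * pi}. \<psi> (clip (\<sigma>' \<theta>))) / of_real (2 * pi)"
proof -
  define tr where "tr N = trace_KN c w R N (fun_calc M (KN c R N) \<psi> (compression c w R \<sigma> N))" for N
  define A where "A N = (\<Sum>n\<le>N. diag_mean \<psi> n)" for N
  let ?L = "(LINT \<theta>|lebesgue_on {0..2 * pi}. \<psi> (clip (\<sigma>' \<theta>))) / of_real (2 * pi)"
  have A_lim: "(\<lambda>N. A N / of_nat (N + 1)) \<longlonglongrightarrow> ?L"
    unfolding A_def by (rule cesaro_mean[OF diag_mean_limit[OF lim cont]])
  have diff: "(\<lambda>N. A N / of_nat (N + 1) - tr N / of_nat (N + 1)) \<longlonglongrightarrow> 0"
  proof (rule LIMSEQ_I)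
    fix \<eta> :: real assume \<eta>: "\<eta> > 0"
    obtain C K where K: "K \<ge> 0" and C: "\<And>x. x \<in> {lo..hi} \<Longrightarrow> cmod (\<psi> x) \<le> C"
      and osc: "\<And>x y. x \<in> {lo..hi} \<Longrightarrow> y \<in> {lo..hi} \<Longrightarrow> cmod (\<psi> x - \<psi> y) \<le> \<eta> / 2 + K * (x - y)\<^sup>2"
      using continuous_oscillation_bound[OF cont half_gt_zero[OF \<eta>]] by metis
    have "\<eta> / (2 * (K + 1)) > 0" using \<eta> K by simp
    from variance_sum_small[OF lim this]
    obtain N0 where N0: "\<And>N. N \<ge> N0 \<Longrightarrow> variance_sum N / (real N + 1) < \<eta> / (2 * (K + 1))"
      unfolding eventually_sequentially by blast
    have "cmod (A N / of_nat (N + 1) - tr N / of_nat (N + 1)) < \<eta>" if N: "N \<ge> N0" for N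
    proof -
      have "cmod (A N / of_nat (N + 1) - tr N / of_nat (N + 1)) = cmod (A N - tr N) / (real N + 1)"
        unfolding diff_divide_distrib[symmetric] norm_divide norm_of_nat by simp
      also have "cmod (A N - tr N) \<le> \<eta> / 2 * (real N + 1) + K * variance_sum N"
        unfolding A_def tr_def by (rule trace_variance_bound[OF measurable_continuous_symbol[OF cont] C osc])
      also have "(\<eta> / 2 * (real N + 1) + K * variance_sum N) / (real N + 1) = \<eta> / 2 + K * (variance_sum N / (real N + 1))"
      proof -
        have "real N + 1 \<noteq> 0" using of_nat_0_le_iff[of N] by linarith
        moreover have "(a * n + b) / n = a + b / n" if "n \<noteq> 0" for a b n :: real
          using that by (simp add: field_simps)
        ultimately show ?thesis by (simp only: times_divide_eq_right)
      qed
      also have "\<dots> \<le> \<eta> / 2 + K * (\<eta> / (2 * (K + 1)))"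
        using N0[OF N] K by (intro add_left_mono mult_left_mono) auto
      also have "\<dots> < \<eta> / 2 + (K + 1) * (\<eta> / (2 * (K + 1)))"
        using \<eta> K by (intro add_strict_left_mono mult_strict_right_mono) auto
      also have "\<dots> = \<eta>" using K by (simp add: field_simps)
      finally show ?thesis by (simp add: divide_right_mono)
    qed
    thus "\<exists>N0. \<forall>N\<ge>N0. norm (A N / of_nat (N + 1) - tr N / of_nat (N + 1) - 0) < \<eta>" by auto
  qed
  from tendsto_diff[OF A_lim diff] show ?thesis by (simp add: tr_def)
qed

end

section \<open>The distribution of the eigenvalues\<close>

theorem theorem3p4:
  fixes c :: "nat \<Rightarrow> real" and R :: ereal and \<mu> :: "real \<Rightarrow> real"
    and \<sigma> :: "complex \<Rightarrow> real" and \<sigma>' :: "real \<Rightarrow> real" and \<psi> :: "real \<Rightarrow> complex"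
  assumes c_pos: "\<And>n. c n > 0"
    and ratio_mono: "monoseq (\<lambda>n. c (Suc n) / c n)"
    and ratio_lim: "(\<lambda>n. ereal (c (Suc n) / c n)) \<longlonglongrightarrow> R"
    and R_pos: "0 < R"
    and mu_meas: "\<mu> \<in> borel_measurable borel"
    and mu_nonneg: "\<And>r. 0 \<le> \<mu> r"
    and mu_finite: "finite_measure (density lborel (\<lambda>r. ennreal (\<mu> r)))"
    and mu_support: "msupport (density lborel (\<lambda>r. ennreal (\<mu> r))) = radii R"
    and moments_int: "\<And>n. set_integrable lborel (radii R) (\<lambda>r. r ^ n * \<mu> r)"
    and moments: "\<And>n. c n = (LINT r:radii R|lborel. r ^ n * \<mu> r)"
    and infinite_radius: "R = \<infinity> \<Longrightarrow>
      (\<forall>m::nat. (\<lambda>l. c (2 * l + m + 1) / (sqrt (c (2 * l + 2 * m + 1)) * sqrt (c (2 * l + 1))))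
         \<longlonglongrightarrow> 1)"
    and sigma_meas: "\<sigma> \<in> borel_measurable (lebesgue_on (disc R))"
    and sigma_bdd: "bounded (\<sigma> ` disc R)"
    and sigma_lim: "has_radial_limit R \<sigma> \<sigma>'"
    and psi_cont: "continuous_on {Inf (\<sigma> ` disc R)..Sup (\<sigma> ` disc R)} \<psi>"
  shows "(\<lambda>N. trace_KN c \<mu> R N
             (fun_calc (radial_measure \<mu> R) (KN c R N) \<psi> (compression c \<mu> R \<sigma> N))
           / of_nat (N + 1))
         \<longlonglongrightarrow> (LINT \<theta>:{0..2 * pi}|lebesgue. \<psi> (\<sigma>' \<theta>)) / complex_of_real (2 * pi)"
proof -
  define lo where "lo = Inf (\<sigma> ` disc R)"
  define hi where "hi = Sup (\<sigma> ` disc R)"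
  have range: "\<sigma> z \<in> {lo..hi}" if "z \<in> disc R" for z
    using that sigma_bdd unfolding lo_def hi_def
    by (auto intro!: cInf_lower cSup_upper bounded_imp_bdd_below bounded_imp_bdd_above)
  interpret radial_symbol c R \<mu> \<sigma> lo hi
    by unfold_locales (fact c_pos ratio_lim R_pos mu_meas mu_nonneg moments_int moments infinite_radius sigma_meas range)+
  have cont: "continuous_on {lo..hi} \<psi>" using psi_cont by (simp add: lo_def hi_def)
  let ?U = "lebesgue_on {0..2 * pi}"
  \<comment> \<open>A radial limit is a limit of values of \<open>\<sigma>\<close>, so clipping changes it only on a null set of angles.\<close>
  have "AE \<theta> in lebesgue. \<theta> \<noteq> 2 * pi" by (rule AE_completion[OF AE_lborel_singleton])
  hence "AE \<theta> in lebesgue. \<theta> \<in> {0..2 * pi} \<longrightarrow> \<sigma>' \<theta> \<in> {lo..hi}"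
    using sigma_lim unfolding has_radial_limit_def
  proof eventually_elim
    case (elim \<theta>)
    show ?case
    proof
      assume "\<theta> \<in> {0..2 * pi}"
      with elim have lim: "((\<lambda>r. complex_of_real (\<sigma> (rcis r \<theta>))) \<longlongrightarrow> of_real (\<sigma>' \<theta>)) (to_radius R)"
        by (auto intro: tendsto_of_real)
      show "\<sigma>' \<theta> \<in> {lo..hi}"
      proof (rule ccontr)
        assume "\<sigma>' \<theta> \<notin> {lo..hi}"
        hence "infdist (\<sigma>' \<theta>) {lo..hi} > 0"
          using lo_le_hi by (subst infdist_pos_not_in_closed) auto
        from radial_limit_near_boundary[OF lim this] obtain r0 where r0: "0 < r0" "ereal r0 < R"
          and near: "\<And>r. r0 < r \<Longrightarrow> ereal r < R \<Longrightarrow>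
            cmod (complex_of_real (\<sigma> (rcis r \<theta>)) - of_real (\<sigma>' \<theta>)) < infdist (\<sigma>' \<theta>) {lo..hi}" by blast
        obtain r where r: "ereal r0 < ereal r" "ereal r < R" using ereal_dense2[OF r0(2)] by blast
        have "\<sigma> (rcis r \<theta>) \<in> {lo..hi}" using r r0 by (intro range) (simp add: disc_def)
        hence "infdist (\<sigma>' \<theta>) {lo..hi} \<le> dist (\<sigma>' \<theta>) (\<sigma> (rcis r \<theta>))" by (rule infdist_le)
        moreover have "cmod (complex_of_real (\<sigma> (rcis r \<theta>)) - of_real (\<sigma>' \<theta>)) = dist (\<sigma>' \<theta>) (\<sigma> (rcis r \<theta>))"
          unfolding of_real_diff[symmetric] norm_of_real by (simp add: dist_real_def)
        ultimately show False using near[of r] r by simp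
      qed
    qed
  qed
  hence ae: "AE \<theta> in lebesgue. (if \<theta> \<in> {0..2 * pi} then \<psi> (clip (\<sigma>' \<theta>)) else 0) =
      (if \<theta> \<in> {0..2 * pi} then \<psi> (\<sigma>' \<theta>) else 0)"
    by (auto elim!: eventually_mono simp: clip_id)
  have m1: "(\<lambda>\<theta>. \<psi> (clip (\<sigma>' \<theta>))) \<in> borel_measurable ?U"
    by (rule continuous_symbol_limit(1)[OF sigma_lim cont])
  hence "(\<lambda>\<theta>. if \<theta> \<in> {0..2 * pi} then \<psi> (clip (\<sigma>' \<theta>)) else 0) \<in> borel_measurable lebesgue"
    by (subst borel_measurable_if) auto
  from borel_measurable_AE[OF this ae] have m2: "(\<lambda>\<theta>. \<psi> (\<sigma>' \<theta>)) \<in> borel_measurable ?U"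
    by (subst (asm) borel_measurable_if) auto
  have ae': "AE \<theta> in ?U. \<psi> (\<sigma>' \<theta>) = \<psi> (clip (\<sigma>' \<theta>))"
    using ae by (subst AE_restrict_space_iff) (auto elim!: eventually_mono)
  have "(LINT \<theta>:{0..2 * pi}|lebesgue. \<psi> (\<sigma>' \<theta>)) = (LINT \<theta>|?U. \<psi> (\<sigma>' \<theta>))"
    unfolding set_lebesgue_integral_def by (rule integral_restrict_space[symmetric]) auto
  also have "\<dots> = (LINT \<theta>|?U. \<psi> (clip (\<sigma>' \<theta>)))"
    by (rule integral_cong_AE[OF m2 m1 ae'])
  finally show ?thesis using spectral_average_limit[OF sigma_lim cont] by simp
qed

end
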